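(* Let $G$ be a finite simple graph with maximum degree $\Delta\ge 6$. If $\mathrm{mad}(G)<2+\frac{4\Delta-8}{5\Delta+2}$, then $\chi_\ell(G^2)=\Delta+1$. In particular, if $G$ is planar (with maximum degree $\Delta \ge 6$) and has girth $g\ge 7+\frac{12}{\Delta-2}$, then $\chi_\ell(G^2)=\Delta+1$.
   Context: Graphs are finite and simple. The square $G^2$ of a graph $G$ has vertex set $V(G)$, with two distinct vertices adjacent in $G^2$ iff their distance in $G$ is at most $2$. The maximum average degree is $\mathrm{mad}(G)=\max_{H\subseteq G}\frac{2|E(H)|}{|V(H)|}$, the maximum over all (nonempty) subgraphs $H$ of $G$. A list-assignment $L$ gives each vertex $v$ a set $L(v)$ of colors; an $L$-coloring is a proper coloring in which each vertex $v$ gets a color from $L(v)$. The choice number $\chi_\ell(H)$ of a graph $H$ is the minimum $k$ such that $H$ has an $L$-coloring for every list-assignment $L$ with $|L(v)|\ge k$ for every vertex $v$. *)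

theory Defs
  imports "HOL-Analysis.Analysis"
begin

text \<open>A graph is given by its vertex set \<open>V\<close> and its set \<open>E\<close> of edges, each edge being
  the two-element set of its ends.\<close>

definition simple_graph :: "'a set \<Rightarrow> 'a set set \<Rightarrow> bool" where
  "simple_graph V E \<longleftrightarrow> finite V \<and> (\<forall>e\<in>E. e \<subseteq> V \<and> card e = 2)"

definition subgraph :: "'a set \<Rightarrow> 'a set set \<Rightarrow> 'a set \<Rightarrow> 'a set set \<Rightarrow> bool" where
  "subgraph W F V E \<longleftrightarrow> simple_graph W F \<and> W \<subseteq> V \<and> F \<subseteq> E"

definition degree :: "'a set set \<Rightarrow> 'a \<Rightarrow> nat" where
  "degree E v = card {e \<in> E. v \<in> e}"

text \<open>The inserted \<open>0\<close> only matters for the graph without vertices.\<close>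

definition max_degree :: "'a set \<Rightarrow> 'a set set \<Rightarrow> nat" where
  "max_degree V E = Max (insert 0 (degree E ` V))"

definition mad :: "'a set \<Rightarrow> 'a set set \<Rightarrow> real" where
  "mad V E = Max {2 * real (card F) / real (card W) | W F. subgraph W F V E \<and> W \<noteq> {}}"

definition walk :: "'a set \<Rightarrow> 'a set set \<Rightarrow> 'a list \<Rightarrow> bool" where
  "walk V E xs \<longleftrightarrow> xs \<noteq> [] \<and> set xs \<subseteq> V \<and>
     (\<forall>i. Suc i < length xs \<longrightarrow> {xs ! i, xs ! Suc i} \<in> E)"

text \<open>Distance and girth are \<open>\<infinity>\<close> if there is no connecting walk, respectively no cycle
  (infimum of the empty set in \<^typ>\<open>enat\<close>).\<close>

definition distance :: "'a set \<Rightarrow> 'a set set \<Rightarrow> 'a \<Rightarrow> 'a \<Rightarrow> enat" where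
  "distance V E u v = Inf {enat (length xs - 1) | xs. walk V E xs \<and> hd xs = u \<and> last xs = v}"

definition square_edges :: "'a set \<Rightarrow> 'a set set \<Rightarrow> 'a set set" where
  "square_edges V E = {{u, v} | u v. u \<in> V \<and> v \<in> V \<and> u \<noteq> v \<and> distance V E u v \<le> 2}"

definition graph_cycle :: "'a set \<Rightarrow> 'a set set \<Rightarrow> 'a list \<Rightarrow> bool" where
  "graph_cycle V E c \<longleftrightarrow> walk V E c \<and> distinct c \<and> 3 \<le> length c \<and> {last c, hd c} \<in> E"

definition girth :: "'a set \<Rightarrow> 'a set set \<Rightarrow> enat" where
  "girth V E = Inf {enat (length c) | c. graph_cycle V E c}"

definition L_coloring :: "'a set \<Rightarrow> 'a set set \<Rightarrow> ('a \<Rightarrow> 'c set) \<Rightarrow> ('a \<Rightarrow> 'c) \<Rightarrow> bool" where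
  "L_coloring V E L f \<longleftrightarrow> (\<forall>v\<in>V. f v \<in> L v) \<and> (\<forall>u v. {u, v} \<in> E \<longrightarrow> f u \<noteq> f v)"

text \<open>Colors are natural numbers, which is no restriction for finite graphs. Lists may be infinite,
  and are then larger than any \<open>k\<close>; \<^const>\<open>card\<close> would give \<open>0\<close>.\<close>

definition choosable :: "'a set \<Rightarrow> 'a set set \<Rightarrow> nat \<Rightarrow> bool" where
  "choosable V E k \<longleftrightarrow>
     (\<forall>L :: 'a \<Rightarrow> nat set. (\<forall>v\<in>V. infinite (L v) \<or> k \<le> card (L v)) \<longrightarrow> (\<exists>f. L_coloring V E L f))"

definition choice_number :: "'a set \<Rightarrow> 'a set set \<Rightarrow> nat" where
  "choice_number V E = (LEAST k. choosable V E k)"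

text \<open>Planarity is existence of a topological drawing: vertices are distinct points of the plane,
  edges are simple arcs joining their ends, and the interior of an edge meets no vertex and no
  other edge. The plane is \<^typ>\<open>complex\<close>, as in the Jordan curve theorem of the library.\<close>

definition plane_drawing ::
    "'a set \<Rightarrow> 'a set set \<Rightarrow> ('a \<Rightarrow> complex) \<Rightarrow> ('a set \<Rightarrow> real \<Rightarrow> complex) \<Rightarrow> bool" where
  "plane_drawing V E p \<gamma> \<longleftrightarrow>
     inj_on p V \<and>
     (\<forall>e\<in>E. arc (\<gamma> e) \<and> {pathstart (\<gamma> e), pathfinish (\<gamma> e)} = p ` e) \<and>
     (\<forall>e\<in>E. (path_image (\<gamma> e) - p ` e) \<inter> p ` V = {}) \<and>
     (\<forall>e\<in>E. \<forall>f\<in>E. e \<noteq> f \<longrightarrow> (path_image (\<gamma> e) - p ` e) \<inter> path_image (\<gamma> f) = {})"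

definition planar :: "'a set \<Rightarrow> 'a set set \<Rightarrow> bool" where
  "planar V E \<longleftrightarrow> (\<exists>p \<gamma>. plane_drawing V E p \<gamma>)"

end

theory Submission
  imports Defs "HOL-Complex_Analysis.Winding_Numbers"
begin

text \<open>
  The closed neighbourhood of a vertex of maximum degree is a clique of the square, which gives the
  lower bound. For the upper bound, colours of a minimal counterexample can be erased and chosen
  again near any vertex with few vertices at distance at most two. This rules out local
  configurations of vertices of degree two, and, because even cycles are 2-choosable, also that the
  paths consisting of three vertices of degree two outnumber the vertices of degree \<open>\<Delta>\<close>. Discharging
  then shows that the average degree is too large.

  For plane graphs, call a cycle facial if no path of the graph splits its inside. The theorem on
  theta curves shows that the facial cycles generate the cycle space, so there are at least
  \<open>|E| - |V| + 1\<close> of them, and a winding number argument shows that an edge lies on at most two.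
  Counting the edges of facial cycles bounds \<open>|E|\<close> in terms of the girth, without Euler's formula.
\<close>

subsection \<open>Squares of graphs\<close>

text \<open>The obstacle is that the square of an induced subgraph may lack edges of the square of
  the whole graph: two vertices whose only common neighbour is deleted may get the same colour. No
  harm is done if every deleted vertex has at most one neighbour whose colour is kept, and this is
  why the configurations are built around vertices of degree two. The number (4\<Delta> -
  8)/(5\<Delta> + 2) solves two balance equations. In one, a vertex of degree \<Delta> feeds
  \<Delta> neighbours of degree two, which pass on what they do not need, and pays in addition for
  one middle vertex of a thread. In the other, a vertex of degree 3 with one neighbour of degree at
  least \<Delta> - 1 feeds two neighbours of degree two whose second neighbours also have degree
  two. Which vertex of degree \<Delta> pays for which middle vertex is never decided; only their
  numbers are compared. The girth bound g = 7 + 12/(\<Delta> - 2) is the solution of 2g/(g - 2) = 2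
  + (4\<Delta> - 8)/(5\<Delta> + 2).\<close>

definition nbrs :: "'a set set \<Rightarrow> 'a \<Rightarrow> 'a set" where
  "nbrs E v = {u. {u, v} \<in> E}"

text \<open>Adjacency in the square, stated without vertex set and walks, so that it can be used for
  any set of edges.\<close>

definition near :: "'a set set \<Rightarrow> 'a \<Rightarrow> 'a \<Rightarrow> bool" where
  "near E u v \<longleftrightarrow> u \<noteq> v \<and> (u \<in> nbrs E v \<or> (\<exists>w. u \<in> nbrs E w \<and> w \<in> nbrs E v))"

lemma nbrs_commute: "u \<in> nbrs E v \<longleftrightarrow> v \<in> nbrs E u"
  by (simp add: nbrs_def insert_commute)

lemma near_commute: "near E u v \<longleftrightarrow> near E v u"
  unfolding near_def by (metis nbrs_commute)

lemma nbrs_in: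
  assumes "simple_graph V E" "u \<in> nbrs E v"
  shows "u \<in> V" "v \<in> V" "u \<noteq> v"
  using assms by (auto simp: simple_graph_def nbrs_def)

lemma nbrs_subset: "simple_graph V E \<Longrightarrow> nbrs E v \<subseteq> V"
  using nbrs_in(1) by fast

lemma finite_nbrs: "simple_graph V E \<Longrightarrow> finite (nbrs E v)"
  by (meson finite_subset nbrs_subset simple_graph_def)

lemma simple_graph_finite:
  assumes "simple_graph V E"
  shows "finite V" "finite E"
proof -
  show "finite V" using assms by (simp add: simple_graph_def)
  moreover have "E \<subseteq> Pow V" using assms by (auto simp: simple_graph_def)
  ultimately show "finite E" by (meson finite_Pow_iff finite_subset)
qed

lemma edge_cases:
  assumes "simple_graph V E" "e \<in> E" "v \<in> e"
  obtains u where "e = {u, v}" "u \<noteq> v" "u \<in> V"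
proof -
  have "card e = 2" "e \<subseteq> V" using assms by (auto simp: simple_graph_def)
  then obtain x y where "e = {x, y}" "x \<noteq> y" by (meson card_2_iff)
  with assms(3) \<open>e \<subseteq> V\<close> show thesis using that by (cases "v = x") (auto simp: insert_commute)
qed

lemma degree_eq_card_nbrs:
  assumes "simple_graph V E"
  shows "Defs.degree E v = card (nbrs E v)"
proof -
  have "bij_betw (\<lambda>u. {u, v}) (nbrs E v) {e \<in> E. v \<in> e}"
    unfolding bij_betw_def
  proof
    show "inj_on (\<lambda>u. {u, v}) (nbrs E v)" by (auto simp: inj_on_def doubleton_eq_iff)
    show "(\<lambda>u. {u, v}) ` nbrs E v = {e \<in> E. v \<in> e}"
    proof (intro equalityI subsetI)
      fix e assume e: "e \<in> {e \<in> E. v \<in> e}"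
      then obtain u where "e = {u, v}" using edge_cases[OF assms, of e v] by blast
      with e show "e \<in> (\<lambda>u. {u, v}) ` nbrs E v" by (auto simp: nbrs_def)
    qed (auto simp: nbrs_def)
  qed
  then show ?thesis unfolding Defs.degree_def by (metis bij_betw_same_card)
qed

lemma handshake:
  assumes "simple_graph V E"
  shows "(\<Sum>v\<in>V. card (nbrs E v)) = 2 * card E"
proof -
  note fin = simple_graph_finite[OF assms]
  have "(\<Sum>v\<in>V. card (nbrs E v)) = (\<Sum>v\<in>V. card {e \<in> E. v \<in> e})"
    using degree_eq_card_nbrs[OF assms, unfolded Defs.degree_def] by (intro sum.cong) auto
  also have "\<dots> = 2 * card E"
  proof (rule sum_multicount[OF fin])
    show "\<forall>e\<in>E. card {v \<in> V. v \<in> e} = 2"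
    proof
      fix e assume "e \<in> E"
      then have sub: "e \<subseteq> V" and "card e = 2" using assms by (auto simp: simple_graph_def)
      from sub have "{v \<in> V. v \<in> e} = e" by blast
      with \<open>card e = 2\<close> show "card {v \<in> V. v \<in> e} = 2" by presburger
    qed
  qed
  finally show ?thesis .
qed

lemma walk_singleton [simp]: "walk V E [x] \<longleftrightarrow> x \<in> V"
  by (simp add: walk_def)

lemma walk_Cons_Cons [simp]:
  "walk V E (x # y # zs) \<longleftrightarrow> x \<in> V \<and> {x, y} \<in> E \<and> walk V E (y # zs)"
proof -
  have "(\<forall>i. Q i) \<longleftrightarrow> Q 0 \<and> (\<forall>i. Q (Suc i))" for Q :: "nat \<Rightarrow> bool"
    by (metis not0_implies_Suc)
  from this[of "\<lambda>i. Suc i < length (x # y # zs) \<longrightarrow> {(x # y # zs) ! i, (x # y # zs) ! Suc i} \<in> E"]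
  show ?thesis by (simp only: walk_def) auto
qed

lemma distance_le_2_iff:
  assumes "simple_graph V E" "u \<in> V" "v \<in> V" "u \<noteq> v"
  shows "distance V E u v \<le> 2 \<longleftrightarrow> near E u v"
proof
  let ?S = "{enat (length xs - 1) | xs. walk V E xs \<and> hd xs = u \<and> last xs = v}"
  assume le: "distance V E u v \<le> 2"
  have "?S \<noteq> {}"
  proof
    assume "?S = {}"
    then have "distance V E u v = \<infinity>" unfolding distance_def by (simp only: Inf_enat_def) simp
    with le show False by simp
  qed
  \<comment> \<open>A nonempty set of \<open>enat\<close> attains its infimum, so there is a
    shortest walk.\<close>
  then have "Inf ?S \<in> ?S" unfolding Inf_enat_def by (metis (mono_tags) LeastI ex_in_conv)
  then obtain xs where xs: "walk V E xs" "hd xs = u" "last xs = v"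
    "distance V E u v = enat (length xs - 1)"
    unfolding distance_def by blast
  have "enat (length xs - 1) \<le> enat 2" using le xs(4) by (metis numeral_eq_enat)
  then have len: "length xs \<le> 3" by simp
  have ne: "xs \<noteq> []" using xs by (auto simp: walk_def)
  obtain x ys where xy: "xs = x # ys" using ne by (cases xs) auto
  obtain y zs where yz: "xs = x # y # zs" using xy xs assms by (cases ys) auto
  show "near E u v"
  proof (cases zs)
    case Nil
    with xs(1) yz have "{x, y} \<in> E" by simp
    with Nil yz xs assms show ?thesis by (auto simp: near_def nbrs_def)
  next
    case (Cons z zs')
    with len yz have c: "xs = [x, y, z]" by simp
    with xs(1) have "{x, y} \<in> E" "{y, z} \<in> E" by auto
    with c xs assms show ?thesis by (auto simp: near_def nbrs_def)
  qed
next
  assume n: "near E u v"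
  have key: "distance V E u v \<le> 2"
    if "walk V E xs" "hd xs = u" "last xs = v" "length xs \<le> 3" for xs
  proof -
    have "distance V E u v \<le> enat (length xs - 1)"
      unfolding distance_def using that by (intro Inf_lower) blast
    also have "\<dots> \<le> enat 2" using that by simp
    finally show ?thesis by (simp add: numeral_eq_enat)
  qed
  from n consider "{u, v} \<in> E" | w where "{u, w} \<in> E" "{w, v} \<in> E"
    by (auto simp: near_def nbrs_def)
  then show "distance V E u v \<le> 2"
  proof cases
    case 1
    then show ?thesis using key[of "[u, v]"] assms by simp
  next
    case 2
    then have "w \<in> V" using assms(1) by (auto simp: simple_graph_def)
    then show ?thesis using key[of "[u, w, v]"] 2 assms by simp
  qed
qed

lemma square_edges_iff:
  assumes "simple_graph V E"
  shows "{u, v} \<in> square_edges V E \<longleftrightarrow> near E u v"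
proof -
  have V: "u \<in> V" "v \<in> V" "u \<noteq> v" if "near E u v"
    using that nbrs_in[OF assms] by (auto simp: near_def)
  have "{u, v} \<in> square_edges V E \<longleftrightarrow> u \<in> V \<and> v \<in> V \<and> u \<noteq> v \<and> near E u v"
    unfolding square_edges_def using distance_le_2_iff[OF assms] near_commute[of E u v]
    by (auto simp: doubleton_eq_iff) 
  then show ?thesis using V by blast
qed

subsection \<open>Reducible configurations\<close>

text \<open>\<open>X\<close> and \<open>E\<close> are independent. With all edges this is a partial
  colouring of the square, where common neighbours outside \<open>X\<close> count; with
  \<open>E \<inter> Pow X\<close> it is a colouring of the square of the induced subgraph, which is
  weaker.\<close>

definition sq_coloring :: "'a set \<Rightarrow> 'a set set \<Rightarrow> ('a \<Rightarrow> 'c set) \<Rightarrow> ('a \<Rightarrow> 'c) \<Rightarrow> bool" where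
  "sq_coloring X E L f \<longleftrightarrow> (\<forall>v\<in>X. f v \<in> L v) \<and> (\<forall>u\<in>X. \<forall>v\<in>X. near E u v \<longrightarrow> f u \<noteq> f v)"

text \<open>A minimal counterexample. \<Delta> is an upper bound for the degrees and need not be
  attained, so that induced subgraphs are covered by the same assumptions.\<close>

locale critical =
  fixes V :: "'a set" and E :: "'a set set" and \<Delta> :: nat and L :: "'a \<Rightarrow> 'c set"
  assumes graph: "simple_graph V E"
    and deg_le: "card (nbrs E v) \<le> \<Delta>"
    and \<Delta>6: "6 \<le> \<Delta>"
    and lists: "v \<in> V \<Longrightarrow> \<Delta> < card (L v)"
    and smaller: "X \<subset> V \<Longrightarrow> \<exists>f. sq_coloring X (E \<inter> Pow X) L f"
    and not_colorable: "\<not> sq_coloring V E L f"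
begin

abbreviation N where "N \<equiv> nbrs E"

definition d where "d v = card (N v)"

definition sqN where "sqN v = {u. near E u v}"

lemma card_le_Un: "X \<subseteq> A \<union> B \<Longrightarrow> finite A \<Longrightarrow> finite B \<Longrightarrow> card X \<le> card A + card B"
  by (meson card_Un_le card_mono finite_UnI le_trans)

lemma card_Un3_le: "card (A \<union> B \<union> C) \<le> card A + card B + card C"
  using card_Un_le[of "A \<union> B" C] card_Un_le[of A B] by linarith

lemma finite_N [simp]: "finite (N v)"
  using finite_nbrs[OF graph] .

lemma finV: "finite V" using simple_graph_finite[OF graph] by simp

lemma N_sym: "u \<in> N v \<Longrightarrow> v \<in> N u" by (simp add: nbrs_commute)

lemma N_irrefl [simp]: "v \<notin> N v" using nbrs_in(3)[OF graph] by blast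

lemma N_V: "u \<in> N v \<Longrightarrow> u \<in> V" using nbrs_in[OF graph] by blast

lemma d_le: "d v \<le> \<Delta>" using deg_le by (simp add: d_def)

lemma sqN_eq: "sqN v = (N v \<union> (\<Union>n\<in>N v. N n)) - {v}"
  unfolding sqN_def near_def by auto

lemma finite_sqN [simp]: "finite (sqN v)"
  by (simp add: sqN_eq)

section \<open>Extending partial colourings of the square\<close>

lemma extend:
  assumes f: "sq_coloring X E L f" and v: "v \<in> V" "v \<notin> X" and c: "card (sqN v \<inter> X) \<le> \<Delta>"
  shows "\<exists>f. sq_coloring (insert v X) E L f"
proof -
  have "card (f ` (sqN v \<inter> X)) < card (L v)"
    using card_image_le[of "sqN v \<inter> X" f] c lists[OF v(1)] by auto
  then have "\<not> L v \<subseteq> f ` (sqN v \<inter> X)"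
    by (metis card_mono finite_Int finite_imageI finite_sqN leD)
  then obtain a where a: "a \<in> L v" "a \<notin> f ` (sqN v \<inter> X)" by blast
  have "sq_coloring (insert v X) E L (f(v := a))"
    unfolding sq_coloring_def
  proof (intro conjI ballI impI)
    fix x y assume xy: "x \<in> insert v X" "y \<in> insert v X" "near E x y"
    then have "x \<noteq> y" by (simp add: near_def)
    with xy a f v near_commute[of E x y] show "(f(v := a)) x \<noteq> (f(v := a)) y"
      by (auto simp: sq_coloring_def sqN_def)
  qed (use f v a in \<open>auto simp: sq_coloring_def\<close>)
  then show ?thesis by blast
qed

lemma sq_coloring_subset: "sq_coloring X E L f \<Longrightarrow> Y \<subseteq> X \<Longrightarrow> sq_coloring Y E L f"
  unfolding sq_coloring_def by blast

lemma extend_card: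
  assumes f: "sq_coloring X E L f" and v: "v \<in> V" and c: "card (sqN v \<inter> X) \<le> \<Delta>"
  shows "\<exists>f. sq_coloring (insert v X) E L f"
  using extend[OF f v] c f by (cases "v \<in> X") (auto simp: insert_absorb)

text \<open>A bound on the whole square neighbourhood holds whatever is already coloured, so these
  vertices can come last and in any order.\<close>

lemma free_set:
  assumes f: "sq_coloring (V - A) E L f" and A: "\<And>a. a \<in> A \<Longrightarrow> card (sqN a) \<le> \<Delta>"
  shows False
proof -
  have "\<exists>f. sq_coloring ((V - A) \<union> B) E L f" if "finite B" "B \<subseteq> A \<inter> V" for B
    using that
  proof (induction B rule: finite_induct)
    case empty
    then show ?case using f by auto
  next
    case (insert b B)
    then obtain g where "sq_coloring ((V - A) \<union> B) E L g" by auto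
    moreover have "card (sqN b \<inter> ((V - A) \<union> B)) \<le> \<Delta>"
      using A[of b] insert.prems card_mono[of "sqN b" "sqN b \<inter> ((V - A) \<union> B)"] by auto
    ultimately show ?case using extend_card[of "(V - A) \<union> B" g b] insert.prems by simp
  qed
  from this[of "A \<inter> V"] obtain f where "sq_coloring ((V - A) \<union> (A \<inter> V)) E L f"
    using finV by auto
  moreover have "(V - A) \<union> (A \<inter> V) = V" by blast
  ultimately show False using not_colorable by metis
qed

text \<open>The list is the order of recolouring: when \<open>s\<close> gets its colour, the later
  entries \<open>ss\<close> and the vertices of \<open>A\<close> are still uncoloured and do not
  count.\<close>

fun greedy :: "'a set \<Rightarrow> 'a list \<Rightarrow> bool" where
  "greedy A [] \<longleftrightarrow> True"
| "greedy A (s # ss) \<longleftrightarrow> card (sqN s - set ss - A) \<le> \<Delta> \<and> greedy A ss"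

lemma greedy_extend:
  assumes "sq_coloring (V - set ss - A) E L f" "greedy A ss" "set ss \<subseteq> V"
    and A: "\<And>a. a \<in> A \<Longrightarrow> card (sqN a) \<le> \<Delta>"
  shows False
  using assms(1-3)
proof (induction ss arbitrary: f)
  case Nil
  then show ?case using free_set[OF _ A] by simp
next
  case (Cons s ss)
  have "card (sqN s \<inter> (V - set (s # ss) - A)) \<le> card (sqN s - set ss - A)"
    by (intro card_mono) auto
  also have "\<dots> \<le> \<Delta>" using Cons.prems by simp
  finally obtain g where "sq_coloring (insert s (V - set (s # ss) - A)) E L g"
    using extend_card[OF Cons.prems(1), of s] Cons.prems by auto
  then have "sq_coloring (V - set ss - A) E L g"
    by (rule sq_coloring_subset) auto
  then show ?case using Cons by auto
qed

text \<open>Deleting \<open>D\<close> destroys only those adjacencies of the square that pass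
  through a vertex of \<open>D\<close> or end in it. By \<open>one\<close> such a vertex has at most
  one neighbour outside \<open>S\<close>, so no pair in \<open>V - S\<close> loses its
  adjacency.\<close>

lemma uncolor:
  assumes D: "D \<noteq> {}" "D \<subseteq> S" "S \<subseteq> V"
    and one: "\<And>w u v. w \<in> D \<Longrightarrow> u \<in> N w - S \<Longrightarrow> v \<in> N w - S \<Longrightarrow> u = v"
  shows "\<exists>f. sq_coloring (V - S) E L f"
proof -
  have "V - D \<subset> V" using D by auto
  then obtain f where f: "sq_coloring (V - D) (E \<inter> Pow (V - D)) L f" using smaller by blast
  have "near (E \<inter> Pow (V - D)) u v" if uv: "u \<in> V - S" "v \<in> V - S" "near E u v" for u v
  proof -
    have edge: "x \<in> nbrs (E \<inter> Pow (V - D)) y" if "x \<in> N y" "x \<in> V - D" "y \<in> V - D" for x y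
      using that by (auto simp: nbrs_def)
    consider "u \<in> N v" | w where "u \<in> N w" "w \<in> N v" using uv by (auto simp: near_def)
    then show ?thesis
    proof cases
      case 1
      then show ?thesis using edge[of u v] uv D by (auto simp: near_def)
    next
      case 2
      have "w \<notin> D"
      proof
        assume "w \<in> D"
        then have "u = v" using one[of w u v] uv 2 N_sym by blast
        then show False using uv by (simp add: near_def)
      qed
      then show ?thesis using edge[of u w] edge[of w v] 2 uv D N_V[of w v] by (auto simp: near_def)
    qed
  qed
  with f D have "sq_coloring (V - S) E L f" unfolding sq_coloring_def by blast
  then show ?thesis by blast
qed

text \<open>The common form of the greedy reductions: delete \<open>D\<close>, erase the colours of
  \<open>ss\<close> and \<open>A\<close>, recolour \<open>ss\<close> in the order of the list and
  \<open>A\<close> at the end.\<close>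

lemma reducible:
  assumes "D \<noteq> {}" "D \<subseteq> set ss \<union> A" "set ss \<union> A \<subseteq> V"
    and "\<And>w u v. w \<in> D \<Longrightarrow> u \<in> N w - (set ss \<union> A) \<Longrightarrow> v \<in> N w - (set ss \<union> A) \<Longrightarrow> u = v"
    and "greedy A ss" and A: "\<And>a. a \<in> A \<Longrightarrow> card (sqN a) \<le> \<Delta>"
  shows False
proof -
  have "\<exists>f. sq_coloring (V - (set ss \<union> A)) E L f"
    by (rule uncolor[of D]) (fact assms)+
  moreover have "V - (set ss \<union> A) = V - set ss - A" by auto
  ultimately obtain f where "sq_coloring (V - set ss - A) E L f" by auto
  then show False using greedy_extend[OF _ \<open>greedy A ss\<close> _ A] assms(3) by blast
qed

section \<open>Sizes of square neighbourhoods\<close>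

lemma card_N_minus: "n \<in> N v \<Longrightarrow> card (N v - {n}) = d v - 1"
  by (simp add: d_def)

lemma card_sqN_minus_le:
  assumes "U \<subseteq> N v"
  shows "card (sqN v - U) \<le> (d v - card U) + (\<Sum>n\<in>N v. d n - 1)"
proof -
  have "sqN v - U \<subseteq> (N v - U) \<union> (\<Union>n\<in>N v. N n - {v})"
    unfolding sqN_eq by auto
  then have "card (sqN v - U) \<le> card ((N v - U) \<union> (\<Union>n\<in>N v. N n - {v}))"
    by (intro card_mono) auto
  also have "\<dots> \<le> card (N v - U) + card (\<Union>n\<in>N v. N n - {v})" by (rule card_Un_le)
  also have "card (\<Union>n\<in>N v. N n - {v}) \<le> (\<Sum>n\<in>N v. card (N n - {v}))" by (rule card_UN_le) simp
  also have "(\<Sum>n\<in>N v. card (N n - {v})) = (\<Sum>n\<in>N v. d n - 1)"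
    using N_sym by (intro sum.cong refl card_N_minus)
  also have "card (N v - U) = d v - card U"
    unfolding d_def using assms by (meson card_Diff_subset finite_N finite_subset)
  finally show ?thesis by simp
qed

text \<open>A single neighbour contributes itself and at most \<Delta> - 1 further vertices, so a
  vertex of degree at most 1 can be deleted and coloured last.\<close>

lemma d_ge_2: assumes "v \<in> V" shows "2 \<le> d v"
proof (rule ccontr)
  assume "\<not> 2 \<le> d v"
  then have "card (N v) \<le> Suc 0" by (simp add: d_def)
  then have one: "\<And>x y. x \<in> N v \<Longrightarrow> y \<in> N v \<Longrightarrow> x = y" by (simp add: card_le_Suc0_iff_eq)
  have "card (sqN v) \<le> d v + (\<Sum>n\<in>N v. d n - 1)" using card_sqN_minus_le[of "{}" v] by simp
  also have "\<dots> \<le> \<Delta>"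
  proof (cases "N v = {}")
    case True
    then show ?thesis by (simp add: d_def)
  next
    case False
    then obtain n where n: "N v = {n}" using one by blast
    then show ?thesis using d_le[of n] N_sym[of n v] \<Delta>6 
      by (auto simp: d_def)
  qed
  finally have "card (sqN v) \<le> \<Delta>" .
  then show False using reducible[of "{v}" "[]" "{v}"] assms one by auto
qed

text \<open>Determined only if \<open>d n = 2\<close> and \<open>y\<close> is a neighbour of
  \<open>n\<close>; it then allows threads to be followed vertex by vertex.\<close>

definition other where "other n y = (SOME z. z \<in> N n - {y})"

lemma other:
  assumes "d n = 2" "y \<in> N n"
  shows "N n = {y, other n y}" "other n y \<noteq> y" "other n y \<in> N n" "n \<in> N (other n y)" "other n y \<noteq> n"
    "other n (other n y) = y"
proof -
  obtain p q where pq: "N n = {p, q}" "p \<noteq> q" using assms(1) by (auto simp: d_def card_2_iff)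
  then have ne: "N n - {y} \<noteq> {}" by auto
  then have o: "other n y \<in> N n - {y}" unfolding other_def by (rule some_in_eq[THEN iffD2])
  then show 1: "N n = {y, other n y}" "other n y \<noteq> y" "other n y \<in> N n" using pq assms(2) by auto
  then show "n \<in> N (other n y)" using N_sym by blast
  show "other n y \<noteq> n" using 1 N_irrefl by metis
  have "N n - {other n y} \<noteq> {}" using 1 by auto
  then have "other n (other n y) \<in> N n - {other n y}" unfolding other_def[of n "other n y"] by (rule some_in_eq[THEN iffD2])
  then show "other n (other n y) = y" using 1 by blast
qed

lemma sqN_2:
  assumes "d c = 2" "y \<in> N c"
  shows "sqN c \<subseteq> {y, other c y} \<union> (N y - {c}) \<union> (N (other c y) - {c})"
  using other(1)[OF assms] unfolding sqN_eq by auto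

lemma card_sqN_2:
  assumes "d c = 2" "y \<in> N c"
  shows "card (sqN c) \<le> d y + d (other c y)"
proof -
  note o = other[OF assms]
  have "card (sqN c) \<le> card ({y, other c y} \<union> (N y - {c}) \<union> (N (other c y) - {c}))"
    by (rule card_mono[OF _ sqN_2[OF assms]]) simp
  also have "\<dots> \<le> card {y, other c y} + card (N y - {c}) + card (N (other c y) - {c})"
    by (rule card_Un3_le)
  also have "\<dots> = 2 + (d y - 1) + (d (other c y) - 1)"
    using card_N_minus N_sym[OF assms(2)] o(2,4) by simp
  finally show ?thesis using d_ge_2[of y] d_ge_2[of "other c y"] N_V assms(2) o(3) by force
qed

text \<open>By \<open>card_sqN_2\<close> the inequality makes \<open>n\<close> see at most \<Delta>
  vertices in the square, so that \<open>n\<close> can always be recoloured last.\<close>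

definition light where
  "light y n \<longleftrightarrow> n \<in> N y \<and> d n = 2 \<and> d y + d (other n y) \<le> \<Delta>"

lemma light_free: "light y n \<Longrightarrow> card (sqN n) \<le> \<Delta>"
  using card_sqN_2[of n y] N_sym by (fastforce simp: light_def)

definition lights where "lights y = {n. light y n}"

lemma lights_subset: "lights y \<subseteq> N y" by (auto simp: lights_def light_def)

lemma finite_lights [simp]: "finite (lights y)" using lights_subset finite_N finite_subset by blast

text \<open>Delete one light neighbour of \<open>y\<close>, uncolour \<open>y\<close>, the vertices of \<open>cs\<close> and all light
  neighbours, and recolour in this order.\<close>

lemma light_reducible:
  assumes "light y a" "set cs \<subseteq> N y" "greedy (lights y) (y # cs)"
  shows False
proof (rule reducible[of "{a}" "y # cs" "lights y"])
  have a: "a \<in> N y" "d a = 2" using assms(1) by (auto simp: light_def)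
  show "set (y # cs) \<union> lights y \<subseteq> V" using lights_subset[of y] assms N_V N_V[OF N_sym[OF a(1)]] by auto
  show "greedy (lights y) (y # cs)" by fact
  show "{a} \<subseteq> set (y # cs) \<union> lights y" using assms(1) by (simp add: lights_def)
  show "card (sqN b) \<le> \<Delta>" if "b \<in> lights y" for b using that light_free by (simp add: lights_def)
  show "u = v" if "w \<in> {a}" "u \<in> N w - (set (y # cs) \<union> lights y)" "v \<in> N w - (set (y # cs) \<union> lights y)" for w u v
    using that other(1)[OF a(2) N_sym[OF a(1)]] by auto
qed simp

text \<open>A vertex of \<open>T\<close> does not count itself, but its second neighbour may. So
  each vertex of \<open>T\<close> contributes at most 1, while the other neighbours contribute their
  full degree.\<close>

lemma card_sqN_y:
  assumes "T \<subseteq> N y" "\<And>n. n \<in> T \<Longrightarrow> d n = 2"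
  shows "card (sqN y - T) \<le> d y + (\<Sum>n\<in>N y - T. d n - 1)"
proof -
  have "(\<Sum>n\<in>N y. d n - 1) = (\<Sum>n\<in>N y - T. d n - 1) + (\<Sum>n\<in>T. d n - 1)"
    using assms by (intro sum.subset_diff) auto
  also have "(\<Sum>n\<in>T. d n - 1) = card T" using assms(2) by simp
  finally show ?thesis
    using card_sqN_minus_le[OF assms(1)] card_mono[OF finite_N assms(1)] by (simp add: d_def)
qed

text \<open>Otherwise \<open>y\<close> could be recoloured while all its light neighbours are
  uncoloured, and these could follow. For the discharging this means that light neighbours are
  accompanied by neighbours of large degree.\<close>

lemma light_bound:
  assumes "light y a"
  shows "\<Delta> < d y + (\<Sum>n\<in>N y - lights y. d n - 1)"
proof (rule ccontr)
  assume "\<not> ?thesis"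
  then have "card (sqN y - lights y) \<le> \<Delta>"
    using card_sqN_y[OF lights_subset, of y] by (force simp: lights_def light_def)
  then show False using light_reducible[OF assms, of "[]"] by simp
qed

text \<open>The vertex \<open>c\<close> may miss being light by 1. Recoloured after \<open>y\<close>
  but before the light neighbours, it does not see the still uncoloured \<open>a\<close>, which
  makes up for the difference. So \<open>c\<close> can be treated as light.\<close>

lemma light_bound2:
  assumes a: "light y a" and c: "c \<in> N y - lights y" "d c = 2" "d y + d (other c y) \<le> \<Delta> + 1"
  shows "\<Delta> < d y + (\<Sum>n\<in>N y - lights y - {c}. d n - 1)"
proof (rule ccontr)
  assume H: "\<not> ?thesis"
  have "card (sqN y - (lights y \<union> {c})) \<le> d y + (\<Sum>n\<in>N y - (lights y \<union> {c}). d n - 1)"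
    using c lights_subset[of y] by (intro card_sqN_y) (auto simp: lights_def light_def)
  moreover have "X - (lights y \<union> {c}) = X - {c} - lights y" "X - (lights y \<union> {c}) = X - lights y - {c}" for X by auto
  ultimately have 1: "card (sqN y - {c} - lights y) \<le> \<Delta>" using H by (metis (no_types) not_less le_trans)
  have yc: "y \<in> N c" using c N_sym by blast
  note o = other[OF c(2) yc]
  have an: "a \<in> N y" "a \<in> lights y" "a \<noteq> c" using a c by (auto simp: lights_def light_def)
  have "sqN c - lights y \<subseteq> {y, other c y} \<union> (N y - {c} - {a}) \<union> (N (other c y) - {c})"
    using sqN_2[OF c(2) yc] an by auto
  then have "card (sqN c - lights y) \<le> card ({y, other c y} \<union> (N y - {c} - {a}) \<union> (N (other c y) - {c}))"
    by (intro card_mono) auto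
  also have "\<dots> \<le> card {y, other c y} + card (N y - {c} - {a}) + card (N (other c y) - {c})"
    by (rule card_Un3_le)
  also have "\<dots> = 2 + (d y - 2) + (d (other c y) - 1)"
    using card_N_minus o(2,4) an c(1) by (simp add: d_def)
  also have "\<dots> \<le> \<Delta>" using c(3) d_ge_2[of y] d_ge_2[of "other c y"] N_V[OF yc] N_V[OF o(3)] by simp
  finally have "card (sqN c - {} - lights y) \<le> \<Delta>" by simp
  then show False using light_reducible[OF a, of "[c]"] 1 c by simp
qed

text \<open>Delete \<open>c1\<close> and recolour \<open>c1\<close>, \<open>c2\<close>,
  \<open>y\<close> in this order. While \<open>y\<close> is uncoloured, \<open>c1\<close> and
  \<open>c2\<close> see at most \<Delta> - 1 and \<Delta> coloured vertices, and finally
  \<open>y\<close> sees at most \<open>3 + 1 + 1 + (d n - 1)\<close>.\<close>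

lemma two_thin_nbrs:
  assumes y: "N y = {c1, c2, n}" "c1 \<noteq> c2" "c1 \<noteq> n" "c2 \<noteq> n"
    and c: "d c1 = 2" "d c2 = 2" "d (other c1 y) + 2 \<le> \<Delta>" "d (other c2 y) + 2 \<le> \<Delta>"
  shows "\<Delta> < d n + 4"
proof (rule ccontr)
  assume H: "\<not> ?thesis"
  have yc: "y \<in> N c1" "y \<in> N c2" using y N_sym[of _ y] by auto
  note o1 = other[OF c(1) yc(1)] and o2 = other[OF c(2) yc(2)]
  have V: "y \<in> V" "c1 \<in> V" "c2 \<in> V" using N_V yc y N_V[of _ y] by auto
  have dn: "1 \<le> d n" using d_ge_2[of n] N_V[of n y] y by auto
  have b1: "card (sqN c1 - {c2, y}) \<le> \<Delta>"
  proof -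
    have "sqN c1 - {c2, y} \<subseteq> {other c1 y, n} \<union> (N (other c1 y) - {c1})"
      using sqN_2[OF c(1) yc(1)] y by auto
    then have "card (sqN c1 - {c2, y}) \<le> card {other c1 y, n} + card (N (other c1 y) - {c1})"
      by (rule card_le_Un) auto
    also have "\<dots> \<le> 2 + (d (other c1 y) - 1)"
      using card_N_minus[OF o1(4)] card_insert_le_m1[of 2 "{n}" "other c1 y"] by simp
    also have "\<dots> \<le> \<Delta>" using c by linarith
    finally show ?thesis .
  qed
  have b2: "card (sqN c2 - {y}) \<le> \<Delta>"
  proof -
    have "sqN c2 - {y} \<subseteq> {other c2 y, n, c1} \<union> (N (other c2 y) - {c2})"
      using sqN_2[OF c(2) yc(2)] y by auto
    then have "card (sqN c2 - {y}) \<le> card {other c2 y, n, c1} + card (N (other c2 y) - {c2})"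
      by (rule card_le_Un) auto
    also have "\<dots> \<le> 3 + (d (other c2 y) - 1)"
      using card_N_minus[OF o2(4)] by (intro add_mono) (auto simp: card_insert_if)
    also have "\<dots> \<le> \<Delta>" using c d_ge_2[OF N_V[OF o2(3)]] by linarith
    finally show ?thesis .
  qed
  have b3: "card (sqN y) \<le> \<Delta>"
  proof -
    have "card (sqN y) \<le> d y + (\<Sum>n\<in>N y. d n - 1)" using card_sqN_minus_le[of "{}" y] by simp
    also have "\<dots> = 3 + (1 + 1 + (d n - 1))" using y c by (simp add: d_def[of y])
    finally show ?thesis using H dn by linarith
  qed
  show False
    by (rule reducible[of "{c1}" "[c1, c2, y]" "{}"]) (use V b1 b2 b3 o1(1) in auto)
qed

text \<open>The thread is deleted and recoloured in the order \<open>w\<close>, \<open>u\<close>,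
  \<open>v\<close>. The vertex \<open>w\<close> sees its outer neighbour and the other neighbours of
  that, \<open>u\<close> sees the same on its side and also \<open>w\<close>, which is at most
  \<open>d (other u v) + 1\<close> vertices, and \<open>v\<close> sees four. Only the bound for
  \<open>u\<close> can fail.\<close>

lemma thread3:
  assumes v: "d v = 2" "N v = {u, w}" "u \<noteq> w" and uw: "d u = 2" "d w = 2"
  shows "d (other u v) = \<Delta>"
proof (rule ccontr)
  assume "d (other u v) \<noteq> \<Delta>"
  then have lt: "d (other u v) + 1 \<le> \<Delta>" using d_le[of "other u v"] by linarith
  have vu: "v \<in> N u" "v \<in> N w" using v N_sym[of _ v] by auto
  note ou = other[OF uw(1) vu(1)] and ow = other[OF uw(2) vu(2)]
  have V: "u \<in> V" "v \<in> V" "w \<in> V" using v N_V vu N_V[of _ v] by auto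
  have b1: "card (sqN w - {u, v}) \<le> \<Delta>"
  proof -
    have "sqN w - {u, v} \<subseteq> {other w v} \<union> (N (other w v) - {w})"
      using sqN_2[OF uw(2) vu(2)] v by auto
    then have "card (sqN w - {u, v}) \<le> card {other w v} + card (N (other w v) - {w})"
      by (rule card_le_Un) auto
    also have "\<dots> = 1 + (d (other w v) - 1)"
      using card_N_minus[OF ow(4)] by simp
    finally show ?thesis using d_le[of "other w v"] d_ge_2[OF N_V[OF ow(3)]] by linarith
  qed
  have b2: "card (sqN u - {v}) \<le> \<Delta>"
  proof -
    have "sqN u - {v} \<subseteq> {other u v, w} \<union> (N (other u v) - {u})"
      using sqN_2[OF uw(1) vu(1)] v by auto
    then have "card (sqN u - {v}) \<le> card {other u v, w} + card (N (other u v) - {u})"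
      by (rule card_le_Un) auto
    also have "\<dots> \<le> 2 + (d (other u v) - 1)"
      using card_N_minus[OF ou(4)] card_insert_le_m1[of 2 "{w}" "other u v"] by simp
    finally show ?thesis using lt d_ge_2[OF N_V[OF ou(3)]] by linarith
  qed
  have b3: "card (sqN v) \<le> \<Delta>"
  proof -
    have "card (sqN v) \<le> d v + (\<Sum>n\<in>N v. d n - 1)" using card_sqN_minus_le[of "{}" v] by simp
    also have "\<dots> = 4" using v uw by simp
    finally show ?thesis using \<Delta>6 by linarith
  qed
  show False
    by (rule reducible[of "{w, u, v}" "[w, u, v]" "{}"]) (use V b1 b2 b3 ou(1) ow(1) v in auto)
qed

end

subsection \<open>Threads of three vertices of degree two\<close>

text \<open>Alternating \<mu> and \<nu> from \<open>u\<close> traces a cycle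
  \<open>p 0, q 0, p 1, q 1, ...\<close> of length \<open>2 * n\<close>. As the steps are
  invertible, a repetition leads back to \<open>u\<close>.\<close>

lemma two_matchings_orbit:
  assumes fin: "finite S" and u: "u \<in> S"
    and \<mu>: "\<And>v. v \<in> S \<Longrightarrow> \<mu> v \<in> S \<and> \<mu> v \<noteq> v \<and> \<mu> (\<mu> v) = v"
    and \<nu>: "\<And>v. v \<in> S \<Longrightarrow> \<nu> v \<in> S \<and> \<nu> v \<noteq> v \<and> \<nu> (\<nu> v) = v"
  obtains p q :: "nat \<Rightarrow> 'a" and n where "0 < n" "p 0 = u" "p n = u"
    "\<And>i. p i \<in> S" "\<And>i. q i \<in> S" "\<And>i. \<mu> (p i) = q i" "\<And>i. \<mu> (q i) = p i"
    "\<And>i. \<nu> (q i) = p (Suc i)" "\<And>i. \<nu> (p (Suc i)) = q i"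
    "inj_on p {..<n}" "inj_on q {..<n}" "\<And>i j. p i \<noteq> q j"
proof -
  define p where "p i = ((\<lambda>v. \<nu> (\<mu> v)) ^^ i) u" for i
  define q where "q i = \<mu> (p i)" for i
  have p0: "p 0 = u" and pS: "p (Suc i) = \<nu> (q i)" for i by (simp_all add: p_def q_def)
  have pin: "p i \<in> S" for i by (induction i) (use u \<mu> \<nu> p0 pS q_def in auto)
  have qin: "q i \<in> S" for i using \<mu> pin by (simp add: q_def)
  have mq: "\<mu> (q i) = p i" for i using \<mu>[OF pin] by (simp add: q_def)
  have np: "\<nu> (p (Suc i)) = q i" for i using \<nu>[OF qin] by (simp add: pS)
  have pred: "p i = p j" if "p (Suc i) = p (Suc j)" for i j
    using that np mq by metis
  have shift: "p k = u" if "p (i + k) = p i" for i k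
    using that
  proof (induction i)
    case (Suc i)
    then show ?case using pred[of "i + k" i] by simp
  qed (use p0 in simp)
  have "\<not> inj p"
  proof
    assume "inj p"
    then have "infinite (range p)" using finite_imageD by blast
    moreover have "range p \<subseteq> S" using pin by auto
    ultimately show False using fin finite_subset by blast
  qed
  then obtain i j where ij: "i < j" "p i = p j" by (metis injI linorder_neqE_nat)
  then have "p (j - i) = u" using shift[of i "j - i"] by simp
  then have ex: "0 < j - i \<and> p (j - i) = u" using ij by simp
  define n where "n = (LEAST n. 0 < n \<and> p n = u)"
  have n: "0 < n" "p n = u" using LeastI[of "\<lambda>n. 0 < n \<and> p n = u", OF ex] by (auto simp: n_def)
  have least: "p m \<noteq> u" if "0 < m" "m < n" for m
    using not_less_Least[of m "\<lambda>n. 0 < n \<and> p n = u"] that by (auto simp: n_def)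
  have ne: "p i \<noteq> p j" if "i < j" "j < n" for i j
    using shift[of i "j - i"] least[of "j - i"] that by auto
  have injp: "inj_on p {..<n}"
    unfolding inj_on_def by (metis lessThan_iff linorder_neqE_nat ne)
  have injq: "inj_on q {..<n}" using injp mq unfolding inj_on_def by metis
  \<comment> \<open>If \<open>p (j + k) = q j\<close>, taking one step inwards at both ends gives
    the same situation with \<open>k\<close> lowered by 2, until \<mu> or \<nu> would have a fixed
    point.\<close>
  have pq: "p (j + k) \<noteq> q j" for j k
  proof (induction k arbitrary: j rule: less_induct)
    case (less k)
    show ?case
    proof
      assume eq: "p (j + k) = q j"
      consider "k = 0" | "k = 1" | m where "k = Suc (Suc m)" by (metis One_nat_def not0_implies_Suc)
      then show False
      proof cases
        case 1
        then have "p j = \<mu> (p j)" using eq by (simp add: q_def)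
        then show False using \<mu>[OF pin[of j]] by metis
      next
        case 2
        then have "p (Suc j) = \<nu> (p (Suc j))" using eq np[of j] by simp
        then show False using \<nu>[OF pin[of "Suc j"]] by metis
      next
        case 3
        then have "\<nu> (p (j + k)) = q (Suc (j + m))" using np by simp
        moreover have "\<nu> (p (j + k)) = p (Suc j)" using eq pS by simp
        ultimately have "p (Suc j) = q (Suc j + m)" by simp
        then have "p (Suc j + m) = q (Suc j)" using mq by (metis q_def)
        then show False using less[of m "Suc j"] 3 by simp
      qed
    qed
  qed
  have "p i \<noteq> q j" for i j
  proof (cases "j \<le> i")
    case True
    then show ?thesis using pq[of j "i - j"] by simp
  next
    case False
    then have "p j \<noteq> q i" using pq[of i "j - i"] by simp
    then show ?thesis using mq q_def by metis
  qed
  then show thesis using that[OF n(1) p0 n(2) pin qin _ mq _ np injp injq] by (simp add: q_def pS)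
qed

text \<open>Even cycles are 2-choosable: the fixed-point-free involutions \<open>\<mu>\<close> and \<open>\<nu>\<close> are the two
  perfect matchings of a disjoint union of even cycles.\<close>

lemma two_matchings_list_coloring:
  fixes A :: "'a \<Rightarrow> 'c set"
  assumes "finite S"
    and "\<And>v. v \<in> S \<Longrightarrow> \<mu> v \<in> S \<and> \<mu> v \<noteq> v \<and> \<mu> (\<mu> v) = v"
    and "\<And>v. v \<in> S \<Longrightarrow> \<nu> v \<in> S \<and> \<nu> v \<noteq> v \<and> \<nu> (\<nu> v) = v"
    and "\<And>v. v \<in> S \<Longrightarrow> 2 \<le> card (A v)"
  shows "\<exists>f. \<forall>v\<in>S. f v \<in> A v \<and> f v \<noteq> f (\<mu> v) \<and> f v \<noteq> f (\<nu> v)"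
  using assms
proof (induction "card S" arbitrary: S \<mu> \<nu> rule: less_induct)
  case less
  note fin = less.prems(1) and \<mu> = less.prems(2) and \<nu> = less.prems(3) and A = less.prems(4)
  have ex2: "\<exists>c. c \<in> A v \<and> c \<noteq> x" if "v \<in> S" for v x
  proof (rule ccontr)
    assume "\<not> ?thesis"
    then have "A v \<subseteq> {x}" by blast
    then have "card (A v) \<le> 1" using card_mono[of "{x}" "A v"] by simp
    then show False using A[OF that] by simp
  qed
  \<comment> \<open>The cycle through \<open>u\<close> is coloured beginning with \<open>a\<close>
    at \<open>u\<close>, the rest by induction. If \<open>a\<close> is missing in the list of the
    last vertex \<open>\<nu> u\<close>, greedy choices around the cycle close up by themselves.
    Otherwise all lists on the cycle contain that of \<open>u\<close>, and two of its colours
    alternate. The involutions are quantified again in order to be exchanged below.\<close>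
  have orbit: "\<exists>f. \<forall>v\<in>S. f v \<in> A v \<and> f v \<noteq> f (\<mu> v) \<and> f v \<noteq> f (\<nu> v)"
    if \<mu>: "\<And>v. v \<in> S \<Longrightarrow> \<mu> v \<in> S \<and> \<mu> v \<noteq> v \<and> \<mu> (\<mu> v) = v"
      and \<nu>: "\<And>v. v \<in> S \<Longrightarrow> \<nu> v \<in> S \<and> \<nu> v \<noteq> v \<and> \<nu> (\<nu> v) = v"
      and u: "u \<in> S" "a \<in> A u"
      and start: "a \<notin> A (\<nu> u) \<or> (\<forall>v\<in>S. A v \<subseteq> A (\<mu> v) \<and> A v \<subseteq> A (\<nu> v))" for \<mu> \<nu> u a
  proof -
    obtain p q n where pq: "0 < (n::nat)" "p 0 = u" "p n = u"
      "\<And>i. p i \<in> S" "\<And>i. q i \<in> S" "\<And>i. \<mu> (p i) = q i" "\<And>i. \<mu> (q i) = p i"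
      "\<And>i. \<nu> (q i) = p (Suc i)" "\<And>i. \<nu> (p (Suc i)) = q i"
      and inj: "inj_on p {..<n}" "inj_on q {..<n}" and ne: "\<And>i j. p i \<noteq> q j"
      by (rule two_matchings_orbit[OF fin u(1), of \<mu> \<nu>]) (use \<mu> \<nu> in blast)+
    have last: "\<nu> (q (n - 1)) = u" "\<nu> u = q (n - 1)"
      using pq(8)[of "n - 1"] pq(9)[of "n - 1"] pq(1,3) by auto
    have "\<exists>P Q. P 0 = a \<and> (\<forall>i. P i \<in> A (p i) \<and> Q i \<in> A (q i) \<and> P i \<noteq> Q i \<and> P (Suc i) \<noteq> Q i) \<and> Q (n - 1) \<noteq> a"
    proof (cases "a \<in> A (\<nu> u)")
      case False
      define pick where "pick v x = (SOME c. c \<in> A v \<and> c \<noteq> x)" for v x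
      have pick: "pick v x \<in> A v" "pick v x \<noteq> x" if "v \<in> S" for v x
        using someI_ex[OF ex2[OF that]] by (auto simp: pick_def)
      define P where "P = rec_nat a (\<lambda>i c. pick (p (Suc i)) (pick (q i) c))"
      define Q where "Q i = pick (q i) (P i)" for i
      have P: "P 0 = a" "P (Suc i) = pick (p (Suc i)) (Q i)" for i by (auto simp: P_def Q_def)
      have "P i \<in> A (p i)" for i using P pick(1)[OF pq(4)] u pq(2) by (cases i) auto
      moreover have "Q i \<in> A (q i)" "P i \<noteq> Q i" "P (Suc i) \<noteq> Q i" for i
        using P(2) pick[OF pq(5)] pick(2)[OF pq(4)] unfolding Q_def by metis+
      ultimately show ?thesis using P(1) False last by metis
    next
      case True
      then have mono: "\<And>v. v \<in> S \<Longrightarrow> A v \<subseteq> A (\<mu> v) \<and> A v \<subseteq> A (\<nu> v)" using start by blast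
      obtain b where b: "b \<in> A u" "b \<noteq> a" using ex2[OF u(1)] by blast
      have "A u \<subseteq> A (p i)" for i
      proof (induction i)
        case 0
        then show ?case using pq(2) by simp
      next
        case (Suc i)
        then show ?case using mono[OF pq(4)[of i]] mono[OF pq(5)[of i]] pq(6,8) by (metis order_trans)
      qed
      moreover from this have "A u \<subseteq> A (q i)" for i
        using mono[OF pq(4)[of i]] pq(6) by (metis order_trans)
      ultimately have "a \<in> A (p i) \<and> b \<in> A (q i)" for i using b u by blast
      then show ?thesis using b by (intro exI[of _ "\<lambda>_. a"] exI[of _ "\<lambda>_. b"]) auto
    qed
    then obtain P Q where PQ: "P 0 = a" "\<And>i. P i \<in> A (p i)" "\<And>i. Q i \<in> A (q i)"
      "\<And>i. P i \<noteq> Q i" "\<And>i. P (Suc i) \<noteq> Q i" "Q (n - 1) \<noteq> a" by blast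
    define O' where "O' = p ` {..<n} \<union> q ` {..<n}"
    have ppred: "\<nu> (p i) = q (if i = 0 then n - 1 else i - 1)" for i
      using last pq(2,9) by (cases i) auto
    have qsuc: "\<nu> (q i) = p (if Suc i = n then 0 else Suc i)" for i
      using pq(2,3,8) by auto
    have clO: "\<mu> v \<in> O'" "\<nu> v \<in> O'" if "v \<in> O'" for v
    proof -
      from that consider i where "i < n" "v = p i" | i where "i < n" "v = q i"
        unfolding O'_def by auto
      then have "\<mu> v \<in> O' \<and> \<nu> v \<in> O'"
      proof cases
        case 1
        then show ?thesis using pq(1,6) ppred[of i] unfolding O'_def by auto
      next
        case 2
        then show ?thesis using pq(1,7) qsuc[of i] unfolding O'_def by auto
      qed
      then show "\<mu> v \<in> O'" "\<nu> v \<in> O'" by auto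
    qed
    have OS: "O' \<subseteq> S" "u \<in> O'" using pq unfolding O'_def by auto
    have "\<exists>h. \<forall>v\<in>S - O'. h v \<in> A v \<and> h v \<noteq> h (\<mu> v) \<and> h v \<noteq> h (\<nu> v)"
    proof (rule less.hyps)
      show "card (S - O') < card S" using OS u fin by (intro psubset_card_mono) auto
      show "\<mu> v \<in> S - O' \<and> \<mu> v \<noteq> v \<and> \<mu> (\<mu> v) = v" if "v \<in> S - O'" for v
        using that \<mu>[of v] clO(1)[of "\<mu> v"] by auto
      show "\<nu> v \<in> S - O' \<and> \<nu> v \<noteq> v \<and> \<nu> (\<nu> v) = v" if "v \<in> S - O'" for v
        using that \<nu>[of v] clO(2)[of "\<nu> v"] by auto
    qed (use fin A in auto)
    then obtain h where h: "\<And>v. v \<in> S - O' \<Longrightarrow> h v \<in> A v \<and> h v \<noteq> h (\<mu> v) \<and> h v \<noteq> h (\<nu> v)"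
      by blast
    define f where "f v = (if v \<in> p ` {..<n} then P (inv_into {..<n} p v)
        else if v \<in> q ` {..<n} then Q (inv_into {..<n} q v) else h v)" for v
    have fp: "f (p i) = P i" if "i < n" for i
      using that inj(1) by (simp add: f_def inv_into_f_f)
    have fq: "f (q i) = Q i" if "i < n" for i
    proof -
      have "q i \<notin> p ` {..<n}" using ne by (metis imageE)
      then show ?thesis using that inj(2) by (simp add: f_def inv_into_f_f)
    qed
    have fh: "f v = h v" if "v \<notin> O'" for v using that by (auto simp: f_def O'_def)
    have "f v \<in> A v \<and> f v \<noteq> f (\<mu> v) \<and> f v \<noteq> f (\<nu> v)" if "v \<in> S" for v
    proof (cases "v \<in> O'")
      case False
      then have "\<mu> v \<notin> O'" "\<nu> v \<notin> O'" using clO \<mu>[OF that] \<nu>[OF that] by metis+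
      then show ?thesis using fh h that False by auto
    next
      case True
      then consider i where "i < n" "v = p i" | i where "i < n" "v = q i"
        unfolding O'_def by auto
      then show ?thesis
      proof cases
        case 1
        have "f (\<mu> v) = Q i" using 1 fq pq(6) by simp
        moreover have "f (\<nu> v) \<noteq> P i"
        proof (cases i)
          case 0
          then show ?thesis using 1 last pq(1,2) fq[of "n - 1"] PQ(1,6) by auto
        next
          case (Suc j)
          then show ?thesis using 1 pq(9) fq[of j] PQ(5)[of j] by auto
        qed
        ultimately show ?thesis using 1 fp PQ by metis
      next
        case 2
        have "f (\<mu> v) = P i" using 2 fp pq(7) by simp
        moreover have "f (\<nu> v) \<noteq> Q i"
        proof (cases "Suc i = n")
          case True
          then show ?thesis using 2 last pq(1,2) fp[of 0] PQ(1,6) by auto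
        next
          case False
          then show ?thesis using 2 pq(8) fp[of "Suc i"] PQ(5)[of i] by auto
        qed
        ultimately show ?thesis using 2 fq PQ by metis
      qed
    qed
    then show ?thesis by blast
  qed
  show ?case
  proof (cases "S = {}")
    case True
    then show ?thesis by simp
  next
    case False
    then obtain u where u: "u \<in> S" by blast
    \<comment> \<open>Either some list is not contained in that of a partner, which gives a start
      for the greedy colouring, or lists are constant along the cycles.\<close>
    consider (nu) v a where "v \<in> S" "a \<in> A v" "a \<notin> A (\<nu> v)"
      | (mu) v a where "v \<in> S" "a \<in> A v" "a \<notin> A (\<mu> v)"
      | (eq) "\<forall>v\<in>S. A v \<subseteq> A (\<mu> v) \<and> A v \<subseteq> A (\<nu> v)" by blast
    then show ?thesis
    proof cases
      case nu
      show ?thesis by (rule orbit[of \<mu> \<nu> v a]) (use \<mu> \<nu> nu in auto)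
    next
      case mu
      have "\<exists>f. \<forall>v\<in>S. f v \<in> A v \<and> f v \<noteq> f (\<nu> v) \<and> f v \<noteq> f (\<mu> v)"
        by (rule orbit[of \<nu> \<mu> v a]) (use \<mu> \<nu> mu in auto)
      then show ?thesis by blast
    next
      case eq
      obtain a where "a \<in> A u" using ex2[OF u] by blast
      show ?thesis by (rule orbit[of \<mu> \<nu> u a]) (use \<mu> \<nu> u eq \<open>a \<in> A u\<close> in auto)
    qed
  qed
qed

context critical
begin

text \<open>The middle vertices of paths with three consecutive vertices of degree 2, for which
  neither the neighbours nor the ends can pay.\<close>

definition centers where "centers = {c. d c = 2 \<and> (\<forall>n\<in>N c. d n = 2)}"

definition ctr where "ctr u = (SOME c. c \<in> centers \<and> u \<in> N c)"

text \<open>The vertex of degree \<Delta> reached from a middle vertex through its neighbour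
  \<open>u\<close>. As an edge of the multigraph, the middle vertex joins the two values of
  \<open>far\<close> at its neighbours.\<close>

definition far where "far u = other u (ctr u)"

lemma center_thread:
  assumes "c \<in> centers" "u \<in> N c"
  shows "d c = 2" "d u = 2" "c \<in> N u" "d (other u c) = \<Delta>" "other c u \<in> N c" "d (other c u) = 2"
proof -
  show 1: "d c = 2" "d u = 2" "c \<in> N u" using assms N_sym by (auto simp: centers_def)
  note o = other[OF 1(1) assms(2)]
  show "other c u \<in> N c" by fact
  then show "d (other c u) = 2" using assms by (simp add: centers_def)
  then show "d (other u c) = \<Delta>" using thread3[OF 1(1) o(1)] o(2) 1 by auto
qed

text \<open>By \<open>thread3\<close> the second neighbour of \<open>u\<close> has degree \<Delta>,
  so \<open>c\<close> is the only neighbour of \<open>u\<close> of degree two and the choice in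
  \<open>ctr\<close> is forced.\<close>

lemma ctr:
  assumes "c \<in> centers" "u \<in> N c"
  shows "ctr u = c" "far u = other u c"
proof -
  note t = center_thread[OF assms]
  have "ctr u \<in> centers \<and> u \<in> N (ctr u)" unfolding ctr_def by (rule someI[of _ c]) (use assms in auto)
  then have "ctr u \<in> N u" "d (ctr u) = 2" using N_sym by (auto simp: centers_def)
  then show "ctr u = c" using other(1)[OF t(2,3)] t(4) \<Delta>6 by auto
  then show "far u = other u c" by (simp add: far_def)
qed

lemma center_not_end: "c \<in> centers \<Longrightarrow> c' \<in> centers \<Longrightarrow> c \<notin> N c'"
proof
  assume c: "c \<in> centers" "c' \<in> centers" "c \<in> N c'"
  then have "d (other c c') = \<Delta>" "other c c' \<in> N c" using center_thread[of c' c] other(3)[of c c'] by auto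
  then show False using c(1) \<Delta>6 by (auto simp: centers_def)
qed

lemma centers_subset: "centers \<subseteq> V"
proof
  fix c assume c: "c \<in> centers"
  then have "card (N c) = 2" by (simp add: centers_def d_def)
  then have "N c \<noteq> {}" by auto
  then show "c \<in> V" using N_V N_sym by blast
qed

lemma finite_centers: "finite centers" using centers_subset finV finite_subset by blast

text \<open>The half-edges of the multigraph with edge set \<open>B\<close>.\<close>

definition ends where "ends B = (\<Union>c\<in>B. N c)"

lemma card_ends: "B \<subseteq> centers \<Longrightarrow> card (ends B) = 2 * card B"
proof -
  assume B: "B \<subseteq> centers"
  have "card (ends B) = (\<Sum>c\<in>B. card (N c))"
    unfolding ends_def
  proof (rule card_UN_disjoint)
    show "finite B" using B finite_centers finite_subset by blast
    show "\<forall>i\<in>B. \<forall>j\<in>B. i \<noteq> j \<longrightarrow> N i \<inter> N j = {}" using ctr B by blast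
  qed simp
  also have "\<dots> = (\<Sum>c\<in>B. 2)" using B by (intro sum.cong) (auto simp: centers_def d_def)
  finally show ?thesis by simp
qed

lemma card_sqN_center: "c \<in> centers \<Longrightarrow> card (sqN c) \<le> \<Delta>"
proof -
  assume c: "c \<in> centers"
  have "card (sqN c) \<le> d c + (\<Sum>n\<in>N c. d n - 1)" using card_sqN_minus_le[of "{}" c] by simp
  also have "\<dots> = 2 + (\<Sum>n\<in>N c. 1)" using c by (simp add: centers_def)
  also have "\<dots> = 4" using c by (simp add: centers_def d_def)
  finally show ?thesis using \<Delta>6 by linarith
qed

text \<open>In a 2-regular set \<open>B\<close> the uncoloured neighbours of \<open>B\<close> form even cycles of the square, and each
  has two colours left.\<close>

lemma centers_regular_False:
  assumes B: "B \<subseteq> centers" "B \<noteq> {}"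
    and two: "\<And>x. x \<in> far ` ends B \<Longrightarrow> card {u \<in> ends B. far u = x} = 2"
  shows False
proof -
  define S where "S = ends B"
  \<comment> \<open>Here \<nu> matches the two half-edges at a vertex of degree \<Delta>, and \<mu>
    those of one middle vertex. By \<open>sqS\<close> below, the square has no other adjacencies
    inside \<open>S\<close>.\<close>
  define \<nu> where "\<nu> u = (SOME w. w \<in> S \<and> far w = far u \<and> w \<noteq> u)" for u
  define \<mu> where "\<mu> u = other (ctr u) u" for u
  have S: "ctr u \<in> B" "u \<in> N (ctr u)" "ctr u \<in> centers" if "u \<in> S" for u
    using that ctr B unfolding S_def ends_def by blast+
  have SI: "u \<in> S" if "u \<in> N c" "c \<in> B" for u c using that by (auto simp: S_def ends_def)
  have far: "d (far u) = \<Delta>" "N u = {ctr u, far u}" "d u = 2" "u \<in> N (far u)" "far u \<in> N u" if "u \<in> S" for u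
    using center_thread[OF S(3,2)[OF that]] other[of u "ctr u"] by (auto simp: far_def)
  have finB: "finite B" using B finite_centers finite_subset by blast
  have finS: "finite S" using finB by (simp add: S_def ends_def)
  have \<mu>: "\<mu> u \<in> S \<and> \<mu> u \<noteq> u \<and> \<mu> (\<mu> u) = u \<and> N (ctr u) = {u, \<mu> u}" if "u \<in> S" for u
  proof -
    note t = center_thread[OF S(3,2)[OF that]]
    note o = other[OF t(1) S(2)[OF that]]
    have "\<mu> u \<in> N (ctr u)" using t(5) by (simp add: \<mu>_def)
    then have "ctr (\<mu> u) = ctr u" "\<mu> u \<in> S" using ctr(1) S(3)[OF that] SI S(1)[OF that] by auto
    then show ?thesis using o by (auto simp: \<mu>_def)
  qed
  have two': "\<exists>w. {v \<in> S. far v = far u} = {u, w} \<and> w \<noteq> u" if "u \<in> S" for u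
  proof -
    have "card {v \<in> S. far v = far u} = 2" using two[of "far u"] that by (auto simp: S_def)
    then obtain a b where "{v \<in> S. far v = far u} = {a, b}" "a \<noteq> b" by (meson card_2_iff)
    moreover from this have "u \<in> {a, b}" using that by auto
    ultimately show ?thesis by (cases "u = a") (auto simp: insert_commute)
  qed
  have \<nu>: "\<nu> u \<in> S \<and> \<nu> u \<noteq> u \<and> {v \<in> S. far v = far u} = {u, \<nu> u} \<and> far (\<nu> u) = far u" if uS: "u \<in> S" for u
  proof -
    obtain w where w: "{v \<in> S. far v = far u} = {u, w}" "w \<noteq> u" using two'[OF uS] by blast
    then have "w \<in> S \<and> far w = far u \<and> w \<noteq> u" by auto
    then have *: "\<nu> u \<in> S \<and> far (\<nu> u) = far u \<and> \<nu> u \<noteq> u" unfolding \<nu>_def by (rule someI)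
    then have "\<nu> u \<in> {u, w}" using w(1) by blast
    then have "\<nu> u = w" using * by blast
    then show ?thesis using w * by simp
  qed
  have \<nu>2: "\<nu> (\<nu> u) = u" if "u \<in> S" for u
  proof -
    have "{\<nu> u, \<nu> (\<nu> u)} = {u, \<nu> u}" using \<nu>[OF that] \<nu>[of "\<nu> u"] by auto
    then show ?thesis using \<nu>[of "\<nu> u"] \<nu>[OF that] by (metis doubleton_eq_iff)
  qed
  have BS: "B \<inter> S = {}" using center_not_end B unfolding S_def ends_def by blast
  have "\<exists>f. sq_coloring (V - (B \<union> S)) E L f"
  proof (rule uncolor[of "B \<union> S"])
    show "B \<union> S \<subseteq> V" using B centers_subset N_V unfolding S_def ends_def by blast
    fix w u v assume w: "w \<in> B \<union> S" "u \<in> N w - (B \<union> S)" "v \<in> N w - (B \<union> S)"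
    then have "w \<in> S" using SI by auto
    then have "N w - (B \<union> S) \<subseteq> {far w}" using far(2) S(1) by auto
    then show "u = v" using w by blast
  qed (use B in auto)
  then obtain f where f: "sq_coloring (V - (B \<union> S)) E L f" by blast
  have sq: "sqN u \<subseteq> {ctr u, far u, \<mu> u, \<nu> u} \<union> (N (far u) - {u, \<nu> u})" if "u \<in> S" for u
    using sqN_2[OF far(3)[OF that], of "ctr u"] far(2)[OF that] \<mu>[OF that] by (auto simp: far_def[symmetric])
  have sqS: "sqN u \<inter> S \<subseteq> {\<mu> u, \<nu> u}" if "u \<in> S" for u
  proof
    fix v assume v: "v \<in> sqN u \<inter> S"
    have "ctr u \<notin> S" using S(1)[OF that] BS by blast
    moreover have "far u \<notin> S" using far(1)[OF that] far(3)[of "far u"] \<Delta>6 by auto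
    moreover have "v \<in> {ctr u, far u, \<mu> u, \<nu> u} \<union> (N (far u) - {u, \<nu> u})" using sq[OF that] v by (meson IntE subsetD)
    moreover have "v \<in> S" using v by blast
    ultimately have "v \<in> {\<mu> u, \<nu> u} \<or> (v \<in> N (far u) \<and> v \<noteq> u \<and> v \<noteq> \<nu> u)"
      by (elim UnE insertE DiffE) auto
    moreover have False if "v \<in> N (far u)" "v \<noteq> u" "v \<noteq> \<nu> u"
    proof -
      have "far u \<in> N v" using that N_sym by blast
      moreover have "d (ctr v) = 2" using S(3)[of v] v by (simp add: centers_def)
      ultimately have "far v = far u" using far(2)[of v] far(1)[OF \<open>u \<in> S\<close>] v \<Delta>6 by auto
      then show False using \<nu>[OF \<open>u \<in> S\<close>] that v by blast
    qed
    ultimately show "v \<in> {\<mu> u, \<nu> u}" by blast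
  qed
  define A where "A u = L u - f ` (sqN u - (B \<union> S))" for u
  have A: "2 \<le> card (A u)" if "u \<in> S" for u
  proof -
    \<comment> \<open>The coloured vertices seen by \<open>u\<close> are \<open>far u\<close> and
      \<Delta> - 2 neighbours of it, which leaves two of at least \<Delta> + 1 colours.\<close>
    have "sqN u - (B \<union> S) \<subseteq> {far u} \<union> (N (far u) - {u, \<nu> u})"
    proof -
      have "ctr u \<in> B \<union> S" "\<mu> u \<in> B \<union> S" "\<nu> u \<in> B \<union> S"
        using S(1)[OF that] \<mu>[OF that] \<nu>[OF that] by auto
      then show ?thesis using sq[OF that] by (auto simp del: Un_iff)
    qed
    then have "card (sqN u - (B \<union> S)) \<le> card {far u} + card (N (far u) - {u, \<nu> u})"
      by (rule card_le_Un) auto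
    also have "card (N (far u) - {u, \<nu> u}) = card (N (far u)) - card {u, \<nu> u}"
      using far(4)[OF that] far(4)[of "\<nu> u"] \<nu>[OF that] by (intro card_Diff_subset) auto
    also have "card {u, \<nu> u} = 2" using \<nu>[OF that] by auto
    also have "card (N (far u)) = \<Delta>" using far(1)[OF that] by (simp add: d_def)
    finally have c: "card (f ` (sqN u - (B \<union> S))) \<le> \<Delta> - 1"
      using card_image_le[of "sqN u - (B \<union> S)" f] \<Delta>6 by simp
    have "u \<in> V" using N_V S(2)[OF that] by blast
    then have "\<Delta> < card (L u)" by (rule lists)
    moreover have "card (L u) - card (f ` (sqN u - (B \<union> S))) \<le> card (A u)"
      unfolding A_def by (intro diff_card_le_card_Diff) auto
    ultimately show ?thesis using c \<Delta>6 by linarith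
  qed
  have "\<exists>h. \<forall>v\<in>S. h v \<in> A v \<and> h v \<noteq> h (\<mu> v) \<and> h v \<noteq> h (\<nu> v)"
    by (rule two_matchings_list_coloring[OF finS]) (use \<mu> \<nu> \<nu>2 A in blast)+
  then obtain h where h: "\<And>v. v \<in> S \<Longrightarrow> h v \<in> A v \<and> h v \<noteq> h (\<mu> v) \<and> h v \<noteq> h (\<nu> v)" by blast
  define g where "g v = (if v \<in> S then h v else f v)" for v
  have hf: "h u \<noteq> f v" if "u \<in> S" "v \<in> V - (B \<union> S)" "near E u v" for u v
  proof -
    have "v \<in> sqN u - (B \<union> S)" using that near_commute[of E u v] by (simp add: sqN_def)
    then show ?thesis using h[OF that(1)] by (auto simp: A_def)
  qed
  have hh: "h u \<noteq> h v" if "u \<in> S" "v \<in> S" "near E u v" for u v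
  proof -
    have "v \<in> {\<mu> u, \<nu> u}" using sqS[OF that(1)] that near_commute[of E u v] by (auto simp: sqN_def)
    then show ?thesis using h[OF that(1)] by auto
  qed
  have "sq_coloring (V - B) E L g"
    unfolding sq_coloring_def
  proof (intro conjI ballI impI)
    fix v assume "v \<in> V - B"
    then show "g v \<in> L v" using h f by (auto simp: g_def A_def sq_coloring_def)
  next
    fix u v assume uv: "u \<in> V - B" "v \<in> V - B" "near E u v"
    then show "g u \<noteq> g v"
      using hf[of u v] hf[of v u] hh[of u v] near_commute[of E u v] f
      by (auto simp: g_def sq_coloring_def)
  qed
  then show False using free_set[of B g] card_sqN_center B by blast
qed

text \<open>Regard \<open>centers\<close> as edges of a multigraph on the vertices of degree \<open>\<Delta>\<close>. If there were more edges
  than vertices, a minimal set of edges that is at least as large as the set of its ends would be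
  2-regular.\<close>

lemma centers_le: "card centers \<le> card {x \<in> V. d x = \<Delta>}"
proof (rule ccontr)
  let ?T = "{x \<in> V. d x = \<Delta>}"
  assume lt: "\<not> card centers \<le> card ?T"
  define P where "P B \<longleftrightarrow> B \<subseteq> centers \<and> B \<noteq> {} \<and> card (far ` ends B) \<le> card B" for B
  have farT: "far ` ends B \<subseteq> ?T" if BC: "B \<subseteq> centers" for B
  proof
    fix x assume "x \<in> far ` ends B"
    then obtain u c where u: "c \<in> centers" "u \<in> N c" "x = far u" using BC unfolding ends_def by blast
    note t = center_thread[OF u(1,2)]
    have "x \<in> N u" "d x = \<Delta>" using t ctr[OF u(1,2)] u other(3)[OF t(2,3)] by auto
    then show "x \<in> ?T" using N_V by blast
  qed
  have finT: "finite ?T" using finV by simp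
  have "card (far ` ends centers) \<le> card centers" using card_mono[OF finT farT[of centers]] lt by simp
  then have "P centers" using lt by (auto simp: P_def)
  then have "\<exists>B. P B \<and> (\<forall>B'. P B' \<longrightarrow> card B \<le> card B')" by (rule ex_has_least_nat)
  then obtain B where B: "P B" "\<And>B'. P B' \<Longrightarrow> card B \<le> card B'" by blast
  then have BC: "B \<subseteq> centers" "B \<noteq> {}" and le: "card (far ` ends B) \<le> card B" by (auto simp: P_def)
  have finB: "finite B" using BC finite_centers finite_subset by blast
  have finE: "finite (ends B)" using finB by (simp add: ends_def)
  \<comment> \<open>The degree in the multigraph, loops counted twice; \<open>sumk\<close> is the
    handshake lemma.\<close>
  define k where "k x = card {u \<in> ends B. far u = x}" for x
  have sumk: "(\<Sum>x\<in>far ` ends B. k x) = 2 * card B"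
    using sum.group[of "ends B" "far ` ends B" far "\<lambda>_. 1::nat"] finE card_ends[OF BC(1)] by (simp add: k_def)
  have remove: "card B - 1 < card (far ` ends (B - {c}))" if "c \<in> B" "B - {c} \<noteq> {}" for c
  proof (rule ccontr)
    assume "\<not> ?thesis"
    then have "P (B - {c})" using BC that finB by (auto simp: P_def)
    then show False using B(2) that finB by (metis card_Diff1_less not_le)
  qed
  have ends_mono: "ends (B - {c}) \<subseteq> ends B" for c by (auto simp: ends_def)
  have ge2: "2 \<le> k x" if x: "x \<in> far ` ends B" for x
  proof (rule ccontr)
    assume "\<not> 2 \<le> k x"
    then have k1: "k x \<le> 1" by simp
    obtain u where u: "u \<in> ends B" "far u = x" using x by blast
    have "finite {u \<in> ends B. far u = x}" using finE by simp
    from card_le_Suc0_iff_eq[OF this] have one: "v = u" if "v \<in> ends B" "far v = x" for v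
      using k1 that u unfolding k_def One_nat_def by blast
    obtain c where c: "c \<in> B" "u \<in> N c" using u by (auto simp: ends_def)
    have nx: "x \<notin> far ` ends (B - {c})"
    proof
      assume "x \<in> far ` ends (B - {c})"
      then obtain v where v: "v \<in> ends (B - {c})" "far v = x" by blast
      then have "v = u" using one ends_mono by blast
      then obtain c' where "c' \<in> B - {c}" "u \<in> N c'" using v by (auto simp: ends_def)
      then show False using ctr(1)[of c u] ctr(1)[of c' u] c BC by blast
    qed
    show False
    proof (cases "B - {c} = {}")
      \<comment> \<open>\<open>P\<close> excludes the empty set, so a single edge is treated
        separately. With at most one vertex it is a loop, and \<open>k x\<close> would be 2.\<close>
      case True
      then have "B = {c}" using c by blast
      then have "card (far ` ends B) \<le> 1" using le by simp
      then have "\<forall>a\<in>far ` ends B. \<forall>b\<in>far ` ends B. a = b"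
        unfolding One_nat_def using finE by (subst (asm) card_le_Suc0_iff_eq) (rule finite_imageI)
      then have "far v = x" if "v \<in> ends B" for v using that x by blast
      then have "ends B \<subseteq> {u}" using one by blast
      then have "card (ends B) \<le> 1" using card_mono[of "{u}"] by fastforce
      then show False using card_ends[OF BC(1)] \<open>B = {c}\<close> by simp
    next
      case False
      have "far ` ends (B - {c}) \<subseteq> far ` ends B - {x}" using nx ends_mono by blast
      then have "card (far ` ends (B - {c})) \<le> card (far ` ends B) - 1"
        using card_mono[of "far ` ends B - {x}"] finE x by auto
      then show False using remove[OF c(1) False] le by linarith
    qed
  qed
  have "card B \<le> card (far ` ends B)"
  proof (rule ccontr)
    assume gt: "\<not> ?thesis"
    obtain c where c: "c \<in> B" using BC by blast
    have "ends B \<noteq> {}" using card_ends[OF BC(1)] BC finB by (metis card.empty card_0_eq mult_eq_0_iff zero_neq_numeral)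
    then have "1 \<le> card (far ` ends B)" using finE by (simp add: Suc_leI card_gt_0_iff)
    then have "B - {c} \<noteq> {}" using gt c by (metis card.empty card.insert finite.emptyI insert_Diff insert_absorb insert_not_empty not_less One_nat_def empty_iff not_le)
    from remove[OF c this] have "card B - 1 < card (far ` ends (B - {c}))" .
    also have "\<dots> \<le> card (far ` ends B)" using ends_mono finE by (intro card_mono image_mono) auto
    finally show False using gt by linarith
  qed
  then have eq: "(\<Sum>x\<in>far ` ends B. k x) = (\<Sum>x\<in>far ` ends B. 2)" using sumk le by simp
  have "k x = 2" if "x \<in> far ` ends B" for x
  proof (rule ccontr)
    assume "k x \<noteq> 2"
    then have "2 < k x" using ge2[OF that] by simp
    then have "(\<Sum>x\<in>far ` ends B. 2) < (\<Sum>x\<in>far ` ends B. k x)"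
      using finE ge2 that by (intro sum_strict_mono_ex1) auto
    then show False using eq by simp
  qed
  then show False using centers_regular_False[OF BC] by (auto simp: k_def)
qed

end

subsection \<open>Discharging\<close>

context critical
begin

definition big where "big v \<longleftrightarrow> \<Delta> \<le> d v + 1"

text \<open>Not poor means being able to send \<open>4 * \<Delta> - 8\<close> along every edge, see \<open>flow\<close>.\<close>

definition poor where "poor v \<longleftrightarrow> 3 \<le> d v \<and> d v * (\<Delta> + 10) + 4 < 14 * \<Delta>"

text \<open>All charges are multiplied by \<open>5 * \<Delta> + 2\<close>; in this unit the bound on the average degree
  exceeds 2 by \<open>4 * \<Delta> - 8\<close>. The amounts are tight: \<open>5 * \<Delta> - 14\<close> is what remains per edge of a vertex
  of degree \<open>\<Delta>\<close> once it has put \<open>2 * \<Delta> + 4\<close> aside for one element of \<open>centers\<close>, and \<open>3 * \<Delta> - 2\<close> is what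
  is then still missing in a path \<open>u, v\<close> of vertices of degree 2 with \<open>v\<close> next to such a vertex.\<close>

definition flow :: "'a \<Rightarrow> 'a \<Rightarrow> int" where
  "flow u v =
    (if big u then 5 * int \<Delta> - 14
     else if d u = 2 then (if d v = 2 \<and> big (other u v) then int \<Delta> - 6 else 0)
     else if \<not> poor u then 4 * int \<Delta> - 8
     else if d v = 2 then
       (if d (other v u) = 2 then 3 * int \<Delta> - 2 else if poor (other v u) then 2 * int \<Delta> - 4 else 0)
     else if (d v = 3 \<or> d v = 4) \<and> d v < d u \<and> \<Delta> \<le> 2 * d u then 3 * int \<Delta> - 18 else 0)"

definition weight :: "'a \<Rightarrow> int" where
  "weight v = (5 * int \<Delta> + 2) * (int (d v) - 2) - (4 * int \<Delta> - 8)"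

definition charge :: "'a \<Rightarrow> int" where
  "charge v = weight v + (\<Sum>u\<in>N v. flow u v - flow v u)"

lemma \<Delta>6_int: "6 \<le> int \<Delta>" using \<Delta>6 by simp

lemma flow_nonneg: "0 \<le> flow u v"
  using \<Delta>6 by (auto simp: flow_def)

lemma poor_mono: "poor v \<Longrightarrow> m \<le> d v \<Longrightarrow> m * (\<Delta> + 10) + 4 < 14 * \<Delta>"
  unfolding poor_def using mult_le_mono1[of m "d v" "\<Delta> + 10"] by linarith

lemma poor_not_big: "poor v \<Longrightarrow> d v + 2 \<le> \<Delta>"
proof (rule ccontr)
  assume p: "poor v" and "\<not> d v + 2 \<le> \<Delta>"
  obtain e where e: "\<Delta> = e + 6" using \<Delta>6 by (metis add.commute le_Suc_ex)
  have "(e + 5) * (\<Delta> + 10) + 4 < 14 * \<Delta>"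
    using \<open>\<not> d v + 2 \<le> \<Delta>\<close> e by (intro poor_mono[OF p]) simp
  then show False using e by (simp add: algebra_simps)
qed

text \<open>A poor vertex has degree at most 13, while the premises put its degree close to
  \<Delta>. Combining the two gives a quadratic inequality that only small \<Delta> satisfy.\<close>

lemma poor_degree_bound:
  assumes "poor v"
  shows "\<Delta> \<le> d v + 2 \<Longrightarrow> \<Delta> \<le> 7" "\<Delta> \<le> d v + 3 \<Longrightarrow> \<Delta> \<le> 9"
    "\<Delta> \<le> d v + 5 \<Longrightarrow> \<Delta> \<le> 12"
proof -
  \<comment> \<open>Writing \<open>\<Delta> = e + k\<close> avoids truncated subtraction; the
    differences below are then polynomials in \<open>e\<close> with nonnegative
    coefficients.\<close>
  have *: False if "\<Delta> = e + k" "\<Delta> \<le> d v + i" "i \<le> k" "14 * (e + k) \<le> (e + (k - i)) * (e + k + 10) + 4" for e k i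
  proof -
    have "e + (k - i) \<le> d v" using that by linarith
    from poor_mono[OF assms this] that(4) show False unfolding that(1) by linarith
  qed
  show "\<Delta> \<le> 7" if "\<Delta> \<le> d v + 2"
  proof (rule ccontr)
    assume "\<not> \<Delta> \<le> 7"
    then have eq: "\<Delta> = (\<Delta> - 8) + 8" by linarith
    have ineq: "14 * (e + 8) \<le> (e + (8 - 2)) * (e + 8 + 10) + 4" for e :: nat
      by (simp add: algebra_simps)
    show False by (rule *[OF eq that _ ineq]) simp
  qed
  show "\<Delta> \<le> 9" if "\<Delta> \<le> d v + 3"
  proof (rule ccontr)
    assume "\<not> \<Delta> \<le> 9"
    then have eq: "\<Delta> = (\<Delta> - 10) + 10" by linarith
    have ineq: "14 * (e + 10) \<le> (e + (10 - 3)) * (e + 10 + 10) + 4" for e :: nat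
      by (simp add: algebra_simps)
    show False by (rule *[OF eq that _ ineq]) simp
  qed
  show "\<Delta> \<le> 12" if "\<Delta> \<le> d v + 5"
  proof (rule ccontr)
    assume "\<not> \<Delta> \<le> 12"
    then have eq: "\<Delta> = (\<Delta> - 13) + 13" by linarith
    have ineq: "14 * (e + 13) \<le> (e + (13 - 5)) * (e + 13 + 10) + 4" for e :: nat
      by (simp add: algebra_simps)
    show False by (rule *[OF eq that _ ineq]) simp
  qed
qed

lemma deg34_poor: "d v = 3 \<or> d v = 4 \<Longrightarrow> poor v"
  using \<Delta>6 by (auto simp: poor_def)

lemma not_big_2: "d v = 2 \<Longrightarrow> \<not> big v"
  using \<Delta>6 by (auto simp: big_def)

text \<open>A vertex of degree two lacks \<open>4 * \<Delta> - 8\<close>. If its neighbours have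
  degree at least 3, one that is not poor supplies this alone and two poor ones supply half each. In
  a pair of adjacent vertices of degree two, the surplus received from a big neighbour is passed on.
  A middle vertex of a thread gets only \<open>\<Delta> - 6\<close> from both sides.\<close>

lemma charge_2:
  assumes v: "d v = 2"
  shows "charge v \<ge> (if v \<in> centers then - (2 * int \<Delta> + 4) else 0)"
proof -
  obtain a b where ab: "N v = {a, b}" "a \<noteq> b" using v by (auto simp: d_def card_2_iff)
  have V: "a \<in> V" "b \<in> V" using ab N_V by auto
  have va: "v \<in> N a" "v \<in> N b" using ab N_sym[of _ v] by auto
  have o: "other v a = b" "other v b = a" using other(1,2)[OF v, of a] other(1,2)[OF v, of b] ab by auto
  have ch: "charge v = - (4 * int \<Delta> - 8) + (flow a v - flow v a) + (flow b v - flow v b)"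
    using v ab by (simp add: charge_def weight_def)
  have mixed: "- (4 * int \<Delta> - 8) + (flow a v - flow v a) + (flow b v - flow v b) \<ge> 0"
    if ab: "N v = {a, b}" "a \<noteq> b" "d a = 2" "d b \<noteq> 2" "b \<in> V" and o: "other v a = b" "other v b = a" for a b
  proof -
    have va: "v \<in> N a" using ab N_sym[of a v] by auto
    have vb: "flow v b = 0" "flow v a = (if big b then int \<Delta> - 6 else 0)"
      using v ab o not_big_2 by (auto simp: flow_def)
    show ?thesis
    proof (cases "big b")
      case True
      then have "flow b v = 5 * int \<Delta> - 14" by (simp add: flow_def)
      then show ?thesis using vb True flow_nonneg[of a v] by simp
    next
      case False
      \<comment> \<open>As \<open>b\<close> is not big, \<open>v\<close> is light for
        \<open>a\<close>. Then \<open>light_bound\<close> makes the outer neighbour of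
        \<open>a\<close> big, and \<open>a\<close> hands on \<open>\<Delta> - 6\<close>.\<close>
      have "light a v" using va v ab o False by (auto simp: light_def big_def)
      then have "\<Delta> < d a + (\<Sum>n\<in>N a - lights a. d n - 1)" by (rule light_bound)
      also have "(\<Sum>n\<in>N a - lights a. d n - 1) \<le> (\<Sum>n\<in>{other a v}. d n - 1)"
        using other(1)[OF ab(3) va] \<open>light a v\<close> by (intro sum_mono2) (auto simp: lights_def)
      finally have "big (other a v)" using ab by (simp add: big_def)
      then have 1: "flow a v = int \<Delta> - 6" using v ab not_big_2 by (simp add: flow_def)
      have "flow b v \<ge> 3 * int \<Delta> - 2"
        using False ab o v \<Delta>6 by (simp add: flow_def)
      then show ?thesis using 1 vb False by simp
    qed
  qed
  consider "d a = 2" "d b = 2" | "d a = 2" "d b \<noteq> 2" | "d a \<noteq> 2" "d b = 2" | "d a \<noteq> 2" "d b \<noteq> 2" by blast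
  then show ?thesis
  proof cases
    case 1
    then have c: "v \<in> centers" using ab v by (auto simp: centers_def)
    have "big (other a v)" "big (other b v)" using center_thread(4)[OF c] ab by (auto simp: big_def)
    then have "flow a v = int \<Delta> - 6" "flow b v = int \<Delta> - 6"
      using 1 v not_big_2 by (auto simp: flow_def)
    moreover have "flow v a = 0" "flow v b = 0" using 1 v o not_big_2 by (auto simp: flow_def)
    ultimately show ?thesis using ch c by simp
  next
    case 2
    have "charge v \<ge> 0" using mixed[of a b] 2 ab V o ch by simp
    then show ?thesis by auto
  next
    case 3
    have "charge v \<ge> 0" using mixed[of b a] 3 ab V o ch by (simp add: insert_commute)
    then show ?thesis by auto
  next
    case 4
    have z: "flow v a = 0" "flow v b = 0" using 4 v not_big_2 by (auto simp: flow_def)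
    have "flow a v + flow b v \<ge> 4 * int \<Delta> - 8"
    proof (cases "poor a \<and> poor b")
      case True
      then have "flow a v = 2 * int \<Delta> - 4" "flow b v = 2 * int \<Delta> - 4"
        using 4 v o poor_not_big[of a] poor_not_big[of b] by (auto simp: flow_def big_def)
      then show ?thesis by simp
    next
      case False
      then have "flow a v \<ge> 4 * int \<Delta> - 8 \<or> flow b v \<ge> 4 * int \<Delta> - 8"
        using 4 \<Delta>6 by (auto simp: flow_def)
      then show ?thesis using flow_nonneg[of a v] flow_nonneg[of b v] by linarith
    qed
    then have "charge v \<ge> 0" using ch z by simp
    then show ?thesis by auto
  qed
qed

lemma charge_ge:
  assumes "\<And>u. u \<in> N v \<Longrightarrow> flow v u \<le> K"
  shows "charge v \<ge> weight v - int (d v) * K"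
proof -
  have "(\<Sum>u\<in>N v. flow u v - flow v u) \<ge> (\<Sum>u\<in>N v. - K)"
  proof (rule sum_mono)
    fix u assume "u \<in> N v"
    then show "- K \<le> flow u v - flow v u" using assms[of u] flow_nonneg[of u v] by linarith
  qed
  then show ?thesis by (simp add: charge_def d_def)
qed

lemma charge_big:
  assumes "big v"
  shows "charge v \<ge> (if d v = \<Delta> then 2 * int \<Delta> + 4 else 0)"
proof -
  have "charge v \<ge> weight v - int (d v) * (5 * int \<Delta> - 14)"
    using assms by (intro charge_ge) (simp add: flow_def)
  moreover have "weight v - int (d v) * (5 * int \<Delta> - 14) = 16 * int (d v) - 14 * int \<Delta> + 4"
    by (simp add: weight_def algebra_simps)
  \<comment> \<open>For degree \<Delta> - 1 the remainder is 2\<Delta> - 12, which is nonnegative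
    just because \<Delta> is at least 6; for degree \<Delta> it is the reserve 2\<Delta> +
    4.\<close>
  moreover have "int (d v) \<ge> int \<Delta> - 1" using assms by (simp add: big_def)
  ultimately show ?thesis using \<Delta>6 by auto
qed

lemma charge_rich:
  assumes "\<not> big v" "\<not> poor v" "3 \<le> d v"
  shows "charge v \<ge> 0"
proof -
  have "charge v \<ge> weight v - int (d v) * (4 * int \<Delta> - 8)"
    using assms by (intro charge_ge) (simp add: flow_def)
  moreover have "weight v - int (d v) * (4 * int \<Delta> - 8) = int (d v * (\<Delta> + 10) + 4) - int (14 * \<Delta>)"
    by (simp add: weight_def algebra_simps)
  moreover have "14 * \<Delta> \<le> d v * (\<Delta> + 10) + 4" using assms by (simp add: poor_def)
  ultimately show ?thesis by linarith
qed

section \<open>Charges of poor vertices\<close>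

definition cost where "cost y n = flow y n - flow n y"

context
  fixes y assumes y: "poor y"
begin

lemma y_bounds: "3 \<le> d y" "d y + 2 \<le> \<Delta>" "\<not> big y" "d y \<noteq> 2"
  using poor_not_big[OF y] y by (auto simp: poor_def big_def)

lemma charge_cost: "charge y = weight y - sum (cost y) (N y)"
  unfolding charge_def cost_def by (simp add: sum_subtractf)

lemma flow_le: "flow y n \<le> 3 * int \<Delta> - 2"
  using y y_bounds \<Delta>6 by (auto simp: flow_def)

lemma cost_le: "cost y n \<le> 3 * int \<Delta> - 2"
  using flow_le[of n] flow_nonneg[of n y] by (simp add: cost_def)

text \<open>Since \<open>n\<close> is not light, its second neighbour has degree greater than
  \<open>\<Delta> - d y\<close>. Unless that neighbour is poor, it supplies \<open>n\<close> alone
  and \<open>y\<close> pays nothing.\<close>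

lemma cost_thin:
  assumes "n \<in> N y" "d n = 2" "n \<notin> lights y"
  shows "cost y n \<le> 2 * int \<Delta> - 4"
    "0 < cost y n \<Longrightarrow> poor (other n y) \<and> \<Delta> < d y + d (other n y)"
proof -
  have l: "\<Delta> < d y + d (other n y)" using assms by (auto simp: lights_def light_def)
  then have "d (other n y) \<noteq> 2" using y_bounds by auto
  then have f: "flow y n = (if poor (other n y) then 2 * int \<Delta> - 4 else 0)"
    using y y_bounds assms by (simp add: flow_def)
  then show "cost y n \<le> 2 * int \<Delta> - 4" using flow_nonneg[of n y] \<Delta>6 by (simp add: cost_def split: if_splits)
  show "poor (other n y) \<and> \<Delta> < d y + d (other n y)" if "0 < cost y n"
    using that f l flow_nonneg[of n y] by (simp add: cost_def split: if_splits)
qed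

lemma cost_rich:
  assumes "3 \<le> d n" "\<not> poor n"
  shows "cost y n \<le> - (4 * int \<Delta> - 8)"
proof -
  have "flow y n = 0" using y y_bounds assms deg34_poor[of n] by (auto simp: flow_def)
  moreover have "flow n y \<ge> 4 * int \<Delta> - 8" using assms \<Delta>6 by (auto simp: flow_def)
  ultimately show ?thesis by (simp add: cost_def)
qed

lemma cost_big:
  assumes "big n"
  shows "cost y n \<le> - (5 * int \<Delta> - 14)"
proof -
  have "\<not> poor n" "3 \<le> d n" using poor_not_big[of n] assms \<Delta>6 by (auto simp: big_def)
  then have "flow y n = 0" using y y_bounds deg34_poor[of n] by (auto simp: flow_def)
  moreover have "flow n y = 5 * int \<Delta> - 14" using assms by (simp add: flow_def)
  ultimately show ?thesis by (simp add: cost_def)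
qed

lemma cost_poor:
  assumes "poor n"
  shows "cost y n = (if (d n = 3 \<or> d n = 4) \<and> d n < d y \<and> \<Delta> \<le> 2 * d y then 3 * int \<Delta> - 18 else 0)
    - (if (d y = 3 \<or> d y = 4) \<and> d y < d n \<and> \<Delta> \<le> 2 * d n then 3 * int \<Delta> - 18 else 0)"
proof -
  have "3 \<le> d n" "\<not> big n" using poor_not_big[of n] assms by (auto simp: poor_def big_def)
  then show ?thesis using y y_bounds assms by (simp add: cost_def flow_def)
qed

lemma cost_thick:
  assumes "3 \<le> d n"
  shows "cost y n \<le> (if d n \<le> 4 \<and> d n < d y \<and> \<Delta> \<le> 2 * d y then 3 * int \<Delta> - 18 else 0)"
  using cost_rich[OF assms] cost_poor[of n] \<Delta>6 by (cases "poor n") (auto simp: assms)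

text \<open>A positive cost has two possible sources. Sharing a vertex of degree two with a poor
  vertex of degree above \<open>\<Delta> - d y\<close> bounds \<Delta> by
  \<open>poor_degree_bound\<close>; the gift \<open>3 * \<Delta> - 18\<close> requires
  \<open>\<Delta> \<le> 2 * d y\<close> and does not exceed \<open>2 * \<Delta> - 4\<close> as long
  as \<Delta> is at most 14.\<close>

lemma cost_nonlight:
  assumes n: "n \<in> N y" "n \<notin> lights y"
  shows "d y \<le> 6 \<Longrightarrow> cost y n \<le> (if \<Delta> \<le> 14 then 2 * int \<Delta> - 4 else 0)"
    "d y \<le> 4 \<Longrightarrow> cost y n \<le> (if \<Delta> \<le> 9 then 2 * int \<Delta> - 4 else 0)"
    "d y = 3 \<Longrightarrow> 0 < cost y n \<Longrightarrow> d n = 2"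
proof -
  have n2: "2 \<le> d n" using d_ge_2 N_V n by blast
  show "cost y n \<le> (if \<Delta> \<le> 14 then 2 * int \<Delta> - 4 else 0)" if "d y \<le> 6"
  proof (cases "d n = 2")
    case True
    then show ?thesis
      using cost_thin[OF n(1) True n(2)] poor_degree_bound(3)[of "other n y"] that by (cases "0 < cost y n") auto
  next
    case False
    then show ?thesis using cost_thick[of n] n2 that \<Delta>6 by (auto split: if_splits)
  qed
  show "cost y n \<le> (if \<Delta> \<le> 9 then 2 * int \<Delta> - 4 else 0)" if "d y \<le> 4"
  proof (cases "d n = 2")
    case True
    then show ?thesis
      using cost_thin[OF n(1) True n(2)] poor_degree_bound(2)[of "other n y"] that by (cases "0 < cost y n") auto
  next
    case False
    then show ?thesis using cost_thick[of n] n2 that \<Delta>6 by (auto split: if_splits)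
  qed
  show "d n = 2" if "d y = 3" "0 < cost y n"
    using cost_thick[of n] n2 that by (cases "d n = 2") (auto split: if_splits)
qed

lemma sum_cost_split:
  assumes "\<And>n. n \<in> N y - lights y \<Longrightarrow> cost y n \<le> K"
  shows "sum (cost y) (N y) \<le> int (card (lights y)) * (3 * int \<Delta> - 2) + int (d y - card (lights y)) * K"
proof -
  have "sum (cost y) (N y) = (\<Sum>n\<in>N y - lights y. cost y n) + (\<Sum>n\<in>lights y. cost y n)"
    using lights_subset by (intro sum.subset_diff) auto
  moreover have "(\<Sum>n\<in>lights y. cost y n) \<le> (\<Sum>n\<in>lights y. 3 * int \<Delta> - 2)" using cost_le by (intro sum_mono)
  moreover have "(\<Sum>n\<in>N y - lights y. cost y n) \<le> (\<Sum>n\<in>N y - lights y. K)" using assms by (intro sum_mono)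
  moreover have "card (N y - lights y) = d y - card (lights y)"
    unfolding d_def by (rule card_Diff_subset) (auto simp: lights_subset)
  ultimately show ?thesis by simp
qed

lemma sum_cost_lights:
  "sum (cost y) (N y) \<le> int (card (lights y)) * (3 * int \<Delta> - 2) + (\<Sum>n\<in>N y - lights y. cost y n)"
proof -
  have "sum (cost y) (N y) = (\<Sum>n\<in>N y - lights y. cost y n) + (\<Sum>n\<in>lights y. cost y n)"
    using lights_subset by (intro sum.subset_diff) auto
  moreover have "(\<Sum>n\<in>lights y. cost y n) \<le> (\<Sum>n\<in>lights y. 3 * int \<Delta> - 2)" using cost_le by (intro sum_mono)
  ultimately show ?thesis by simp
qed

lemma card_nonlight: "card (N y - lights y) = d y - card (lights y)" "card (lights y) \<le> d y"
  unfolding d_def by (rule card_Diff_subset; simp add: lights_subset) (simp add: lights_subset card_mono)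

lemma light_sum: "card (lights y) \<noteq> 0 \<Longrightarrow> \<Delta> < d y + (\<Sum>n\<in>N y - lights y. d n - 1)"
proof -
  assume "card (lights y) \<noteq> 0"
  then obtain a where "a \<in> lights y" by (metis card.empty ex_in_conv)
  then show ?thesis using light_bound by (simp add: lights_def)
qed

text \<open>If all neighbours were light, \<open>light_bound\<close> would read
  \<open>\<Delta> < d y\<close>.\<close>

lemma not_all_light: "card (lights y) < d y"
proof (rule ccontr)
  assume "\<not> ?thesis"
  then have eq: "card (lights y) = d y" using card_nonlight(2) by simp
  then have "N y - lights y = {}" using card_nonlight(1) by (metis card_0_eq diff_self_eq_0 finite_Diff finite_N)
  then have "(\<Sum>n\<in>N y - lights y. d n - 1) = 0" by (metis sum.empty)
  then show False using light_sum eq y_bounds by linarith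
qed

lemma charge_7: "7 \<le> d y \<Longrightarrow> charge y \<ge> 0"
proof -
  assume d7: "7 \<le> d y"
  have "charge y \<ge> weight y - int (d y) * (3 * int \<Delta> - 2)" using flow_le by (intro charge_ge)
  moreover have "weight y - int (d y) * (3 * int \<Delta> - 2) = int (d y) * (2 * int \<Delta> + 4) - (14 * int \<Delta> - 4)"
    by (simp add: weight_def algebra_simps)
  moreover have "int (d y) * (2 * int \<Delta> + 4) \<ge> 7 * (2 * int \<Delta> + 4)"
    using d7 by (intro mult_right_mono) auto
  ultimately show ?thesis by simp
qed

lemma charge_6: "d y = 6 \<Longrightarrow> charge y \<ge> 0"
proof -
  assume d6: "d y = 6"
  have "sum (cost y) (N y) \<le> int (card (lights y)) * (3 * int \<Delta> - 2)
      + int (d y - card (lights y)) * (if \<Delta> \<le> 14 then 2 * int \<Delta> - 4 else 0)"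
    using cost_nonlight(1) d6 by (intro sum_cost_split) auto
  moreover have "card (lights y) = 0 \<or> card (lights y) = 1 \<or> card (lights y) = 2 \<or> card (lights y) = 3 \<or> card (lights y) = 4
      \<or> card (lights y) = 5"
    using not_all_light d6 by linarith
  moreover have "weight y = 16 * int \<Delta> + 16" using d6 by (simp add: weight_def)
  ultimately show ?thesis
    using d6 \<Delta>6 unfolding charge_cost by (elim disjE; cases "\<Delta> \<le> 14"; simp)
qed

text \<open>Up to three light neighbours can be afforded if \<Delta> is at most 14, with equality at
  14, and for larger \<Delta> the other neighbours cost nothing. With four,
  \<open>light_bound\<close> gives the fifth neighbour degree at least \<Delta> - 3, so that it is
  not poor and pays, or \<Delta> is at most 9.\<close>

lemma charge_5: "d y = 5 \<Longrightarrow> charge y \<ge> 0"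
proof -
  assume d5: "d y = 5"
  have w: "weight y = 11 * int \<Delta> + 14" using d5 by (simp add: weight_def)
  show ?thesis
  proof (cases "card (lights y) = 4")
    case False
    have "sum (cost y) (N y) \<le> int (card (lights y)) * (3 * int \<Delta> - 2)
        + int (d y - card (lights y)) * (if \<Delta> \<le> 14 then 2 * int \<Delta> - 4 else 0)"
      using cost_nonlight(1) d5 by (intro sum_cost_split) auto
    moreover have "card (lights y) = 0 \<or> card (lights y) = 1 \<or> card (lights y) = 2 \<or> card (lights y) = 3"
      using not_all_light d5 False by linarith
    ultimately show ?thesis
      using d5 \<Delta>6 w unfolding charge_cost by (elim disjE; cases "\<Delta> \<le> 14"; simp)
  next
    case True
    then obtain n where n: "N y - lights y = {n}" using card_nonlight(1) d5 by (auto simp: card_1_singleton_iff)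
    have "\<Delta> < 5 + (d n - 1)" using light_sum n d5 True by simp
    then have dn: "\<Delta> \<le> d n + 3" "3 \<le> d n" using \<Delta>6 by auto
    have s: "sum (cost y) (N y) \<le> 12 * int \<Delta> - 8 + cost y n"
      using sum_cost_lights n True by (simp add: algebra_simps)
    show ?thesis
    proof (cases "poor n")
      case True
      then have "int \<Delta> \<le> 9" using poor_degree_bound(2) dn by fastforce
      moreover have "cost y n \<le> 3 * int \<Delta> - 18"
        using cost_thick[OF dn(2)] \<Delta>6 by (auto split: if_splits)
      ultimately have "sum (cost y) (N y) \<le> 11 * int \<Delta> + 14" using s by linarith
      then show ?thesis using w unfolding charge_cost by linarith
    next
      case False
      then show ?thesis using s w cost_rich[OF dn(2)] \<Delta>6_int unfolding charge_cost by linarith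
    qed
  qed
qed

lemma charge_4: "d y = 4 \<Longrightarrow> charge y \<ge> 0"
proof -
  assume d4: "d y = 4"
  have w: "weight y = 6 * int \<Delta> + 12" using d4 by (simp add: weight_def)
  have k: "cost y n \<le> (if \<Delta> \<le> 9 then 2 * int \<Delta> - 4 else 0)" if "n \<in> N y - lights y" for n
    using that cost_nonlight(2) d4 by auto
  have thick: "cost y n \<le> (if d n = 3 \<and> \<Delta> \<le> 8 then 3 * int \<Delta> - 18 else 0)" if "3 \<le> d n" for n
    using cost_thick[OF that] d4 that \<Delta>6 by (auto split: if_splits)
  have n2: "2 \<le> d n" if "n \<in> N y" for n using that d_ge_2 N_V by blast
  consider "card (lights y) = 0" | "card (lights y) = 1" | "card (lights y) = 2" | "card (lights y) = 3"
    using not_all_light d4 by linarith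
  then show ?thesis
  proof cases
    case 1
    have "sum (cost y) (N y) \<le> int (card (lights y)) * (3 * int \<Delta> - 2)
        + int (d y - card (lights y)) * (if \<Delta> \<le> 9 then 2 * int \<Delta> - 4 else 0)"
      using k by (intro sum_cost_split) auto
    then show ?thesis using 1 d4 w \<Delta>6 unfolding charge_cost by (auto split: if_splits)
  next
    case 2
    show ?thesis
    \<comment> \<open>In the range up to 9, this is the only value for which the crude bound
      3\<Delta> - 2 + 3(2\<Delta> - 4) exceeds the weight 6\<Delta> + 12.\<close>
    proof (cases "\<Delta> = 9")
      case False
      have "sum (cost y) (N y) \<le> int (card (lights y)) * (3 * int \<Delta> - 2)
          + int (d y - card (lights y)) * (if \<Delta> \<le> 9 then 2 * int \<Delta> - 4 else 0)"
        using k by (intro sum_cost_split) auto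
      then show ?thesis using 2 d4 w \<Delta>6 False unfolding charge_cost by (auto split: if_splits)
    next
      case True
      have "card (N y - lights y) = 3" using card_nonlight(1) d4 2 by simp
      then obtain a b c where abc: "N y - lights y = {a, b, c}" "a \<noteq> b" "b \<noteq> c" "a \<noteq> c"
        by (auto simp: card_3_iff)
      have le: "cost y a \<le> 14" "cost y b \<le> 14" "cost y c \<le> 14" using k abc True by (auto split: if_splits)
      have "9 < 4 + (\<Sum>n\<in>{a, b, c}. d n - 1)" using light_sum abc 2 d4 True by simp
      then have "9 < 4 + ((d a - 1) + (d b - 1) + (d c - 1))" using abc by simp
      then have "3 \<le> d a \<or> 3 \<le> d b \<or> 3 \<le> d c" by linarith
      then have "cost y a \<le> 0 \<or> cost y b \<le> 0 \<or> cost y c \<le> 0" using thick True by fastforce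
      then have "cost y a + cost y b + cost y c \<le> 28" using le by linarith
      moreover have "sum (cost y) (N y) \<le> (3 * int \<Delta> - 2) + (cost y a + cost y b + cost y c)"
        using sum_cost_lights abc 2 by (simp add: algebra_simps)
      ultimately show ?thesis using w True unfolding charge_cost by simp
    qed
  next
    case 3
    then have "card (N y - lights y) = 2" using card_nonlight(1) d4 by simp
    then obtain a b where ab: "N y - lights y = {a, b}" "a \<noteq> b" by (auto simp: card_2_iff)
    have "\<Delta> < 4 + ((d a - 1) + (d b - 1))" using light_sum ab 3 d4 by simp
    moreover have dd: "2 \<le> d a" "2 \<le> d b" using ab n2 by auto
    ultimately have sum: "\<Delta> < 2 + d a + d b" by linarith
    have ka: "cost y a \<le> (if \<Delta> \<le> 9 then 2 * int \<Delta> - 4 else 0)"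
      "cost y b \<le> (if \<Delta> \<le> 9 then 2 * int \<Delta> - 4 else 0)" using k ab by auto
    \<comment> \<open>After two light neighbours exactly 6\<Delta> + 12 - 2(3\<Delta> - 2) = 16 is
      left.\<close>
    have one: "cost y a + cost y b \<le> 16"
      if "d a = 2" "\<Delta> < 2 + d a + d b" "cost y a \<le> (if \<Delta> \<le> 9 then 2 * int \<Delta> - 4 else 0)" for a b
      using that thick[of b] \<Delta>6 by (auto split: if_splits)
    have "cost y a + cost y b \<le> 16"
    proof (cases "d a = 2 \<or> d b = 2")
      case True
      then show ?thesis using one[of a b] one[of b a] ka sum by (auto simp: ac_simps)
    next
      case False
      then show ?thesis using thick[of a] thick[of b] dd by (auto split: if_splits)
    qed
    moreover have "sum (cost y) (N y) \<le> 6 * int \<Delta> - 4 + (cost y a + cost y b)"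
      using sum_cost_lights ab 3 by (simp add: algebra_simps)
    ultimately show ?thesis using w unfolding charge_cost by simp
  next
    case 4
    then obtain n where n: "N y - lights y = {n}" using card_nonlight(1) d4 by (auto simp: card_1_singleton_iff)
    have "\<Delta> < 4 + (d n - 1)" using light_sum n d4 4 by simp
    then have dn: "\<Delta> \<le> d n + 2" "4 \<le> d n" using \<Delta>6 by auto
    have s: "sum (cost y) (N y) \<le> 9 * int \<Delta> - 6 + cost y n"
      using sum_cost_lights n 4 by (simp add: algebra_simps)
    show ?thesis
    proof (cases "poor n")
      case True
      then have "\<Delta> \<le> 7" using poor_degree_bound(1) dn by blast
      then consider "\<Delta> = 6" | "\<Delta> = 7" using \<Delta>6 by linarith
      then show ?thesis
      proof cases
        case 1
        then show ?thesis using s w thick[of n] dn unfolding charge_cost by auto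
      next
        case 2
        \<comment> \<open>Three light neighbours take 57 of a weight of 54. The gift
          \<open>3 * \<Delta> - 18\<close> vanishes for \<Delta> = 6, where the balance is 0, and is
          the missing 3 here.\<close>
        then have "cost y n = - 3" using cost_poor[OF True] d4 dn by simp
        then show ?thesis using s w 2 unfolding charge_cost by simp
      qed
    next
      case False
      then have "cost y n \<le> - (4 * int \<Delta> - 8)" using cost_rich[of n] dn by simp
      then show ?thesis using s w \<Delta>6_int unfolding charge_cost by linarith
    qed
  qed
qed

lemma charge_3: "d y = 3 \<Longrightarrow> charge y \<ge> 0"
proof -
  assume d3: "d y = 3"
  have w: "weight y = int \<Delta> + 10" using d3 by (simp add: weight_def)
  have n2: "2 \<le> d n" if "n \<in> N y" for n using that d_ge_2 N_V by blast
  have thick: "cost y n \<le> 0" if "3 \<le> d n" for n using cost_thick[OF that] d3 that by auto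
  have gift: "cost y n \<le> - (3 * int \<Delta> - 18)" if "poor n" "\<Delta> \<le> 2 * d n" for n
    using cost_poor[OF that(1)] that d3 \<Delta>6 by (auto simp: poor_def)
  have k: "cost y n \<le> 2 * int \<Delta> - 4" if "n \<in> N y - lights y" for n
    using that cost_thin(1)[of n] thick[of n] n2[of n] \<Delta>6 by (cases "d n = 2") auto
  \<comment> \<open>A vertex of degree 3 gives nothing to vertices of larger degree, so the only
    costly neighbours that are not light are shared with a poor vertex of degree at least \<Delta> -
    2.\<close>
  have pos: "d n = 2 \<and> poor (other n y) \<and> \<Delta> \<le> d (other n y) + 2 \<and> \<Delta> \<le> 7" if "n \<in> N y - lights y" "0 < cost y n" for n
  proof -
    have "d n = 2" using that cost_nonlight(3) d3 by auto
    then show ?thesis using that cost_thin(2)[of n] d3 poor_degree_bound(1)[of "other n y"] by auto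
  qed
  consider "card (lights y) = 0" | "card (lights y) = 1" | "card (lights y) = 2"
    using not_all_light d3 by linarith
  then show ?thesis
  proof cases
    case 1
    then have U: "lights y = {}" by simp
    have "card (N y) = 3" using d3 by (simp add: d_def)
    then obtain a b c where abc: "N y = {a, b, c}" "a \<noteq> b" "b \<noteq> c" "a \<noteq> c"
      by (auto simp: card_3_iff)
    \<comment> \<open>By \<open>two_thin_nbrs\<close> the third neighbour has degree at least
      \<Delta> - 3. If it is poor, the cost is at most 16 for \<Delta> = 6 and at most 20 - 3 for
      \<Delta> = 7, in both cases \<Delta> + 10.\<close>
    have two: "cost y a + cost y b + cost y c \<le> int \<Delta> + 10"
      if abc: "N y = {a, b, c}" "a \<noteq> b" "b \<noteq> c" "a \<noteq> c" and p: "0 < cost y a" "0 < cost y b" for a b c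
    proof -
      have pa: "d a = 2" "poor (other a y)" "\<Delta> \<le> 7" and pb: "d b = 2" "poor (other b y)"
        using pos[of a] pos[of b] U abc p by auto
      have dc: "\<Delta> < d c + 4"
        using two_thin_nbrs[of y a b c] abc pa pb poor_not_big by auto
      then have c3: "3 \<le> d c" using \<Delta>6 by simp
      have ab: "cost y a \<le> 2 * int \<Delta> - 4" "cost y b \<le> 2 * int \<Delta> - 4" using k U abc by auto
      show ?thesis
      proof (cases "poor c")
        case False
        then show ?thesis using cost_rich[OF c3] ab \<Delta>6_int by linarith
      next
        case True
        consider "\<Delta> = 6" | "\<Delta> = 7" using \<Delta>6 pa by linarith
        then show ?thesis
        proof cases
          case 1
          then show ?thesis using thick[OF c3] ab by simp
        next
          case 2
          then show ?thesis using gift[OF True] ab dc by simp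
        qed
      qed
    qed
    have le: "cost y a \<le> 2 * int \<Delta> - 4" "cost y b \<le> 2 * int \<Delta> - 4" "cost y c \<le> 2 * int \<Delta> - 4"
      using k U abc by auto
    have one: "2 * int \<Delta> - 4 \<le> int \<Delta> + 10" if "0 < cost y n" "n \<in> N y" for n
      using pos[of n] that U by auto
    have "cost y a + cost y b + cost y c \<le> int \<Delta> + 10"
    proof -
      consider "0 < cost y a" "0 < cost y b" | "0 < cost y a" "0 < cost y c" | "0 < cost y b" "0 < cost y c"
        | "cost y a \<le> 0" "cost y b \<le> 0" | "cost y a \<le> 0" "cost y c \<le> 0" | "cost y b \<le> 0" "cost y c \<le> 0"
        by linarith
      then show ?thesis
      proof cases
        case 1
        then show ?thesis using two[of a b c] abc by simp
      next
        case 2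
        then show ?thesis using two[of a c b] abc by (simp add: insert_commute)
      next
        case 3
        then show ?thesis using two[of b c a] abc by (simp add: insert_commute)
      next
        case 4
        then show ?thesis using one[of c] le abc \<Delta>6 by (cases "0 < cost y c") auto
      next
        case 5
        then show ?thesis using one[of b] le abc \<Delta>6 by (cases "0 < cost y b") auto
      next
        case 6
        then show ?thesis using one[of a] le abc \<Delta>6 by (cases "0 < cost y a") auto
      qed
    qed
    then show ?thesis using w abc unfolding charge_cost by simp
  next
    case 2
    then have "card (N y - lights y) = 2" using card_nonlight(1) d3 by simp
    then obtain a b where ab: "N y - lights y = {a, b}" "a \<noteq> b" by (auto simp: card_2_iff)
    obtain l where l: "light y l" using 2 by (auto simp: lights_def card_1_singleton_iff)
    have dd: "2 \<le> d a" "2 \<le> d b" using ab n2 by auto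
    have "\<Delta> < 3 + ((d a - 1) + (d b - 1))" using light_sum ab 2 d3 by simp
    then have sum: "\<Delta> \<le> d a + d b" using dd by linarith
    \<comment> \<open>The right side is the weight \<Delta> + 10 less 3\<Delta> - 2 for the light
      neighbour. It is not positive, so the larger neighbour has to give.\<close>
    have key: "cost y a + cost y b \<le> 12 - 2 * int \<Delta>"
      if ab: "N y - lights y = {a, b}" "a \<noteq> b" and dd: "d a \<le> d b" "2 \<le> d a" and sum: "\<Delta> \<le> d a + d b" for a b
    proof -
      have b3: "3 \<le> d b" using sum dd \<Delta>6 by linarith
      show ?thesis
      proof (cases "poor b")
        case False
        have "cost y a \<le> 2 * int \<Delta> - 4" using k ab by auto
        then show ?thesis using cost_rich[OF b3 False] by linarith
      next
        case True
        have gb: "cost y b \<le> - (3 * int \<Delta> - 18)" using gift[OF True] dd sum by simp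
        \<comment> \<open>If \<open>a\<close> were costly, it would miss being light by at most 1,
          as its second neighbour is poor. Then \<open>light_bound2\<close> would make
          \<open>b\<close> big.\<close>
        have "cost y a \<le> 0"
        proof (rule ccontr)
          assume "\<not> cost y a \<le> 0"
          then have a: "d a = 2" "poor (other a y)" using pos[of a] ab by auto
          have "\<Delta> < d y + (\<Sum>n\<in>N y - lights y - {a}. d n - 1)"
            using poor_not_big[OF a(2)] d3 ab a by (intro light_bound2[OF l]) auto
          also have "N y - lights y - {a} = {b}" using ab by auto
          finally have "\<Delta> < 3 + (d b - 1)" using d3 by simp
          then show False using poor_not_big[OF True] b3 by linarith
        qed
        then show ?thesis using gb \<Delta>6_int by linarith
      qed
    qed
    have "cost y a + cost y b \<le> 12 - 2 * int \<Delta>"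
      using key[of a b] key[of b a] ab dd sum by (cases "d a \<le> d b") (auto simp: insert_commute ac_simps)
    moreover have "sum (cost y) (N y) \<le> (3 * int \<Delta> - 2) + (cost y a + cost y b)"
      using sum_cost_lights ab 2 by (simp add: algebra_simps)
    ultimately show ?thesis using w unfolding charge_cost by simp
  next
    case 3
    then obtain n where n: "N y - lights y = {n}" using card_nonlight(1) d3 by (auto simp: card_1_singleton_iff)
    have "\<Delta> < 3 + (d n - 1)" using light_sum n d3 3 by simp
    then have "big n" using \<Delta>6 by (auto simp: big_def)
    moreover have "sum (cost y) (N y) \<le> 6 * int \<Delta> - 4 + cost y n"
      using sum_cost_lights n 3 by (simp add: algebra_simps)
    \<comment> \<open>Equality is possible: the weight \<Delta> + 10 and the 5\<Delta> - 14 from the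
      big neighbour add up to 2(3\<Delta> - 2).\<close>
    ultimately show ?thesis using w cost_big[of n] unfolding charge_cost by linarith
  qed
qed

lemma charge_poor: "charge y \<ge> 0"
proof -
  have "d y = 3 \<or> d y = 4 \<or> d y = 5 \<or> d y = 6 \<or> 7 \<le> d y" using y_bounds(1) by linarith
  then show ?thesis using charge_3 charge_4 charge_5 charge_6 charge_7 by blast
qed

end

section \<open>Summation of the charges\<close>

lemma sum_charge: "(\<Sum>v\<in>V. charge v) = (\<Sum>v\<in>V. weight v)"
proof -
  have N: "{u \<in> V. u \<in> N v} = N v" "{u \<in> V. v \<in> N u} = N v" for v using N_V N_sym by blast+
  have "(\<Sum>v\<in>V. \<Sum>u\<in>N v. flow u v) = (\<Sum>v\<in>V. \<Sum>u | u \<in> V \<and> u \<in> N v. flow u v)"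
    by (simp only: N)
  also have "\<dots> = (\<Sum>u\<in>V. \<Sum>v | v \<in> V \<and> u \<in> N v. flow u v)"
    by (rule sum.swap_restrict) (rule finV)+
  also have "\<dots> = (\<Sum>u\<in>V. \<Sum>v\<in>N u. flow u v)"
    by (simp only: N)
  finally show ?thesis by (simp add: charge_def sum.distrib sum_subtractf)
qed

text \<open>The deficit of a middle vertex equals the reserve of a vertex of degree \<Delta>, and by
  \<open>centers_le\<close> there are enough of the latter. All other charges are
  nonnegative.\<close>

lemma sum_weight_nonneg: "0 \<le> (\<Sum>v\<in>V. weight v)"
proof -
  let ?p = "2 * int \<Delta> + 4"
  have ch: "charge v \<ge> (if d v = \<Delta> then ?p else 0) - (if v \<in> centers then ?p else 0)" if vV: "v \<in> V" for v
  proof -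
    have C: "d v = 2" if "v \<in> centers" using that by (simp add: centers_def)
    consider "d v = 2" | "big v" | "3 \<le> d v" "\<not> big v" "\<not> poor v" | "poor v" "\<not> big v"
      using d_ge_2[OF vV] by linarith
    then show ?thesis
    proof cases
      case 1
      then show ?thesis using charge_2[OF 1] \<Delta>6 by auto
    next
      case 2
      then show ?thesis using charge_big[OF 2] C not_big_2[of v] \<Delta>6 by auto
    next
      case 3
      then show ?thesis using charge_rich[of v] C by (auto simp: big_def)
    next
      case 4
      then show ?thesis using charge_poor[of v] y_bounds(4)[of v] C by (auto simp: big_def)
    qed
  qed
  have "(\<Sum>v\<in>V. charge v) \<ge> (\<Sum>v\<in>V. (if d v = \<Delta> then ?p else 0) - (if v \<in> centers then ?p else 0))"
    using ch by (rule sum_mono)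
  also have "(\<Sum>v\<in>V. (if d v = \<Delta> then ?p else 0) - (if v \<in> centers then ?p else 0))
      = int (card {v \<in> V. d v = \<Delta>}) * ?p - int (card centers) * ?p"
  proof -
    have "V \<inter> {v. d v = \<Delta>} = {v \<in> V. d v = \<Delta>}" "V \<inter> centers = centers" using centers_subset by auto
    then show ?thesis using finV by (simp add: sum_subtractf sum.If_cases)
  qed
  finally have "int (card {v \<in> V. d v = \<Delta>}) * ?p - int (card centers) * ?p \<le> sum weight V"
    unfolding sum_charge .
  moreover have "int (card centers) * ?p \<le> int (card {v \<in> V. d v = \<Delta>}) * ?p"
    using centers_le by (intro mult_right_mono) auto
  ultimately show ?thesis by linarith
qed

end

subsection \<open>Sparse graphs\<close>

text \<open>The last assumption is the density bound (14\<Delta> - 4)/(5\<Delta> + 2) for induced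
  subgraphs, cleared of denominators. All assumptions pass to induced subgraphs, so a smallest
  counterexample is critical, yet its total weight is negative.\<close>

lemma sparse_square_colorable:
  fixes V :: "'a set" and L :: "'a \<Rightarrow> 'c set"
  assumes "simple_graph V E" "\<And>v. card (nbrs E v) \<le> \<Delta>" "6 \<le> \<Delta>"
    and "\<And>v. v \<in> V \<Longrightarrow> \<Delta> < card (L v)"
    and "\<And>X. X \<subseteq> V \<Longrightarrow> X \<noteq> {} \<Longrightarrow>
      (5 * int \<Delta> + 2) * (2 * int (card (E \<inter> Pow X))) < (14 * int \<Delta> - 4) * int (card X)"
  shows "\<exists>f. sq_coloring V E L f"
  using assms
proof (induction "card V" arbitrary: V E rule: less_induct)
  case less
  note graph = less.prems(1) and sparse = less.prems(5)
  note fin = simple_graph_finite[OF graph]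
  show ?case
  proof (rule ccontr)
    assume no: "\<not> ?thesis"
    have "critical V E \<Delta> L"
    proof
      fix X assume X: "X \<subset> V"
      show "\<exists>f. sq_coloring X (E \<inter> Pow X) L f"
      proof (rule less.hyps)
        show "card X < card V" using X fin by (simp add: psubset_card_mono)
        show "simple_graph X (E \<inter> Pow X)"
          using graph X finite_subset[of X V] by (auto simp: simple_graph_def)
        show "card (nbrs (E \<inter> Pow X) v) \<le> \<Delta>" for v
          using card_mono[OF finite_nbrs[OF graph], of "nbrs (E \<inter> Pow X) v" v] less.prems(2)[of v]
          by (fastforce simp: nbrs_def)
        fix Y assume Y: "Y \<subseteq> X" "Y \<noteq> {}"
        then have "E \<inter> Pow X \<inter> Pow Y = E \<inter> Pow Y" by auto
        then show "(5 * int \<Delta> + 2) * (2 * int (card (E \<inter> Pow X \<inter> Pow Y))) < (14 * int \<Delta> - 4) * int (card Y)"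
          using sparse[of Y] X Y by auto
      qed (use less.prems X in auto)
    qed (use less.prems no in auto)
    then interpret critical V E \<Delta> L .
    have "V \<noteq> {}" using no by (auto simp: sq_coloring_def)
    moreover have "E \<inter> Pow V = E" using graph by (auto simp: simple_graph_def)
    ultimately have neg: "(5 * int \<Delta> + 2) * (2 * int (card E)) < (14 * int \<Delta> - 4) * int (card V)"
      using sparse[of V] by simp
    have "(\<Sum>v\<in>V. int (d v)) = 2 * int (card E)"
      using handshake[OF graph] unfolding d_def by (metis of_nat_sum of_nat_mult of_nat_numeral)
    then have "(\<Sum>v\<in>V. weight v) = (5 * int \<Delta> + 2) * (2 * int (card E) - 2 * int (card V)) - int (card V) * (4 * int \<Delta> - 8)"
      unfolding weight_def by (simp add: sum_subtractf sum_distrib_left[symmetric])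
    also have "\<dots> = (5 * int \<Delta> + 2) * (2 * int (card E)) - (14 * int \<Delta> - 4) * int (card V)"
      by (simp add: algebra_simps)
    finally show False using sum_weight_nonneg neg by linarith
  qed
qed

lemma choosable_square:
  fixes V :: "'a set"
  assumes "simple_graph V E" "\<And>v. card (nbrs E v) \<le> \<Delta>" "6 \<le> \<Delta>"
    and "\<And>X. X \<subseteq> V \<Longrightarrow> X \<noteq> {} \<Longrightarrow>
      (5 * int \<Delta> + 2) * (2 * int (card (E \<inter> Pow X))) < (14 * int \<Delta> - 4) * int (card X)"
  shows "choosable V (square_edges V E) (\<Delta> + 1)"
  unfolding choosable_def
proof (intro allI impI)
  fix L :: "'a \<Rightarrow> nat set"
  assume L: "\<forall>v\<in>V. infinite (L v) \<or> \<Delta> + 1 \<le> card (L v)"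
  \<comment> \<open>Lists that may be infinite are cut down to sets whose \<open>card\<close> is
    meaningful.\<close>
  have "\<exists>M. M \<subseteq> L v \<and> \<Delta> < card M" if "v \<in> V" for v
  proof (cases "infinite (L v)")
    case True
    then obtain M where "M \<subseteq> L v" "card M = \<Delta> + 1" using infinite_arbitrarily_large by blast
    then show ?thesis by auto
  next
    case False
    then show ?thesis using L that by (intro exI[of _ "L v"]) auto
  qed
  then obtain M where M: "\<And>v. v \<in> V \<Longrightarrow> M v \<subseteq> L v \<and> \<Delta> < card (M v)" by metis
  obtain f where f: "sq_coloring V E M f"
    using sparse_square_colorable[OF assms(1-3) _ assms(4), of M] M by auto
  have "L_coloring V (square_edges V E) L f"
    unfolding L_coloring_def square_edges_iff[OF assms(1)]
  proof (intro conjI ballI allI impI)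
    show "f v \<in> L v" if "v \<in> V" for v using f M that by (auto simp: sq_coloring_def)
    show "f u \<noteq> f v" if "near E u v" for u v
    proof -
      have "u \<in> V" "v \<in> V" using that nbrs_in[OF assms(1)] by (auto simp: near_def)
      then show ?thesis using f that by (simp add: sq_coloring_def)
    qed
  qed
  then show "\<exists>f. L_coloring V (square_edges V E) L f" by blast
qed

lemma choosable_square_ge:
  fixes V :: "'a set"
  assumes graph: "simple_graph V E" and v: "v \<in> V" and k: "choosable V (square_edges V E) k"
  shows "card (nbrs E v) + 1 \<le> k"
proof -
  obtain f where f: "L_coloring V (square_edges V E) (\<lambda>_. {..<k}) f"
    using k unfolding choosable_def by (metis card_lessThan order_refl)
  let ?K = "insert v (nbrs E v)"
  have "inj_on f ?K"
  proof (rule inj_onI, rule ccontr)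
    fix x y assume "x \<in> ?K" "y \<in> ?K" "f x = f y" "x \<noteq> y"
    then have "near E x y" unfolding near_def by (metis insert_iff nbrs_commute)
    then show False
      using f \<open>f x = f y\<close> unfolding L_coloring_def square_edges_iff[OF graph] by blast
  qed
  moreover have "f ` ?K \<subseteq> {..<k}"
    using f v nbrs_subset[OF graph] unfolding L_coloring_def by blast
  ultimately have "card ?K \<le> card {..<k}" by (intro card_inj_on_le) auto
  moreover have "card ?K = card (nbrs E v) + 1"
    using nbrs_in(3)[OF graph, of v v] by (subst card_insert_disjoint) (auto simp: finite_nbrs[OF graph])
  ultimately show ?thesis by simp
qed

lemma max_degree_bounds:
  assumes graph: "simple_graph V E" and max: "max_degree V E = \<Delta>" and "0 < \<Delta>"
  shows "card (nbrs E v) \<le> \<Delta>" "\<exists>v\<in>V. card (nbrs E v) = \<Delta>"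
proof -
  have fin: "finite (insert 0 (Defs.degree E ` V))" using simple_graph_finite[OF graph] by simp
  show "card (nbrs E v) \<le> \<Delta>"
  proof (cases "v \<in> V")
    case True
    then show ?thesis
      using Max_ge[OF fin insertI2[OF imageI[OF True]]] max degree_eq_card_nbrs[OF graph, of v]
      by (simp add: max_degree_def)
  next
    case False
    then have "nbrs E v = {}" using nbrs_in(2)[OF graph] by blast
    then show ?thesis by simp
  qed
  \<comment> \<open>As \<Delta> is positive, the maximum is not the inserted 0 but a degree.\<close>
  have "\<Delta> \<in> insert 0 (Defs.degree E ` V)" using Max_in[OF fin] max by (simp add: max_degree_def)
  then show "\<exists>v\<in>V. card (nbrs E v) = \<Delta>" using \<open>0 < \<Delta>\<close> degree_eq_card_nbrs[OF graph] by auto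
qed

lemma choice_number_square:
  fixes V :: "'a set"
  assumes graph: "simple_graph V E" and max: "max_degree V E = \<Delta>" and \<Delta>: "6 \<le> \<Delta>"
    and "\<And>X. X \<subseteq> V \<Longrightarrow> X \<noteq> {} \<Longrightarrow>
      (5 * int \<Delta> + 2) * (2 * int (card (E \<inter> Pow X))) < (14 * int \<Delta> - 4) * int (card X)"
  shows "choice_number V (square_edges V E) = \<Delta> + 1"
  unfolding choice_number_def
proof (rule Least_equality)
  have "0 < \<Delta>" using \<Delta> by simp
  note deg = max_degree_bounds[OF graph max this]
  show "choosable V (square_edges V E) (\<Delta> + 1)"
    by (rule choosable_square[OF graph deg(1) \<Delta> assms(4)])
  show "\<Delta> + 1 \<le> k" if "choosable V (square_edges V E) k" for k
    using deg(2) choosable_square_ge[OF graph _ that] by blast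
qed

lemma density_le_mad:
  assumes graph: "simple_graph V E" and X: "X \<subseteq> V" "X \<noteq> {}"
  shows "2 * real (card (E \<inter> Pow X)) / real (card X) \<le> mad V E"
  unfolding mad_def
proof (rule Max_ge)
  let ?S = "{2 * real (card F) / real (card W) | W F. subgraph W F V E \<and> W \<noteq> {}}"
  have "?S \<subseteq> (\<lambda>(W, F). 2 * real (card F) / real (card W)) ` (Pow V \<times> Pow E)"
    by (auto simp: subgraph_def)
  moreover have "finite (Pow V \<times> Pow E)" using simple_graph_finite[OF graph] by simp
  ultimately show "finite ?S" by (meson finite_imageI finite_subset)
  have "subgraph X (E \<inter> Pow X) V E"
    using graph X finite_subset[of X V] by (auto simp: subgraph_def simple_graph_def)
  then show "2 * real (card (E \<inter> Pow X)) / real (card X) \<in> ?S" using X by blast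
qed

lemma choice_number_square_mad:
  fixes V :: "'a set"
  assumes graph: "simple_graph V E" and max: "max_degree V E = \<Delta>" and \<Delta>: "6 \<le> \<Delta>"
    and mad: "mad V E < 2 + (4 * real \<Delta> - 8) / (5 * real \<Delta> + 2)"
  shows "choice_number V (square_edges V E) = \<Delta> + 1"
proof (rule choice_number_square[OF graph max \<Delta>])
  fix X assume X: "X \<subseteq> V" "X \<noteq> {}"
  then have pos: "0 < card X" using simple_graph_finite[OF graph] finite_subset by (metis card_gt_0_iff)
  have "2 * real (card (E \<inter> Pow X)) / real (card X) < 2 + (4 * real \<Delta> - 8) / (5 * real \<Delta> + 2)"
    using density_le_mad[OF graph X] mad by linarith
  also have "\<dots> = (14 * real \<Delta> - 4) / (5 * real \<Delta> + 2)" by (simp add: field_simps)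
  finally have "(5 * real \<Delta> + 2) * (2 * real (card (E \<inter> Pow X))) < (14 * real \<Delta> - 4) * real (card X)"
    using pos by (simp add: field_simps)
  then have "real_of_int ((5 * int \<Delta> + 2) * (2 * int (card (E \<inter> Pow X)))) < real_of_int ((14 * int \<Delta> - 4) * int (card X))"
    by simp
  then show "(5 * int \<Delta> + 2) * (2 * int (card (E \<inter> Pow X))) < (14 * int \<Delta> - 4) * int (card X)"
    by (simp only: of_int_less_iff)
qed

subsection \<open>Generating sets of the cycle space\<close>

fun path_edges :: "'a list \<Rightarrow> 'a set set" where
  "path_edges (x # y # zs) = insert {x, y} (path_edges (y # zs))"
| "path_edges _ = {}"

definition cycle_edges :: "'a list \<Rightarrow> 'a set set" where
  "cycle_edges c = path_edges (c @ [hd c])"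

lemma walk_iff_path_edges: "walk V E xs \<longleftrightarrow> xs \<noteq> [] \<and> set xs \<subseteq> V \<and> path_edges xs \<subseteq> E"
proof (induction xs rule: path_edges.induct)
  case (1 x y zs)
  then show ?case by auto
qed (auto simp: walk_def)

lemma path_edges_append: "path_edges (xs @ y # zs) = path_edges (xs @ [y]) \<union> path_edges (y # zs)"
proof (induction xs)
  case (Cons x xs)
  then show ?case by (cases xs) auto
qed simp

lemma path_edges_append2:
  "xs \<noteq> [] \<Longrightarrow> ys \<noteq> [] \<Longrightarrow> path_edges (xs @ ys) = insert {last xs, hd ys} (path_edges xs \<union> path_edges ys)"
proof (induction xs)
  case (Cons x xs)
  then show ?case by (cases xs; cases ys) auto
qed simp

lemma path_edges_rev [simp]: "path_edges (rev xs) = path_edges xs"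
proof (induction xs)
  case (Cons x xs)
  show ?case
  proof (cases xs)
    case (Cons y ys)
    then have "path_edges (rev (x # xs)) = insert {last (rev xs), x} (path_edges (rev xs))"
      using path_edges_append2[of "rev xs" "[x]"] by simp
    also have "last (rev xs) = y" using Cons by simp
    finally show ?thesis using Cons.IH Cons by (simp add: insert_commute)
  qed simp
qed simp

lemma path_edges_subset: "e \<in> path_edges xs \<Longrightarrow> e \<subseteq> set xs"
  by (induction xs rule: path_edges.induct) auto

lemma Union_path_edges: "2 \<le> length xs \<Longrightarrow> \<Union> (path_edges xs) = set xs"
proof (induction xs rule: path_edges.induct)
  case (1 x y zs)
  then show ?case by (cases zs) auto
qed auto

lemma finite_path_edges [simp]: "finite (path_edges xs)"
  by (induction xs rule: path_edges.induct) auto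

lemma card_path_edges: "distinct xs \<Longrightarrow> card (path_edges xs) = length xs - 1"
proof (induction xs rule: path_edges.induct)
  case (1 x y zs)
  then have "{x, y} \<notin> path_edges (y # zs)" using path_edges_subset[of "{x, y}" "y # zs"] by auto
  then show ?case using 1 by simp
qed auto

text \<open>An inner vertex separates the ends along a path. This shows that the closing edge of a
  cycle is not among the edges of the path.\<close>

lemma end_edge:
  assumes "distinct (a # xs @ [b])" "{a, b} \<in> path_edges (a # xs @ [b])"
  shows "xs = []"
proof (cases xs)
  case (Cons x ys)
  then have "{a, b} \<noteq> {a, x}" "{a, b} \<notin> path_edges (x # ys @ [b])"
    using assms(1) path_edges_subset[of "{a, b}" "x # ys @ [b]"] by (auto simp: doubleton_eq_iff)
  then show ?thesis using assms(2) Cons by auto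
qed

lemma cycle_edges_rotate: "cycle_edges (xs @ ys) = cycle_edges (ys @ xs)"
proof (cases "xs = [] \<or> ys = []")
  case False
  then show ?thesis
    by (auto simp: cycle_edges_def path_edges_append2)
qed auto

lemma cycle_edges_eq: "c \<noteq> [] \<Longrightarrow> cycle_edges c = insert {last c, hd c} (path_edges c)"
  by (simp add: cycle_edges_def path_edges_append2)

lemma card_cycle_edges:
  assumes "distinct c" "3 \<le> length c"
  shows "card (cycle_edges c) = length c"
proof -
  obtain a ds where "c = a # ds" using assms by (cases c) auto
  moreover from this have "ds \<noteq> []" using assms by auto
  ultimately obtain xs b where c: "c = a # xs @ [b]" by (metis rev_exhaust)
  then have "{a, b} \<notin> path_edges c" using end_edge[of a xs b] assms by auto
  then show ?thesis
    using card_path_edges[OF assms(1)] c assms by (auto simp: cycle_edges_eq insert_commute)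
qed

lemma Union_cycle_edges:
  assumes "2 \<le> length c"
  shows "\<Union> (cycle_edges c) = set c"
proof -
  have "c \<noteq> []" using assms by auto
  then show ?thesis using Union_path_edges[of c] assms by (auto simp: cycle_edges_eq)
qed

lemma graph_cycle_iff:
  "graph_cycle V E c \<longleftrightarrow> set c \<subseteq> V \<and> distinct c \<and> 3 \<le> length c \<and> cycle_edges c \<subseteq> E"
proof (cases "c = []")
  case False
  then show ?thesis by (auto simp: graph_cycle_def walk_iff_path_edges cycle_edges_eq)
qed (auto simp: graph_cycle_def)

lemma graph_cycle_rotate: "graph_cycle V E (xs @ ys) \<longleftrightarrow> graph_cycle V E (ys @ xs)"
  unfolding graph_cycle_iff by (auto simp: cycle_edges_rotate[of xs ys])

lemma cycle_at_edge:
  assumes "graph_cycle V E c" "f \<in> cycle_edges c"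
  obtains c' where "graph_cycle V E c'" "cycle_edges c' = cycle_edges c" "set c' = set c"
    "f = {last c', hd c'}"
proof -
  have split: "\<exists>xs ys. zs = xs @ ys \<and> xs \<noteq> [] \<and> ys \<noteq> [] \<and> f = {last xs, hd ys}"
    if "f \<in> path_edges zs" for zs :: "'a list"
    using that
  proof (induction zs rule: path_edges.induct)
    case (1 x y zs)
    show ?case
    proof (cases "f = {x, y}")
      case True
      then show ?thesis by (intro exI[of _ "[x]"] exI[of _ "y # zs"]) auto
    next
      case False
      then obtain xs ys where *: "y # zs = xs @ ys" "xs \<noteq> []" "ys \<noteq> []" "f = {last xs, hd ys}"
        using 1 by auto
      then show ?thesis by (intro exI[of _ "x # xs"] exI[of _ "ys"]) auto
    qed
  qed auto
  have ne: "c \<noteq> []" using assms by (auto simp: graph_cycle_def)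
  show thesis
  proof (cases "f = {last c, hd c}")
    case True
    then show thesis using that[of c] assms by simp
  next
    case False
    then obtain xs ys where *: "c = xs @ ys" "xs \<noteq> []" "ys \<noteq> []" "f = {last xs, hd ys}"
      using split[of c] assms ne by (auto simp: cycle_edges_eq)
    then show thesis
      using that[of "ys @ xs"] assms graph_cycle_rotate[of V E xs ys] cycle_edges_rotate[of xs ys] by auto
  qed
qed

lemma cycle_at_vertices:
  assumes "graph_cycle V E c" "a \<in> set c" "b \<in> set c" "a \<noteq> b"
  obtains A B where "graph_cycle V E (a # A @ b # B)" "cycle_edges (a # A @ b # B) = cycle_edges c"
    "set (a # A @ b # B) = set c"
proof -
  obtain xs ys where c: "c = xs @ a # ys" using assms(2) by (meson split_list)
  then have "b \<in> set (ys @ xs)" using assms by auto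
  then obtain A B where AB: "ys @ xs = A @ b # B" by (meson split_list)
  have "graph_cycle V E ((a # ys) @ xs)" "cycle_edges ((a # ys) @ xs) = cycle_edges c"
    using assms(1) c graph_cycle_rotate[of V E xs "a # ys"] cycle_edges_rotate[of xs "a # ys"] by auto
  moreover have "set (a # A @ b # B) = set c"
    using arg_cong[OF AB, of set] by (auto simp: c)
  ultimately show thesis using that[of A B] AB by simp
qed

section \<open>Forests and the rank of the cycle space\<close>

lemma acyclic_card:
  fixes V :: "'a set"
  assumes "simple_graph V E" "V \<noteq> {}" "\<And>c. \<not> graph_cycle V E c"
  shows "card E + 1 \<le> card V"
  using assms
proof (induction "card V" arbitrary: V E rule: less_induct)
  case less
  note graph = less.prems(1) and fin = simple_graph_finite[OF less.prems(1)]
  have "\<exists>v\<in>V. card (nbrs E v) \<le> 1"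
  proof (rule ccontr)
    assume "\<not> ?thesis"
    then have deg: "2 \<le> card (nbrs E v)" if "v \<in> V" for v using that by force
    define P where "P n \<longleftrightarrow> (\<exists>xs. walk V E xs \<and> distinct xs \<and> length xs = n)" for n
    obtain v where "v \<in> V" using less.prems by blast
    then have "walk V E [v]" by (simp add: walk_def)
    then have "P 1" unfolding P_def by (intro exI[of _ "[v]"]) auto
    moreover have bound: "n \<le> card V" if "P n" for n
      using that fin(1) by (auto simp: P_def walk_def) (metis card_mono distinct_card)
    ultimately obtain n where n: "P n" "\<And>m. P m \<Longrightarrow> m \<le> n" using Nat.ex_has_greatest_nat[of P 1 "card V"] by auto
    then obtain xs where xs: "walk V E xs" "distinct xs" "length xs = n" by (auto simp: P_def)
    then obtain x ys where x: "xs = x # ys" by (cases xs) (auto simp: walk_def)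
    have xV: "x \<in> V" using xs x by (simp add: walk_def)
    \<comment> \<open>The path is longest, so all neighbours of its first vertex lie on it; a
      neighbour besides the second vertex of the path closes a cycle.\<close>
    have nb: "z \<in> set ys" if z: "z \<in> nbrs E x" for z
    proof (rule ccontr)
      assume "z \<notin> set ys"
      moreover have "z \<noteq> x" "z \<in> V" using nbrs_in[OF graph z] by auto
      ultimately have "walk V E (z # xs)" "distinct (z # xs)"
        using xs x z by (auto simp: nbrs_def)
      then have "P (Suc n)" unfolding P_def using xs(3) by (intro exI[of _ "z # xs"]) auto
      then show False using n(2) by fastforce
    qed
    have "nbrs E x \<noteq> {}" using deg[OF xV] by auto
    then obtain y ys' where y: "ys = y # ys'" using nb by (cases ys) auto
    have "\<not> nbrs E x \<subseteq> {y}" using deg[OF xV] card_mono[of "{y}" "nbrs E x"] by auto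
    then obtain z where z: "z \<in> nbrs E x" "z \<noteq> y" by blast
    then have "z \<in> set ys'" using nb y by auto
    then obtain A B where AB: "ys' = A @ z # B" by (meson split_list)
    have "path_edges (x # y # A @ [z]) \<subseteq> path_edges xs"
      using path_edges_append[of "x # y # A" z B] x y AB by auto
    then have "graph_cycle V E (x # y # A @ [z])"
      using xs x y AB z by (auto simp: graph_cycle_def walk_iff_path_edges nbrs_def)
    then show False using less.prems by blast
  qed
  then obtain v where v: "v \<in> V" "card (nbrs E v) \<le> 1" by blast
  define W where "W = V - {v}"
  define F where "F = {e \<in> E. v \<notin> e}"
  have "card {e \<in> E. v \<in> e} \<le> 1" using degree_eq_card_nbrs[OF graph, of v] v by (simp add: Defs.degree_def)
  moreover have "card E = card F + card {e \<in> E. v \<in> e}"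
  proof -
    have "E = F \<union> {e \<in> E. v \<in> e}" "F \<inter> {e \<in> E. v \<in> e} = {}" by (auto simp: F_def)
    then show ?thesis using card_Un_disjoint[of F "{e \<in> E. v \<in> e}"] fin(2) by (auto simp: F_def)
  qed
  ultimately have E: "card E \<le> card F + 1" by simp
  have W: "card W + 1 = card V" using card.remove[OF fin(1) v(1)] unfolding W_def by linarith
  show ?case
  proof (cases "W = {}")
    case True
    have False if "e \<in> E" for e
    proof -
      have "e \<subseteq> {v}" "card e = 2" using graph that True by (auto simp: simple_graph_def W_def)
      then show False using card_mono[of "{v}" e] by simp
    qed
    then have "E = {}" by blast
    then show ?thesis using W by simp
  next
    case False
    have "card F + 1 \<le> card W"
    proof (rule less.hyps)
      show "card W < card V" using W by simp
      show "simple_graph W F" using graph by (auto simp: simple_graph_def W_def F_def)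
      show "\<not> graph_cycle W F c" for c
        using less.prems(3)[of c] by (auto simp: graph_cycle_iff W_def F_def)
    qed (fact False)
    then show ?thesis using E W by simp
  qed
qed

text \<open>The linear span over the field with two elements, with symmetric difference as
  addition.\<close>

inductive_set sym_span :: "'a set set \<Rightarrow> 'a set set" for \<F> where
  empty: "{} \<in> sym_span \<F>"
| step: "X \<in> sym_span \<F> \<Longrightarrow> F \<in> \<F> \<Longrightarrow> sym_diff X F \<in> sym_span \<F>"

lemma sym_diff_assoc: "sym_diff X (sym_diff Y Z) = sym_diff (sym_diff X Y) Z"
  by blast

lemma sym_span_sym_diff:
  assumes "X \<in> sym_span \<F>" "Y \<in> sym_span \<F>"
  shows "sym_diff X Y \<in> sym_span \<F>"
  using assms(2)
proof induction
  case (step Y F)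
  then show ?case using sym_span.step[of "sym_diff X Y" \<F> F] by (simp only: sym_diff_assoc)
qed (use assms(1) in simp)

lemma sym_span_base: "F \<in> \<F> \<Longrightarrow> F \<in> sym_span \<F>"
  using sym_span.step[OF sym_span.empty, of F \<F>] by simp

lemma sym_span_Union: "X \<in> sym_span \<F> \<Longrightarrow> X \<subseteq> \<Union> \<F>"
  by (induction rule: sym_span.induct) auto

text \<open>The cyclomatic number bounds the size of a generating set from below: deleting an edge \<open>e\<close> of
  a cycle and eliminating \<open>e\<close> from the generators lowers both by one.\<close>

lemma cycle_generators_card:
  fixes V :: "'a set"
  assumes "simple_graph V E" "V \<noteq> {}" "finite \<F>"
    and "\<And>c. graph_cycle V E c \<Longrightarrow> cycle_edges c \<in> sym_span \<F>"
  shows "card E + 1 \<le> card V + card \<F>"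
  using assms
proof (induction "card E" arbitrary: E \<F> rule: less_induct)
  case less
  show ?case
  proof (cases "\<exists>c. graph_cycle V E c")
    case False
    then show ?thesis using acyclic_card[OF less.prems(1,2)] by force
  next
    case True
    then obtain c where c: "graph_cycle V E c" by blast
    then have "c \<noteq> []" by (auto simp: graph_cycle_def)
    then have e0: "{last c, hd c} \<in> cycle_edges c" by (simp add: cycle_edges_eq)
    define e where "e = {last c, hd c}"
    have eE: "e \<in> E" using e0 c by (auto simp: graph_cycle_iff e_def)
    obtain F0 where F0: "F0 \<in> \<F>" "e \<in> F0"
      using sym_span_Union[OF less.prems(4)[OF c]] e0 by (auto simp: e_def)
    \<comment> \<open>Gaussian elimination with pivot \<open>F0\<close>: \<phi> is linear, maps
      \<open>F0\<close> to the empty set and fixes the sets without \<open>e\<close>. Hence the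
      images of the other generators still span all cycles avoiding \<open>e\<close>.\<close>
    define \<phi> where "\<phi> X = (if e \<in> X then sym_diff X F0 else X)" for X
    define \<G> where "\<G> = \<phi> ` (\<F> - {F0})"
    have span: "\<phi> X \<in> sym_span \<G>" if "X \<in> sym_span \<F>" for X
      using that
    proof induction
      case empty
      then show ?case by (simp add: \<phi>_def sym_span.empty)
    next
      case (step X F)
      show ?case
      proof (cases "F = F0")
        case True
        then have "\<phi> (sym_diff X F) = \<phi> X" using F0(2) by (auto simp: \<phi>_def)
        then show ?thesis using step by simp
      next
        case False
        then have "\<phi> F \<in> \<G>" using step by (auto simp: \<G>_def)
        moreover have "\<phi> (sym_diff X F) = sym_diff (\<phi> X) (\<phi> F)" using F0(2) by (auto simp: \<phi>_def)
        ultimately show ?thesis using step by (simp add: sym_span.step)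
      qed
    qed
    have "card \<G> \<le> card (\<F> - {F0})" using less.prems(3) by (auto simp: \<G>_def card_image_le)
    then have cG: "card \<G> + 1 \<le> card \<F>"
      using card.remove[OF less.prems(3) F0(1)] by linarith
    have cE: "card (E - {e}) + 1 = card E"
      using card.remove[OF simple_graph_finite(2)[OF less.prems(1)] eE] by linarith
    have "card (E - {e}) + 1 \<le> card V + card \<G>"
    proof (rule less.hyps)
      show "simple_graph V (E - {e})" using less.prems(1) by (auto simp: simple_graph_def)
      show "finite \<G>" using less.prems(3) by (simp add: \<G>_def)
      fix c assume "graph_cycle V (E - {e}) c"
      then have "graph_cycle V E c" "e \<notin> cycle_edges c" by (auto simp: graph_cycle_iff)
      then show "cycle_edges c \<in> sym_span \<G>" using span[OF less.prems(4), of c] by (simp add: \<phi>_def)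
    qed (use less.prems cE in auto)
    then show ?thesis using cG cE by simp
  qed
qed

subsection \<open>Plane drawings\<close>

locale drawing =
  fixes V :: "'a set" and E :: "'a set set" and p :: "'a \<Rightarrow> complex" and \<gamma> :: "'a set \<Rightarrow> real \<Rightarrow> complex"
  assumes graph: "simple_graph V E" and plane: "plane_drawing V E p \<gamma>"
begin

definition im :: "'a set set \<Rightarrow> complex set" where
  "im X = (\<Union>e\<in>X. path_image (\<gamma> e))"

lemma inj_p: "inj_on p V" using plane by (simp add: plane_drawing_def)

lemma arc_edge: "e \<in> E \<Longrightarrow> arc (\<gamma> e)" using plane by (simp add: plane_drawing_def)

lemma edge_ends: "e \<in> E \<Longrightarrow> {pathstart (\<gamma> e), pathfinish (\<gamma> e)} = p ` e"
  using plane by (simp add: plane_drawing_def)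

lemma edge_V: "e \<in> E \<Longrightarrow> e \<subseteq> V" using graph by (simp add: simple_graph_def)

lemma end_in_edge: "e \<in> E \<Longrightarrow> v \<in> e \<Longrightarrow> p v \<in> path_image (\<gamma> e)"
  using edge_ends[of e] by (metis (no_types) image_eqI insert_iff pathfinish_in_path_image pathstart_in_path_image singletonD)

lemma edge_inter:
  assumes "e \<in> E" "f \<in> E" "e \<noteq> f" "z \<in> path_image (\<gamma> e)" "z \<in> path_image (\<gamma> f)"
  shows "z \<in> p ` (e \<inter> f)"
proof -
  have "z \<in> p ` e" "z \<in> p ` f" using plane assms unfolding plane_drawing_def by blast+
  then show ?thesis
    using inj_on_image_Int[OF inj_p edge_V[OF assms(1)] edge_V[OF assms(2)]] by auto
qed

text \<open>A point of the edge that lies on no other edge, so the image of a set of edges reveals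
  whether \<open>e\<close> belongs to the set.\<close>

definition mid where "mid e = \<gamma> e (1/2)"

lemma mid_in: "mid e \<in> path_image (\<gamma> e)" by (auto simp: mid_def path_image_def)

lemma mid_not_end:
  assumes "e \<in> E" shows "mid e \<notin> p ` e"
proof -
  have inj: "inj_on (\<gamma> e) {0..1}" using arc_edge[OF assms] by (simp add: arc_def)
  have "\<gamma> e (1/2) \<noteq> \<gamma> e 0" "\<gamma> e (1/2) \<noteq> \<gamma> e 1"
    using inj_onD[OF inj, of "1/2" 0] inj_onD[OF inj, of "1/2" 1] by auto
  then show ?thesis using edge_ends[OF assms] by (auto simp: mid_def pathstart_def pathfinish_def)
qed

lemma mid_in_im: "X \<subseteq> E \<Longrightarrow> e \<in> E \<Longrightarrow> mid e \<in> im X \<longleftrightarrow> e \<in> X"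
  unfolding im_def using mid_in mid_not_end edge_inter by (auto; blast)

lemma im_Un: "im (X \<union> Y) = im X \<union> im Y" by (auto simp: im_def)

lemma im_insert: "im (insert e X) = path_image (\<gamma> e) \<union> im X" by (auto simp: im_def)

lemma im_subset_iff: "X \<subseteq> E \<Longrightarrow> Y \<subseteq> E \<Longrightarrow> im X \<subseteq> im Y \<Longrightarrow> X \<subseteq> Y"
  using mid_in_im by (metis subset_eq)

lemma im_Int:
  assumes "X \<subseteq> E" "Y \<subseteq> E" "X \<inter> Y = {}"
  shows "im X \<inter> im Y \<subseteq> p ` (\<Union>X \<inter> \<Union>Y)"
proof
  fix z assume "z \<in> im X \<inter> im Y"
  then obtain e f where "e \<in> X" "f \<in> Y" "z \<in> path_image (\<gamma> e)" "z \<in> path_image (\<gamma> f)"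
    by (auto simp: im_def)
  moreover from this have "e \<noteq> f" "e \<in> E" "f \<in> E" using assms by auto
  ultimately have "z \<in> p ` (e \<inter> f)" using edge_inter by blast
  then show "z \<in> p ` (\<Union>X \<inter> \<Union>Y)" using \<open>e \<in> X\<close> \<open>f \<in> Y\<close> by blast
qed

lemma vertex_im: "X \<subseteq> E \<Longrightarrow> v \<in> \<Union>X \<Longrightarrow> p v \<in> im X"
  unfolding im_def using end_in_edge by blast

lemma compact_im: "X \<subseteq> E \<Longrightarrow> compact (im X)"
proof -
  assume X: "X \<subseteq> E"
  then have "finite X" using simple_graph_finite(2)[OF graph] finite_subset by blast
  then show ?thesis unfolding im_def using X arc_edge by (intro compact_UN compact_path_image) (auto simp: arc_def)
qed

lemma arc_single:
  assumes "{a, b} \<in> E"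
  shows "\<exists>h. arc h \<and> pathstart h = p a \<and> pathfinish h = p b \<and> path_image h = path_image (\<gamma> {a, b})"
proof -
  have e: "{pathstart (\<gamma> {a, b}), pathfinish (\<gamma> {a, b})} = {p a, p b}" using edge_ends[OF assms] by simp
  show ?thesis
  proof (cases "pathstart (\<gamma> {a, b}) = p a")
    case True
    then show ?thesis using e arc_edge[OF assms]
      by (intro exI[of _ "\<gamma> {a, b}"]) (auto simp: doubleton_eq_iff)
  next
    case False
    then show ?thesis using e arc_edge[OF assms]
      by (intro exI[of _ "reversepath (\<gamma> {a, b})"]) (auto simp: doubleton_eq_iff arc_reversepath)
  qed
qed

lemma arc_path:
  assumes "distinct xs" "2 \<le> length xs" "path_edges xs \<subseteq> E"
  shows "\<exists>h. arc h \<and> pathstart h = p (hd xs) \<and> pathfinish h = p (last xs) \<and> path_image h = im (path_edges xs)"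
  using assms
proof (induction xs rule: path_edges.induct)
  case (1 x y zs)
  then have e: "{x, y} \<in> E" by simp
  obtain g where g: "arc g" "pathstart g = p x" "pathfinish g = p y" "path_image g = path_image (\<gamma> {x, y})"
    using arc_single[OF e] by blast
  show ?case
  proof (cases "zs = []")
    case True
    then show ?thesis using g by (intro exI[of _ g]) (auto simp: im_def)
  next
    case False
    then have len: "2 \<le> length (y # zs)" by (cases zs) auto
    then obtain h where h: "arc h" "pathstart h = p y" "pathfinish h = p (last (y # zs))"
      "path_image h = im (path_edges (y # zs))" using 1 by auto
    have "im {{x, y}} \<inter> im (path_edges (y # zs)) \<subseteq> p ` (\<Union>{{x, y}} \<inter> \<Union>(path_edges (y # zs)))"
      using 1 e path_edges_subset[of "{x, y}" "y # zs"] by (intro im_Int) auto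
    also have "\<dots> \<subseteq> {p y}" using 1 Union_path_edges[OF len] by auto
    finally have "path_image g \<inter> path_image h \<subseteq> {pathstart h}" using g h by (simp add: im_def)
    then have "arc (g +++ h)" using g h by (intro arc_join) auto
    then show ?thesis using g h
      by (intro exI[of _ "g +++ h"]) (auto simp: path_image_join im_def)
  qed
qed auto

section \<open>Cycles as Jordan curves\<close>

definition cyc :: "'a set set \<Rightarrow> bool" where
  "cyc X \<longleftrightarrow> (\<exists>c. graph_cycle V E c \<and> X = cycle_edges c)"

definition ins :: "'a set set \<Rightarrow> complex set" where "ins X = inside (im X)"

lemma cyc_E: "cyc X \<Longrightarrow> X \<subseteq> E" by (auto simp: cyc_def graph_cycle_iff)

lemma ins_im: "ins X \<inter> im X = {}" by (simp add: ins_def)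

text \<open>The edge and the rest of the cycle are separate arcs, so that different cycles through
  \<open>e\<close> can be compared along their common arc.\<close>

lemma cyc_edge_arc:
  assumes "cyc X" "e \<in> X"
  obtains a b g h where "e = {a, b}" "arc g" "pathstart g = p a" "pathfinish g = p b"
    "path_image g = path_image (\<gamma> e)"
    "arc h" "pathstart h = p b" "pathfinish h = p a" "path_image h = im (X - {e})"
    "simple_path (g +++ h)" "path_image (g +++ h) = im X"
proof -
  obtain c0 where "graph_cycle V E c0" "X = cycle_edges c0" using assms by (auto simp: cyc_def)
  then obtain c where c: "graph_cycle V E c" "cycle_edges c = X" "e = {last c, hd c}"
    using cycle_at_edge[of V E c0 e] assms by metis
  then have cc: "distinct c" "3 \<le> length c" "X \<subseteq> E" by (auto simp: graph_cycle_iff)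
  then have "c \<noteq> []" by auto
  then obtain b xs where bx: "c = b # xs" by (cases c) auto
  then have "xs \<noteq> []" using cc by auto
  then obtain ys a where "xs = ys @ [a]" by (metis rev_exhaust)
  with bx have c': "c = b # ys @ [a]" by simp
  have "ys \<noteq> []" using c' cc by auto
  then have ne: "e \<notin> path_edges c" using end_edge[of b ys a] cc c c' by (auto simp: insert_commute)
  have X: "X = insert e (path_edges c)" using c \<open>c \<noteq> []\<close> by (simp add: cycle_edges_eq)
  then have Xe: "X - {e} = path_edges c" using ne by auto
  have e: "e = {a, b}" "e \<in> E" using c c' assms cc by auto
  obtain h where h: "arc h" "pathstart h = p b" "pathfinish h = p a" "path_image h = im (X - {e})"
    using arc_path[of c] cc X Xe c' by auto
  obtain g where g: "arc g" "pathstart g = p a" "pathfinish g = p b" "path_image g = path_image (\<gamma> e)"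
    using arc_single[of a b] e by auto
  have "im {e} \<inter> im (X - {e}) \<subseteq> p ` (\<Union>{e} \<inter> \<Union>(X - {e}))"
    using cc e by (intro im_Int) auto
  also have "\<dots> \<subseteq> {p a, p b}" using e by auto
  finally have "simple_path (g +++ h)" using g h by (intro simple_path_join_loop) (auto simp: im_def)
  moreover have "path_image (g +++ h) = im X"
    using g h X Xe by (auto simp: path_image_join im_insert)
  ultimately show thesis using that e g h by blast
qed

lemma cyc_nonempty: "cyc X \<Longrightarrow> X \<noteq> {}"
proof -
  assume "cyc X"
  then obtain c where c: "graph_cycle V E c" "X = cycle_edges c" by (auto simp: cyc_def)
  then have "3 \<le> card X" using card_cycle_edges[of c] by (simp add: graph_cycle_iff)
  then show "X \<noteq> {}" by auto
qed

lemma cyc_jordan: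
  assumes "cyc X"
  shows "ins X \<noteq> {}" "open (ins X)" "connected (ins X)" "open (outside (im X))"
    "ins X \<union> outside (im X) = - im X" "frontier (ins X) = im X" "ins X \<inter> outside (im X) = {}"
proof -
  obtain e where "e \<in> X" using cyc_nonempty[OF assms] by blast
  then obtain a b g h where g: "pathstart g = p a" "pathfinish g = p b"
    "pathstart h = p b" "pathfinish h = p a" "simple_path (g +++ h)" "path_image (g +++ h) = im X"
    using cyc_edge_arc[OF assms] by metis
  then have "pathfinish (g +++ h) = pathstart (g +++ h)" by simp
  from Jordan_inside_outside[OF g(5) this]
  show "ins X \<noteq> {}" "open (ins X)" "connected (ins X)" "open (outside (im X))"
    "ins X \<union> outside (im X) = - im X" "frontier (ins X) = im X" "ins X \<inter> outside (im X) = {}"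
    unfolding ins_def g(6) by auto
qed

text \<open>Off its end points the path avoids \<open>X\<close>, so that meeting the inside of \<open>X\<close> means lying in it.\<close>

definition chord :: "'a set set \<Rightarrow> 'a list \<Rightarrow> bool" where
  "chord X P \<longleftrightarrow> (\<exists>a Q b. P = a # Q @ [b] \<and> a \<in> \<Union>X \<and> b \<in> \<Union>X \<and> set Q \<inter> \<Union>X = {}) \<and>
     distinct P \<and> set P \<subseteq> V \<and> path_edges P \<subseteq> E \<and> path_edges P \<inter> X = {} \<and> im (path_edges P) \<inter> ins X \<noteq> {}"

text \<open>The chord and the two parts \<open>E1\<close>, \<open>E2\<close> of the cycle form a
  theta curve, and the cycles through the chord divide the inside of \<open>X\<close>. A point of
  the chord in \<open>ins X\<close> lies on both of these cycles, so both insides are strictly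
  smaller. In the symmetric difference the chord cancels.\<close>

lemma chord_split:
  assumes X: "cyc X" and P: "chord X P"
  shows "\<exists>X' X''. cyc X' \<and> cyc X'' \<and> X = sym_diff X' X'' \<and> ins X' \<subset> ins X \<and> ins X'' \<subset> ins X"
proof -
  obtain a Q b where ab: "P = a # Q @ [b]" "a \<in> \<Union>X" "b \<in> \<Union>X" "set Q \<inter> \<Union>X = {}"
    using P by (auto simp: chord_def)
  have Pd: "distinct P" "set P \<subseteq> V" "path_edges P \<subseteq> E" "path_edges P \<inter> X = {}"
    "im (path_edges P) \<inter> ins X \<noteq> {}" using P by (auto simp: chord_def)
  have neq: "a \<noteq> b" using ab Pd by auto
  obtain c0 where c0: "graph_cycle V E c0" "X = cycle_edges c0" using X by (auto simp: cyc_def)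
  have UX: "\<Union>X = set c0" using Union_cycle_edges[of c0] c0 by (auto simp: graph_cycle_iff)
  have "a \<in> set c0" "b \<in> set c0" using ab UX by auto
  then obtain A B where c: "graph_cycle V E (a # A @ b # B)" "cycle_edges (a # A @ b # B) = X"
    "set (a # A @ b # B) = \<Union>X"
    using cycle_at_vertices[OF c0(1) _ _ neq] UX c0(2) by metis
  define E1 E2 EP where "E1 = path_edges (a # A @ [b])" and "E2 = path_edges (b # B @ [a])"
    and "EP = path_edges P"
  have dist: "distinct (a # A @ b # B)" "3 \<le> length (a # A @ b # B)" "X \<subseteq> E" "\<Union>X \<subseteq> V"
    using c by (auto simp: graph_cycle_iff)
  have X12: "X = E1 \<union> E2"
    using c(2) path_edges_append[of "a # A" b "B @ [a]"] by (simp add: cycle_edges_def E1_def E2_def)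
  have U1: "\<Union>E1 = set (a # A @ [b])" unfolding E1_def by (rule Union_path_edges) simp
  have U2: "\<Union>E2 = set (b # B @ [a])" unfolding E2_def by (rule Union_path_edges) simp
  have UP: "\<Union>EP = set P" unfolding EP_def by (rule Union_path_edges) (simp add: ab)
  have two: "card e = 2" if "e \<in> E" for e using graph that by (simp add: simple_graph_def)
  have disj: "E1 \<inter> E2 = {}"
  proof (rule ccontr)
    assume "E1 \<inter> E2 \<noteq> {}"
    then obtain e where e: "e \<in> E1" "e \<in> E2" by blast
    then have "e \<subseteq> set (a # A @ [b]) \<inter> set (b # B @ [a])"
      using path_edges_subset[OF e(1)[unfolded E1_def]] path_edges_subset[OF e(2)[unfolded E2_def]] by blast
    also have "\<dots> = {a, b}" using dist(1) by auto
    finally have "e \<subseteq> {a, b}" .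
    moreover have "card e = 2" using e X12 dist two by auto
    ultimately have "e = {a, b}" using neq card_subset_eq[of "{a, b}" e] by simp
    then have "A = []" "B = []"
      using end_edge[of a A b] end_edge[of b B a] e dist(1) by (auto simp: E1_def E2_def insert_commute)
    then show False using dist by simp
  qed
  have sub: "E1 \<subseteq> E" "E2 \<subseteq> E" "EP \<subseteq> E" using X12 dist Pd by (auto simp: EP_def)
  have dP: "E1 \<inter> EP = {}" "E2 \<inter> EP = {}" using X12 Pd by (auto simp: EP_def)
  have Qc: "set Q \<inter> set (a # A @ b # B) = {}" "distinct Q" "a \<notin> set Q" "b \<notin> set Q" using ab c(3) Pd by auto
  have vs: "set (a # A @ b # B) \<subseteq> V" "set Q \<subseteq> V" using c(1) ab(1) Pd(2) by (auto simp: graph_cycle_iff)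
  \<comment> \<open>If both were empty, the chord would be an edge of \<open>X\<close>. Thus the new
    cycles have length at least 3.\<close>
  have nA: "A \<noteq> [] \<or> Q \<noteq> []" using dP(1) ab by (auto simp: E1_def EP_def)
  have nB: "B \<noteq> [] \<or> Q \<noteq> []" using dP(2) ab by (auto simp: E2_def EP_def insert_commute)
  have revQ: "path_edges (b # rev Q @ [a]) = EP"
    using path_edges_rev[of P] by (simp add: ab EP_def)
  have C1: "cyc (E1 \<union> EP)"
    unfolding cyc_def
  proof (intro exI conjI)
    have ce: "cycle_edges (a # A @ b # rev Q) = E1 \<union> EP"
      using path_edges_append[of "a # A" b "rev Q @ [a]"] revQ by (simp add: cycle_edges_def E1_def)
    show "E1 \<union> EP = cycle_edges (a # A @ b # rev Q)" using ce by simp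
    show "graph_cycle V E (a # A @ b # rev Q)"
      unfolding graph_cycle_iff ce
    proof (intro conjI)
      show "set (a # A @ b # rev Q) \<subseteq> V" using vs by auto
      show "distinct (a # A @ b # rev Q)" using dist(1) Qc by auto
      show "3 \<le> length (a # A @ b # rev Q)" using nA by (cases A; cases Q) auto
    qed (use sub in auto)
  qed
  have C2: "cyc (E2 \<union> EP)"
    unfolding cyc_def
  proof (intro exI conjI)
    have ce: "cycle_edges (b # B @ a # Q) = E2 \<union> EP"
      using path_edges_append[of "b # B" a "Q @ [b]"] by (simp add: cycle_edges_def E2_def EP_def ab)
    show "E2 \<union> EP = cycle_edges (b # B @ a # Q)" using ce by simp
    show "graph_cycle V E (b # B @ a # Q)"
      unfolding graph_cycle_iff ce
    proof (intro conjI)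
      show "set (b # B @ a # Q) \<subseteq> V" using vs by auto
      show "distinct (b # B @ a # Q)" using dist(1) Qc by auto
      show "3 \<le> length (b # B @ a # Q)" using nB by (cases B; cases Q) auto
    qed (use sub in auto)
  qed
  obtain c1 where c1: "arc c1" "pathstart c1 = p a" "pathfinish c1 = p b" "path_image c1 = im E1"
    using arc_path[of "a # A @ [b]"] dist(1) sub by (auto simp: E1_def)
  obtain c2 where c2: "arc c2" "pathstart c2 = p a" "pathfinish c2 = p b" "path_image c2 = im E2"
  proof -
    obtain h where h: "arc h" "pathstart h = p b" "pathfinish h = p a" "path_image h = im E2"
      using arc_path[of "b # B @ [a]"] dist(1) sub by (auto simp: E2_def)
    then show thesis using that[of "reversepath h"] by (simp add: arc_reversepath)
  qed
  obtain c3 where c3: "arc c3" "pathstart c3 = p a" "pathfinish c3 = p b" "path_image c3 = im EP"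
    using arc_path[of P] Pd sub by (auto simp: EP_def ab)
  have pab: "p a \<noteq> p b" using neq inj_p dist ab by (meson inj_onD subsetD)
  have ends: "{p a, p b} \<subseteq> im E1" "{p a, p b} \<subseteq> im E2" "{p a, p b} \<subseteq> im EP"
    using vertex_im[OF sub(1)] vertex_im[OF sub(2)] vertex_im[OF sub(3)] U1 U2 UP ab by auto
  have i12: "im E1 \<inter> im E2 = {p a, p b}"
    using im_Int[OF sub(1,2) disj] U1 U2 dist(1) ends by auto
  have PX: "set P \<inter> \<Union>X = {a, b}" using ab by auto
  have i1P: "im E1 \<inter> im EP = {p a, p b}"
  proof -
    have "\<Union>E1 \<inter> \<Union>EP \<subseteq> {a, b}" using PX UP X12 by blast
    then have "im E1 \<inter> im EP \<subseteq> p ` {a, b}"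
      by (rule subset_trans[OF im_Int[OF sub(1,3) dP(1)] image_mono])
    moreover have "{p a, p b} \<subseteq> im E1 \<inter> im EP" using ends(1,3) by (rule Int_greatest)
    ultimately show ?thesis by simp
  qed
  have i2P: "im E2 \<inter> im EP = {p a, p b}"
  proof -
    have "\<Union>E2 \<inter> \<Union>EP \<subseteq> {a, b}" using PX UP X12 by blast
    then have "im E2 \<inter> im EP \<subseteq> p ` {a, b}"
      by (rule subset_trans[OF im_Int[OF sub(2,3) dP(2)] image_mono])
    moreover have "{p a, p b} \<subseteq> im E2 \<inter> im EP" using ends(2,3) by (rule Int_greatest)
    ultimately show ?thesis by simp
  qed
  have "inside (im E1 \<union> im EP) \<union> inside (im E2 \<union> im EP) \<union> (im EP - {p a, p b}) = inside (im E1 \<union> im E2)"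
    by (rule split_inside_simple_closed_curve[of c1 "p a" "p b" c2 c3])
      (use c1 c2 c3 arc_imp_simple_path pab i12 i1P i2P Pd(5) in \<open>simp_all add: ins_def X12 im_Un EP_def\<close>)
  then have le: "ins (E1 \<union> EP) \<subseteq> ins X" "ins (E2 \<union> EP) \<subseteq> ins X" by (auto simp: ins_def im_Un X12)
  obtain z where z: "z \<in> im EP" "z \<in> ins X" using Pd(5) by (auto simp: EP_def)
  then have "z \<notin> ins (E1 \<union> EP)" "z \<notin> ins (E2 \<union> EP)" using ins_im[of "E1 \<union> EP"] ins_im[of "E2 \<union> EP"] by (auto simp: im_Un)
  then have lt: "ins (E1 \<union> EP) \<subset> ins X" "ins (E2 \<union> EP) \<subset> ins X" using le z by auto
  have "X = sym_diff (E1 \<union> EP) (E2 \<union> EP)" using X12 disj dP by blast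
  then show ?thesis using C1 C2 lt by blast
qed

text \<open>An edge \<open>f\<close> of \<open>X\<close> that meets the inside of \<open>Y\<close>
  is extended along \<open>X\<close> in both directions until \<open>Y\<close> is reached. The two
  vertices found are distinct because the common edge provides two vertices of \<open>Y\<close> on
  \<open>X\<close>. If an edge of this path were in \<open>Y\<close>, the path would be that edge,
  which is \<open>f\<close>.\<close>

lemma shared_edge_chord:
  assumes X: "cyc X" and Y: "cyc Y" and e: "e \<in> X" "e \<in> Y" and meet: "im X \<inter> ins Y \<noteq> {}"
  shows "\<exists>P. chord Y P"
proof -
  obtain f where f: "f \<in> X" "path_image (\<gamma> f) \<inter> ins Y \<noteq> {}" using meet by (auto simp: im_def)
  have fY: "f \<notin> Y" using f ins_im[of Y] by (auto simp: im_def)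
  obtain c0 where c0: "graph_cycle V E c0" "X = cycle_edges c0" using X by (auto simp: cyc_def)
  then obtain c where c: "graph_cycle V E c" "cycle_edges c = X" "f = {last c, hd c}"
    using cycle_at_edge[of V E c0 f] f by metis
  have cd: "distinct c" "3 \<le> length c" "X \<subseteq> E" "set c \<subseteq> V" using c by (auto simp: graph_cycle_iff)
  then have UX: "\<Union>X = set c" using Union_cycle_edges[of c] c by simp
  have two: "card e = 2" if "e \<in> E" for e using graph that by (simp add: simple_graph_def)
  obtain s t where st: "e = {s, t}" "s \<noteq> t" using two[of e] e cd by (meson card_2_iff subsetD)
  let ?W = "\<Union>Y"
  have W: "s \<in> ?W" "t \<in> ?W" "s \<in> set c" "t \<in> set c" using st e UX by auto
  then have "\<exists>v\<in>set c. v \<in> ?W" by blast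
  from split_list_first_prop[OF this]
  obtain Q1 a R where a: "c = Q1 @ a # R" "a \<in> ?W" "\<forall>q\<in>set Q1. q \<notin> ?W" by blast
  \<comment> \<open>\<open>a\<close> is the first vertex of \<open>Y\<close> on \<open>c\<close>,
    and at least one end of \<open>e\<close> differs from it.\<close>
  have "\<exists>v\<in>set R. v \<in> ?W" using W a st by auto
  from split_list_last_prop[OF this]
  obtain M b Q2 where b: "R = M @ b # Q2" "b \<in> ?W" "\<forall>q\<in>set Q2. q \<notin> ?W" by blast
  define P where "P = b # (Q2 @ Q1) @ [a]"
  have cs: "c = (Q1 @ a # M) @ (b # Q2)" using a(1) b(1) by simp
  have ed: "X = path_edges P \<union> path_edges (a # M @ [b])"
  proof -
    have "X = cycle_edges ((b # Q2) @ (Q1 @ a # M))"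
      unfolding c(2)[symmetric] cs by (rule cycle_edges_rotate)
    also have "\<dots> = path_edges ((b # Q2 @ Q1) @ a # (M @ [b]))" by (simp add: cycle_edges_def)
    also have "\<dots> = path_edges ((b # Q2 @ Q1) @ [a]) \<union> path_edges (a # M @ [b])"
      by (rule path_edges_append)
    finally show ?thesis by (simp add: P_def)
  qed
  have "f \<in> path_edges ((b # Q2) @ (Q1 @ [a]))"
    using c(3) cs by (subst path_edges_append2) (auto simp: hd_append)
  then have fP: "f \<in> path_edges P" by (simp add: P_def)
  have dP: "distinct P" using cd(1) cs by (auto simp: P_def)
  have "path_edges P \<inter> Y = {}"
  proof (rule ccontr)
    assume "path_edges P \<inter> Y \<noteq> {}"
    then obtain e' where e': "e' \<in> path_edges P" "e' \<in> Y" by blast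
    then have "e' \<subseteq> set P \<inter> ?W" using path_edges_subset[of e' P] by auto
    also have "\<dots> \<subseteq> {b, a}" using a(3) b(3) unfolding P_def set_append list.set by blast
    finally have "e' \<subseteq> {b, a}" .
    moreover have "card e' = 2" using e' ed cd two by auto
    moreover have "b \<noteq> a" using dP by (auto simp: P_def)
    ultimately have "e' = {b, a}" using card_subset_eq[of "{b, a}" e'] by simp
    then have Q: "Q2 @ Q1 = []" using end_edge[of b "Q2 @ Q1" a] e' dP by (simp add: P_def)
    then have "f = e'" using fP \<open>e' = {b, a}\<close> by (simp add: P_def)
    then show False using fY e' by simp
  qed
  moreover have "im (path_edges P) \<inter> ins Y \<noteq> {}" using fP f by (auto simp: im_def)
  moreover have "set P \<subseteq> V" "path_edges P \<subseteq> E" using cs cd ed by (auto simp: P_def)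
  ultimately have "chord Y P"
    unfolding chord_def
  proof (intro conjI exI)
    show "P = b # (Q2 @ Q1) @ [a]" by (fact P_def)
    show "set (Q2 @ Q1) \<inter> ?W = {}" using a(3) b(3) by auto
  qed (use dP a(2) b(2) in \<open>simp_all only: not_False_eq_True\<close>)
  then show ?thesis by blast
qed

section \<open>Facial cycles\<close>

definition facial where "facial X \<longleftrightarrow> cyc X \<and> (\<forall>P. \<not> chord X P)"

text \<open>Neither curve enters the inside of the other, as that would give a chord. So connected
  insides that meet contain each other, and equal insides have equal frontiers and hence the same
  edges.\<close>

lemma facial_disjoint:
  assumes X: "facial X" and Y: "facial Y" and e: "e \<in> X" "e \<in> Y" and neq: "X \<noteq> Y"
  shows "ins X \<inter> ins Y = {}"
proof (rule ccontr)
  assume meet: "ins X \<inter> ins Y \<noteq> {}"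
  have c: "cyc X" "cyc Y" using X Y by (auto simp: facial_def)
  have sub: "ins A \<subseteq> ins B"
    if "cyc A" "cyc B" "im B \<inter> ins A = {}" "ins A \<inter> ins B \<noteq> {}" for A B
  proof -
    note jA = cyc_jordan[OF that(1)] and jB = cyc_jordan[OF that(2)]
    have "ins A \<subseteq> ins B \<union> outside (im B)" using that(3) jB(5) by blast
    then have "outside (im B) \<inter> ins A = {}"
      using connectedD[OF jA(3) jB(2,4)] jB(7) that(4) by blast
    then show ?thesis using \<open>ins A \<subseteq> ins B \<union> outside (im B)\<close> by blast
  qed
  have "im X \<inter> ins Y = {}" using shared_edge_chord[OF c e] Y by (auto simp: facial_def)
  moreover have "im Y \<inter> ins X = {}" using shared_edge_chord[OF c(2,1) e(2,1)] X by (auto simp: facial_def)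
  ultimately have "ins X = ins Y" using sub[OF c] sub[OF c(2,1)] meet by blast
  then have "im X = im Y" using cyc_jordan(6)[OF c(1)] cyc_jordan(6)[OF c(2)] by simp
  then have "X = Y" using im_subset_iff cyc_E c by (metis subset_antisym subset_refl)
  with neq show False by simp
qed

text \<open>Near an edge \<open>e\<close> the winding numbers of two cycles through \<open>e\<close> differ by a constant, so
  there is no room for three disjoint insides at \<open>e\<close>.\<close>

lemma no_three_facial:
  assumes F: "facial X" "facial Y" "facial Z" and e: "e \<in> X" "e \<in> Y" "e \<in> Z"
    and neq: "X \<noteq> Y" "X \<noteq> Z" "Y \<noteq> Z"
  shows False
proof -
  have c: "cyc X" "cyc Y" "cyc Z" using F by (auto simp: facial_def)
  have dis: "ins X \<inter> ins Y = {}" "ins X \<inter> ins Z = {}" "ins Y \<inter> ins Z = {}"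
    using facial_disjoint F e neq by blast+
  have eE: "e \<in> E" using c e cyc_E by blast
  obtain a b g h where X: "e = {a, b}" "arc g" "pathstart g = p a" "pathfinish g = p b"
    "path_image g = path_image (\<gamma> e)"
    "arc h" "pathstart h = p b" "pathfinish h = p a" "path_image h = im (X - {e})"
    "simple_path (g +++ h)" "path_image (g +++ h) = im X"
    by (rule cyc_edge_arc[OF c(1) e(1)])
  obtain a' b' g' h' where Y': "e = {a', b'}" "arc g'" "pathstart g' = p a'" "pathfinish g' = p b'"
    "path_image g' = path_image (\<gamma> e)"
    "arc h'" "pathstart h' = p b'" "pathfinish h' = p a'" "path_image h' = im (Y - {e})"
    by (rule cyc_edge_arc[OF c(2) e(2)])
  have Yins: "path_image g \<union> im (Y - {e}) = im Y" using e X(5) im_insert[of e "Y - {e}"] by (simp add: insert_absorb)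
  \<comment> \<open>The rest of \<open>Y\<close>, directed such that both closed curves run through
    \<open>g\<close> in the same direction.\<close>
  obtain k where k: "arc k" "pathstart k = p b" "pathfinish k = p a" "path_image k = im (Y - {e})"
  proof (cases "a = a'")
    case True
    then have "b = b'" using X(1) Y'(1) by (auto simp: doubleton_eq_iff)
    then show thesis using that[of h'] True Y' by simp
  next
    case False
    then have "a = b'" "b = a'" using X(1) Y'(1) by (auto simp: doubleton_eq_iff)
    then show thesis using that[of "reversepath h'"] Y' by (simp add: arc_reversepath)
  qed
  have paths: "path g" "path h" "path k" using X(2,6) k(1) by (auto simp: arc_def)
  let ?S = "im (X - {e}) \<union> im (Y - {e})"
  have sub: "X - {e} \<subseteq> E" "Y - {e} \<subseteq> E" using c cyc_E by blast+
  have "mid e \<notin> ?S" using mid_in_im[OF sub(1) eE] mid_in_im[OF sub(2) eE] by auto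
  moreover have "closed ?S" using compact_im[OF sub(1)] compact_im[OF sub(2)] by (intro closed_Un compact_imp_closed)
  ultimately obtain r where r: "0 < r" "ball (mid e) r \<inter> ?S = {}"
    by (metis Compl_iff open_Compl open_contains_ball disjoint_eq_subset_Compl)
  have near: "\<exists>z. z \<in> ball (mid e) r \<and> z \<in> ins T" if "cyc T" "e \<in> T" for T
  proof -
    have "mid e \<in> frontier (ins T)"
      using cyc_jordan(6)[OF that(1)] mid_in_im[OF cyc_E[OF that(1)] eE] that(2) by simp
    then have "mid e \<in> closure (ins T)" by (simp add: frontier_def)
    then show ?thesis using r(1) by (auto simp: closure_approachable dist_commute)
  qed
  \<comment> \<open>The cycle \<open>Z\<close> provides a point near \<open>e\<close> that is
    outside both \<open>X\<close> and \<open>Y\<close>.\<close>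
  obtain x z where x: "x \<in> ball (mid e) r" "x \<in> ins X" and z: "z \<in> ball (mid e) r" "z \<in> ins Z"
    using near[OF c(1) e(1)] near[OF c(3) e(3)] by blast
  have out: "w \<in> outside (im T)" if "cyc T" "w \<notin> ins T" "w \<notin> im T" for T w
    using cyc_jordan(5)[OF that(1)] that(2,3) by blast
  have gZ: "path_image g \<subseteq> im Z" "path_image g \<subseteq> im X" using X(5) e by (auto simp: im_def)
  have xg: "x \<notin> path_image g" using gZ(2) x ins_im[of X] by blast
  have zg: "z \<notin> path_image g" using gZ(1) z ins_im[of Z] by blast
  have hk: "w \<notin> path_image h" "w \<notin> path_image k" if "w \<in> ball (mid e) r" for w
    using r that X(9) k(4) by auto
  have loopX: "pathfinish (g +++ h) = pathstart (g +++ h)" and loopY: "pathfinish (g +++ k) = pathstart (g +++ k)"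
    using X k by auto
  have imY: "path_image (g +++ k) = im Y" using Yins X(4) k by (simp add: path_image_join)
  have pX: "path (g +++ h)" and pY: "path (g +++ k)" using paths X k by auto
  have WX: "winding_number (g +++ h) w = winding_number g w + winding_number h w"
    and WY: "winding_number (g +++ k) w = winding_number g w + winding_number k w"
    if "w \<in> ball (mid e) r" "w \<notin> path_image g" for w
    using winding_number_join[OF paths(1) that(2) paths(2) hk(1)[OF that(1)]]
      winding_number_join[OF paths(1) that(2) paths(3) hk(2)[OF that(1)]] X k by simp_all
  \<comment> \<open>Inside the ball the difference of the winding numbers of the two cycles is that
    of \<open>l\<close>, which avoids the ball; so it is constant there. At \<open>x\<close> just
    one of them is 0, at \<open>z\<close> both are.\<close>
  define l where "l = h +++ reversepath k"
  have Wl: "winding_number l w = winding_number h w - winding_number k w" if "w \<in> ball (mid e) r" for w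
    unfolding l_def
    using winding_number_join[OF paths(2) hk(1)[OF that], of "reversepath k"] hk(2)[OF that] paths(3) X k
    by (simp add: winding_number_reversepath)
  have "winding_number l constant_on ball (mid e) r"
  proof (rule winding_number_constant)
    show "path l" "pathfinish l = pathstart l" using paths X k by (auto simp: l_def)
    show "ball (mid e) r \<inter> path_image l = {}"
      using r(2) X k paths by (auto simp: l_def path_image_join)
  qed (rule connected_ball)
  then have const: "winding_number l x = winding_number l z"
    using x(1) z(1) by (auto simp: constant_on_def)
  have "winding_number (g +++ h) x \<noteq> 0"
    using simple_closed_path_norm_winding_number_inside[OF X(10), of x] x(2) X(11) by (auto simp: ins_def)
  moreover have "winding_number (g +++ k) x = 0"
  proof (rule winding_number_zero_in_outside[OF pY loopY])
    have "x \<notin> im Y" using Yins xg hk(2)[OF x(1)] k(4) by blast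
    then show "x \<in> outside (path_image (g +++ k))" using out[OF c(2)] dis(1) x(2) imY by auto
  qed
  moreover have "winding_number (g +++ k) z = 0"
  proof (rule winding_number_zero_in_outside[OF pY loopY])
    have "z \<notin> im Y" using Yins zg hk(2)[OF z(1)] k(4) by blast
    then show "z \<in> outside (path_image (g +++ k))" using out[OF c(2)] dis(3) z(2) imY by auto
  qed
  moreover have "winding_number (g +++ h) z = 0"
  proof (rule winding_number_zero_in_outside[OF pX loopX])
    have "im X = path_image g \<union> path_image h" using X(4,7,11) by (simp add: path_image_join)
    then have "z \<notin> im X" using zg hk(1)[OF z(1)] by blast
    then show "z \<in> outside (path_image (g +++ h))" using out[OF c(1)] dis(2) z(2) X(11) by auto
  qed
  ultimately have W: "winding_number g x + winding_number h x \<noteq> 0" "winding_number g x + winding_number k x = 0"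
    "winding_number g z + winding_number k z = 0" "winding_number g z + winding_number h z = 0"
    using WX[OF x(1) xg] WY[OF x(1) xg] WX[OF z(1) zg] WY[OF z(1) zg] by simp_all
  from W(3,4) have "winding_number h z = winding_number k z" by (metis add_left_cancel)
  then have "winding_number h x = winding_number k x" using const Wl[OF x(1)] Wl[OF z(1)] by simp
  then show False using W(1,2) by simp
qed

lemma finite_cyc: "finite {X. cyc X}"
proof -
  have "{X. cyc X} \<subseteq> Pow E" using cyc_E by auto
  then show ?thesis using simple_graph_finite(2)[OF graph] by (meson finite_Pow_iff finite_subset)
qed

text \<open>A chord writes \<open>X\<close> as the sum of two cycles with strictly smaller insides.
  For these, the number of cycles whose inside is contained in theirs is smaller, since
  \<open>X\<close> itself no longer counts.\<close>

lemma cyc_span: "cyc X \<Longrightarrow> X \<in> sym_span {F. facial F}"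
proof (induction "card {Y. cyc Y \<and> ins Y \<subseteq> ins X}" arbitrary: X rule: less_induct)
  case less
  show ?case
  proof (cases "facial X")
    case True
    then show ?thesis by (simp add: sym_span_base)
  next
    case False
    then obtain P where "chord X P" using less.prems by (auto simp: facial_def)
    from chord_split[OF less.prems this]
    obtain X' X'' where s: "cyc X'" "cyc X''" "X = sym_diff X' X''" "ins X' \<subset> ins X" "ins X'' \<subset> ins X"
      by (elim exE conjE)
    have lt: "card {Y. cyc Y \<and> ins Y \<subseteq> ins Z} < card {Y. cyc Y \<and> ins Y \<subseteq> ins X}" if "ins Z \<subset> ins X" for Z
    proof (rule psubset_card_mono)
      show "finite {Y. cyc Y \<and> ins Y \<subseteq> ins X}" using finite_cyc by simp
      have "X \<in> {Y. cyc Y \<and> ins Y \<subseteq> ins X}" "X \<notin> {Y. cyc Y \<and> ins Y \<subseteq> ins Z}"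
        using less.prems that by auto
      then show "{Y. cyc Y \<and> ins Y \<subseteq> ins Z} \<subset> {Y. cyc Y \<and> ins Y \<subseteq> ins X}" using that by blast
    qed
    have "X' \<in> sym_span {F. facial F}" "X'' \<in> sym_span {F. facial F}"
      using less.hyps[OF lt[OF s(4)] s(1)] less.hyps[OF lt[OF s(5)] s(2)] by simp_all
    then show ?thesis unfolding s(3) by (rule sym_span_sym_diff)
  qed
qed

lemma card_facial_edge: "card {X. facial X \<and> e \<in> X} \<le> 2"
proof (rule ccontr)
  assume "\<not> ?thesis"
  then obtain T where T: "T \<subseteq> {X. facial X \<and> e \<in> X}" "card T = 3"
    using obtain_subset_with_card_n[of 3 "{X. facial X \<and> e \<in> X}"] by auto
  then obtain X Y Z where "T = {X, Y, Z}" "X \<noteq> Y" "Y \<noteq> Z" "X \<noteq> Z" by (auto simp: card_3_iff)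
  then show False using no_three_facial[of X Y Z e] T by auto
qed

text \<open>Double counting of pairs of an edge and a facial cycle containing it gives
  \<open>g * (|E| - |V| + 1) \<le> 2 * |E|\<close>. The number \<open>g\<close> is real because the
  girth bound to be used is a fraction.\<close>

lemma girth_edge_bound:
  fixes g :: real
  assumes "V \<noteq> {}" "0 \<le> g" and g: "\<And>c. graph_cycle V E c \<Longrightarrow> g \<le> real (length c)"
  shows "(g - 2) * real (card E) \<le> g * (real (card V) - 1)"
proof -
  let ?F = "{X. facial X}"
  have finF: "finite ?F" using finite_cyc by (rule finite_subset[rotated]) (auto simp: facial_def)
  have finE: "finite E" using simple_graph_finite[OF graph] by simp
  have "card E + 1 \<le> card V + card ?F"
    by (rule cycle_generators_card[OF graph assms(1) finF]) (auto intro!: cyc_span simp: cyc_def)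
  then have "real (card E + 1) \<le> real (card V + card ?F)" by (rule of_nat_mono)
  then have 1: "g * (real (card E) + 1 - real (card V)) \<le> g * real (card ?F)"
    using assms(2) by (intro mult_left_mono) auto
  have "(\<Sum>X\<in>?F. g) \<le> (\<Sum>X\<in>?F. real (card X))"
  proof (rule sum_mono)
    fix X assume "X \<in> ?F"
    then obtain c where c: "graph_cycle V E c" "X = cycle_edges c" by (auto simp: facial_def cyc_def)
    then have "card X = length c" using card_cycle_edges by (auto simp: graph_cycle_iff)
    then show "g \<le> real (card X)" using g[OF c(1)] by simp
  qed
  then have 2: "g * real (card ?F) \<le> real (\<Sum>X\<in>?F. card X)" by (simp add: mult.commute)
  have "(\<Sum>X\<in>?F. card X) = (\<Sum>X\<in>?F. card {e \<in> E. e \<in> X})"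
  proof (rule sum.cong[OF refl])
    fix X assume "X \<in> ?F"
    then have "{e \<in> E. e \<in> X} = X" using cyc_E by (auto simp: facial_def)
    then show "card X = card {e \<in> E. e \<in> X}" by simp
  qed
  also have "\<dots> = (\<Sum>e\<in>E. card {X \<in> ?F. e \<in> X})"
    using sum.swap_restrict[OF finF finE, of "\<lambda>_ _. 1::nat" "\<lambda>X e. e \<in> X"] by simp
  also have "\<dots> \<le> (\<Sum>e\<in>E. 2)" using card_facial_edge by (intro sum_mono) simp
  finally have "real (\<Sum>X\<in>?F. card X) \<le> 2 * real (card E)" using finE by (simp flip: of_nat_sum)
  then show ?thesis using 1 2 by (simp add: algebra_simps)
qed

end

text \<open>Drawings restrict to induced subgraphs, and cycles of a subgraph are cycles of the
  graph. The comparison in \<open>ereal\<close> includes forests, whose girth is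
  \<infinity>.\<close>

lemma planar_girth_edge_bound:
  fixes g :: real
  assumes graph: "simple_graph V E" and "planar V E" and X: "X \<subseteq> V" "X \<noteq> {}"
    and g: "0 \<le> g" "ereal g \<le> ereal_of_enat (girth V E)"
  shows "(g - 2) * real (card (E \<inter> Pow X)) \<le> g * (real (card X) - 1)"
proof -
  obtain p \<gamma> where pg: "plane_drawing V E p \<gamma>" using assms by (auto simp: planar_def)
  have sg: "simple_graph X (E \<inter> Pow X)"
    using graph X finite_subset[of X V] by (auto simp: simple_graph_def)
  have "inj_on p X" using pg X inj_on_subset by (auto simp: plane_drawing_def)
  moreover have "\<forall>e\<in>E. (path_image (\<gamma> e) - p ` e) \<inter> p ` V = {}"
    using pg by (simp add: plane_drawing_def)
  then have "\<forall>e\<in>E. (path_image (\<gamma> e) - p ` e) \<inter> p ` X = {}"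
    using image_mono[OF X(1), of p] by (meson disjoint_iff subsetD)
  ultimately have "plane_drawing X (E \<inter> Pow X) p \<gamma>"
    using pg by (simp add: plane_drawing_def)
  then interpret drawing X "E \<inter> Pow X" p \<gamma> using sg by unfold_locales
  show ?thesis
  proof (rule girth_edge_bound[OF X(2) g(1)])
    fix c assume "graph_cycle X (E \<inter> Pow X) c"
    then have "graph_cycle V E c" using X by (auto simp: graph_cycle_iff)
    then have "girth V E \<le> enat (length c)" unfolding girth_def by (intro Inf_lower) blast
    then have "ereal_of_enat (girth V E) \<le> ereal (real (length c))"
      by (metis ereal_of_enat_le_iff ereal_of_enat_simps(1))
    then have "ereal g \<le> ereal (real (length c))" using g(2) order_trans by blast
    then show "g \<le> real (length c)" by simp
  qed
qed

lemma choice_number_square_planar: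
  fixes V :: "'a set"
  assumes graph: "simple_graph V E" and max: "max_degree V E = \<Delta>" and \<Delta>: "6 \<le> \<Delta>"
    and planar: "planar V E" and girth: "ereal (7 + 12 / (real \<Delta> - 2)) \<le> ereal_of_enat (girth V E)"
  shows "choice_number V (square_edges V E) = \<Delta> + 1"
proof (rule choice_number_square[OF graph max \<Delta>])
  fix X assume X: "X \<subseteq> V" "X \<noteq> {}"
  define g where "g = 7 + 12 / (real \<Delta> - 2)"
  have pos: "0 < real \<Delta> - 2" using \<Delta> by simp
  have "0 \<le> g" using pos by (simp add: g_def)
  then have "(g - 2) * real (card (E \<inter> Pow X)) \<le> g * (real (card X) - 1)"
    using girth by (intro planar_girth_edge_bound[OF graph planar X]) (auto simp: g_def)
  then have "(real \<Delta> - 2) * ((g - 2) * real (card (E \<inter> Pow X))) \<le> (real \<Delta> - 2) * (g * (real (card X) - 1))"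
    using pos by (intro mult_left_mono) auto
  \<comment> \<open>Multiplication by \<Delta> - 2 turns \<open>g\<close> and \<open>g - 2\<close>
    into numerator and denominator of half the density bound (14\<Delta> - 4)/(5\<Delta> +
    2).\<close>
  moreover have "(real \<Delta> - 2) * g = 7 * real \<Delta> - 2" using pos by (simp add: g_def field_simps)
  moreover from this have "(real \<Delta> - 2) * (g - 2) = 5 * real \<Delta> + 2" by (simp add: algebra_simps)
  ultimately have "(5 * real \<Delta> + 2) * real (card (E \<inter> Pow X)) \<le> (7 * real \<Delta> - 2) * (real (card X) - 1)"
    by (simp only: mult.assoc[symmetric])
  \<comment> \<open>The \<open>- 1\<close> gives the strict inequality, so the girth may equal its
    bound.\<close>
  also have "\<dots> < (7 * real \<Delta> - 2) * real (card X)" using \<Delta> by (simp add: algebra_simps)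
  finally have "real_of_int ((5 * int \<Delta> + 2) * (2 * int (card (E \<inter> Pow X)))) < real_of_int ((14 * int \<Delta> - 4) * int (card X))"
    by (simp add: algebra_simps)
  then show "(5 * int \<Delta> + 2) * (2 * int (card (E \<inter> Pow X))) < (14 * int \<Delta> - 4) * int (card X)"
    by (simp only: of_int_less_iff)
qed

theorem mainTheorem1:
  fixes V :: "'a set" and E :: "'a set set" and \<Delta> :: nat
  assumes "simple_graph V E"
    and "max_degree V E = \<Delta>"
    and "\<Delta> \<ge> 6"
  shows "(mad V E < 2 + (4 * real \<Delta> - 8) / (5 * real \<Delta> + 2) \<longrightarrow>
            choice_number V (square_edges V E) = \<Delta> + 1) \<and>
         (planar V E \<and> ereal_of_enat (girth V E) \<ge> ereal (7 + 12 / (real \<Delta> - 2)) \<longrightarrow>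
            choice_number V (square_edges V E) = \<Delta> + 1)"
  using choice_number_square_mad[OF assms] choice_number_square_planar[OF assms] by blast

end
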